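(* Let $\mathbb{F}$ be a field of characteristic $0$ and let $\mathcal{W}(0)$ be the Lie conformal algebra that is the free $\mathbb{F}[\partial]$-module on $L,H$ with $[L_\lambda L]=(\partial+2\lambda)L$, $[L_\lambda H]=(\partial+\lambda)H$, $[H_\lambda L]=\lambda H$, $[H_\lambda H]=0$. Then the basic and reduced cohomology of $\mathcal{W}(0)$ with coefficients in its adjoint module satisfy, for $q\ge 0$, $$\dim\widetilde{\mathrm{H}}^q(\mathcal{W}(0),\mathcal{W}(0))=\begin{cases}1,& q=1,3,\\ 2,& q=2,\\ 0,&\text{otherwise,}\end{cases}\qquad \dim\mathrm{H}^q(\mathcal{W}(0),\mathcal{W}(0))=\begin{cases}3,& q=1,2,\\ 1,& q=0,3,\\ 0,&\text{otherwise.}\end{cases}$$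
   Context: Lie conformal algebra (LCA): an $\mathbb{F}[\partial]$-module $\mathcal{A}$ with an $\mathbb{F}$-bilinear $\lambda$-bracket $\mathcal{A}\otimes\mathcal{A}\to\mathcal{A}[\lambda]$, $a\otimes b\mapsto[a_\lambda b]$, such that $[\partial a_\lambda b]=-\lambda[a_\lambda b]$, $[a_\lambda\partial b]=(\partial+\lambda)[a_\lambda b]$, $[a_\lambda b]=-[b_{-\lambda-\partial}a]$, and $[a_\lambda[b_\mu c]]=[[a_\lambda b]_{\lambda+\mu}c]+[b_\mu[a_\lambda c]]$. The $\lambda$-bracket on $\mathbb{F}[\partial]$-generators determines it everywhere. An $\mathcal{A}$-module is an $\mathbb{F}[\partial]$-module $M$ with an $\mathbb{F}$-bilinear $\lambda$-action $a\otimes m\mapsto a_\lambda m\in M[\lambda]$ such that $(\partial a)_\lambda m=-\lambda a_\lambda m$, $a_\lambda(\partial m)=(\partial+\lambda)a_\lambda m$, $a_\lambda(b_\mu m)-b_\mu(a_\lambda m)=[a_\lambda b]_{\lambda+\mu}m$. The adjoint module is $M=\mathcal{A}$ with $a_\lambda m=[a_\lambda m]$. Write $\partial^M$ for the action of $\partial$ on $M$. Basic complex: for $q\ge 1$, $\widetilde{C}^q(\mathcal{A},M)$ is the space of $\mathbb{F}$-linear maps $f:\mathcal{A}^{\otimes q}\to M[\lambda_1,\dots,\lambda_q]$, $a_1\otimes\cdots\otimes a_q\mapsto f_{\lambda_1,\dots,\lambda_q}(a_1,\dots,a_q)$, with $f_{\lambda_1,\dots,\lambda_q}(a_1,\dots,\partial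 a_i,\dots,a_q)=-\lambda_i f_{\lambda_1,\dots,\lambda_q}(a_1,\dots,a_q)$ for all $i$, and skew-symmetric under simultaneous permutations of the $a_i$ and the $\lambda_i$. Also $\widetilde{C}^0(\mathcal{A},M)=M$. The differential is $$(\mathbf{d}f)_{\lambda_1,\dots,\lambda_{q+1}}(a_1,\dots,a_{q+1})=\sum_{k}(-1)^{k+1}a_{k\,\lambda_k}f_{\lambda_1,\dots,\hat\lambda_k,\dots,\lambda_{q+1}}(a_1,\dots,\hat a_k,\dots,a_{q+1})+\sum_{k<l}(-1)^{k+l}f_{\lambda_k+\lambda_l,\lambda_1,\dots,\hat\lambda_k,\dots,\hat\lambda_l,\dots,\lambda_{q+1}}([a_{k\,\lambda_k}a_l],a_1,\dots,\hat a_k,\dots,\hat a_l,\dots,a_{q+1}),$$ with $(\mathbf{d}m)_\lambda(a)=a_\lambda m$ for $m\in M$; hats denote omission, and polynomial coefficients in the $\lambda$'s are extended linearly. One has $\mathbf{d}^2=0$. Define $(\partial f)_{\lambda_1,\dots,\lambda_q}(a_1,\dots,a_q)=(\partial^M+\sum_{k=1}^q\lambda_k)f_{\lambda_1,\dots,\lambda_q}(a_1,\dots,a_q)$; then $\mathbf{d}\partial=\partial\mathbf{d}$. The reduced complex is $C^\bullet(\mathcal{A},M)=\widetilde{C}^\bullet(\mathcal{A},M)/\partial\widetilde{C}^\bullet(\mathcal{A},M)$. The basic cohomology $\widetilde{\mathrm{H}}^\bullet(\mathcal{A},M)$ is the cohomology of $\widetilde{C}^\bullet(\mathcal{A},M)$;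 the reduced cohomology $\mathrm{H}^\bullet(\mathcal{A},M)$ is the cohomology of $C^\bullet(\mathcal{A},M)$. Dimensions are over $\mathbb{F}$. *)

theory Defs
  imports
    "HOL-Library.Poly_Mapping"
    "HOL-Computational_Algebra.Polynomial"
    "HOL-Combinatorics.Permutations"
    "HOL-Algebra.AbelCoset"
    "HOL-Library.Product_Plus"
    "Jordan_Normal_Form.VS_Connect"
    "Jordan_Normal_Form.Char_Poly"
begin

section \<open>Polynomials in $\lambda_0, \lambda_1, \dots$ with coefficients in a module\<close>

text \<open>
  An \<open>F[\<partial>]\<close>-module is given by a scalar multiplication \<open>s :: 'f poly \<Rightarrow> 'm \<Rightarrow> 'm\<close>
  satisfying the locale \<^locale>\<open>Modules.module\<close>: \<open>\<partial>\<close> acts as \<open>s [:0, 1:]\<close> and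
  \<open>k \<in> F\<close> as \<open>s [:k:]\<close>.
  An element of \<open>'m mpol\<close> is a polynomial in the variables \<open>\<lambda>\<^sub>0, \<lambda>\<^sub>1, \<dots>\<close> with
  coefficients in \<open>'m\<close>; the keys are the exponent vectors.  The ring \<open>'f poly mpol\<close> is
  \<open>F[\<partial>][\<lambda>\<^sub>0, \<lambda>\<^sub>1, \<dots>]\<close>; it acts on \<open>'m mpol\<close>, so that factors such
  as \<open>\<partial> + \<lambda>\<^sub>0\<close> or \<open>- \<lambda>\<^sub>0 - \<partial>\<close> are elements of it.  Variables are
  numbered from 0.
\<close>

type_synonym 'm mpol = "(nat \<Rightarrow>\<^sub>0 nat) \<Rightarrow>\<^sub>0 'm"

definition const :: "'m::zero \<Rightarrow> 'm mpol" where
  "const m = Poly_Mapping.single 0 m"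

definition lmon :: "(nat \<Rightarrow>\<^sub>0 nat) \<Rightarrow> 'r::comm_ring_1 mpol" where
  "lmon \<alpha> = Poly_Mapping.single \<alpha> 1"

definition var :: "nat \<Rightarrow> 'r::comm_ring_1 mpol" where
  "var i = lmon (Poly_Mapping.single i 1)"

definition del :: "'f::field poly mpol" where
  "del = const [:0, 1:]"

definition pact :: "('r::comm_ring_1 \<Rightarrow> 'm::ab_group_add \<Rightarrow> 'm) \<Rightarrow> 'r mpol \<Rightarrow> 'm mpol \<Rightarrow> 'm mpol" where
  "pact s p u = (\<Sum>\<alpha>\<in>Poly_Mapping.keys p. \<Sum>\<beta>\<in>Poly_Mapping.keys u.
     Poly_Mapping.single (\<alpha> + \<beta>) (s (Poly_Mapping.lookup p \<alpha>) (Poly_Mapping.lookup u \<beta>)))"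

text \<open>\<open>subst s \<sigma> u\<close> replaces every \<open>\<lambda>\<^sub>i\<close> in \<open>u\<close> by \<open>\<sigma> i\<close>.\<close>

definition subst :: "('r::comm_ring_1 \<Rightarrow> 'm::ab_group_add \<Rightarrow> 'm) \<Rightarrow> (nat \<Rightarrow> 'r mpol) \<Rightarrow> 'm mpol \<Rightarrow> 'm mpol" where
  "subst s \<sigma> u = (\<Sum>\<alpha>\<in>Poly_Mapping.keys u.
     pact s (\<Prod>i\<in>Poly_Mapping.keys \<alpha>. \<sigma> i ^ Poly_Mapping.lookup \<alpha> i) (const (Poly_Mapping.lookup u \<alpha>)))"


section \<open>Lie conformal algebras and their modules\<close>

text \<open>
  Brackets and actions take values in \<open>'m poly\<close>, i.e. in \<open>M[\<lambda>]\<close>.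
  If \<open>P = \<Sum>\<^sub>n \<lambda>\<^sup>n m\<^sub>n\<close>, then \<open>poly_at s P p = \<Sum>\<^sub>n p\<^sup>n m\<^sub>n\<close>;
  when \<open>p\<close> involves \<open>\<partial>\<close>, the latter acts on the coefficients \<open>m\<^sub>n\<close>, as is the
  convention for \<open>[b\<^bsub>-\<lambda>-\<partial>\<^esub> a]\<close>.
\<close>

definition poly_at :: "('r::comm_ring_1 \<Rightarrow> 'm::ab_group_add \<Rightarrow> 'm) \<Rightarrow> 'm poly \<Rightarrow> 'r mpol \<Rightarrow> 'm mpol" where
  "poly_at s P p = (\<Sum>n\<le>degree P. pact s (p ^ n) (const (coeff P n)))"

text \<open>
  \<open>act_at s act w p u\<close> is \<open>w\<^bsub>p\<^esub> u\<close> for polynomials \<open>w\<close> (with coefficients in the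
  algebra) and \<open>u\<close> (with coefficients in the module): the \<open>\<lambda>\<close>-action extended
  linearly over the coefficients in the \<open>\<lambda>\<^sub>i\<close>.
\<close>

definition act_at ::
  "('r::comm_ring_1 \<Rightarrow> 'm::ab_group_add \<Rightarrow> 'm) \<Rightarrow> ('a::zero \<Rightarrow> 'm \<Rightarrow> 'm poly) \<Rightarrow> 'a mpol \<Rightarrow> 'r mpol \<Rightarrow> 'm mpol \<Rightarrow> 'm mpol" where
  "act_at s act w p u = (\<Sum>\<alpha>\<in>Poly_Mapping.keys w. \<Sum>\<beta>\<in>Poly_Mapping.keys u.
     pact s (lmon (\<alpha> + \<beta>)) (poly_at s (act (Poly_Mapping.lookup w \<alpha>) (Poly_Mapping.lookup u \<beta>)) p))"

text \<open>The variables \<open>\<lambda>\<close> and \<open>\<mu>\<close> of the axioms are \<open>var 0\<close> and \<open>var 1\<close>.\<close>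

locale lie_conformal_algebra = Modules.module s
  for s :: "'f::field poly \<Rightarrow> 'a::ab_group_add \<Rightarrow> 'a" +
  fixes br :: "'a \<Rightarrow> 'a \<Rightarrow> 'a poly"
  assumes br_add_left: "br (a + b) c = br a c + br b c"
    and br_add_right: "br a (b + c) = br a b + br a c"
    and br_scale_left: "br (s [:k:] a) b = map_poly (s [:k:]) (br a b)"
    and br_scale_right: "br a (s [:k:] b) = map_poly (s [:k:]) (br a b)"
    and br_del_left: "poly_at s (br (s [:0, 1:] a) b) (var 0) = pact s (- var 0) (poly_at s (br a b) (var 0))"
    and br_del_right: "poly_at s (br a (s [:0, 1:] b)) (var 0) = pact s (del + var 0) (poly_at s (br a b) (var 0))"
    and br_skew: "poly_at s (br a b) (var 0) = - poly_at s (br b a) (- var 0 - del)"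
    and br_jacobi:
      "act_at s br (const a) (var 0) (act_at s br (const b) (var 1) (const c)) =
         act_at s br (act_at s br (const a) (var 0) (const b)) (var 0 + var 1) (const c)
       + act_at s br (const b) (var 1) (act_at s br (const a) (var 0) (const c))"

locale lie_conformal_module =
  A: lie_conformal_algebra s br + M: Modules.module sM
  for s :: "'f::field poly \<Rightarrow> 'a::ab_group_add \<Rightarrow> 'a" and br :: "'a \<Rightarrow> 'a \<Rightarrow> 'a poly"
    and sM :: "'f poly \<Rightarrow> 'm::ab_group_add \<Rightarrow> 'm" +
  fixes act :: "'a \<Rightarrow> 'm \<Rightarrow> 'm poly"
  assumes act_add_left: "act (a + b) m = act a m + act b m"
    and act_add_right: "act a (m + n) = act a m + act a n"
    and act_scale_left: "act (s [:k:] a) m = map_poly (sM [:k:]) (act a m)"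
    and act_scale_right: "act a (sM [:k:] m) = map_poly (sM [:k:]) (act a m)"
    and act_del_left: "poly_at sM (act (s [:0, 1:] a) m) (var 0) = pact sM (- var 0) (poly_at sM (act a m) (var 0))"
    and act_del_right: "poly_at sM (act a (sM [:0, 1:] m)) (var 0) = pact sM (del + var 0) (poly_at sM (act a m) (var 0))"
    and act_jacobi:
      "act_at sM act (const a) (var 0) (act_at sM act (const b) (var 1) (const m))
       - act_at sM act (const b) (var 1) (act_at sM act (const a) (var 0) (const m)) =
         act_at sM act (act_at s br (const a) (var 0) (const b)) (var 0 + var 1) (const m)"

lemma (in lie_conformal_algebra) adjoint_module: "lie_conformal_module s br s br"
  by unfold_locales
    (use br_add_left br_add_right br_scale_left br_scale_right br_del_left br_del_right br_jacobi in auto)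


section \<open>The basic complex\<close>

text \<open>
  A \<open>q\<close>-cochain is a function on lists of length \<open>q\<close>, extended by 0 to all other lists;
  \<open>f [a\<^sub>1, \<dots>, a\<^sub>q]\<close> is a polynomial in \<open>\<lambda>\<^sub>0, \<dots>, \<lambda>\<^bsub>q-1\<^esub>\<close>.
  Linear maps on the tensor power are given as multilinear maps.  For \<open>q = 0\<close> this is a copy of
  \<open>M\<close>, with \<open>m\<close> corresponding to \<open>f [] = const m\<close>.
\<close>

definition cochains ::
  "('f::field poly \<Rightarrow> 'a::ab_group_add \<Rightarrow> 'a) \<Rightarrow> ('f poly \<Rightarrow> 'm::ab_group_add \<Rightarrow> 'm) \<Rightarrow> nat \<Rightarrow> ('a list \<Rightarrow> 'm mpol) set" where
  "cochains s sM q = {f.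
     (\<forall>as. length as \<noteq> q \<longrightarrow> f as = 0) \<and>
     (\<forall>as. length as = q \<longrightarrow> (\<forall>\<alpha>\<in>Poly_Mapping.keys (f as). Poly_Mapping.keys \<alpha> \<subseteq> {..<q})) \<and>
     (\<forall>as i a b. length as = q \<longrightarrow> i < q \<longrightarrow> f (as[i := a + b]) = f (as[i := a]) + f (as[i := b])) \<and>
     (\<forall>as i k. length as = q \<longrightarrow> i < q \<longrightarrow> f (as[i := s [:k:] (as ! i)]) = pact sM (const [:k:]) (f as)) \<and>
     (\<forall>as i. length as = q \<longrightarrow> i < q \<longrightarrow> f (as[i := s [:0, 1:] (as ! i)]) = pact sM (- var i) (f as)) \<and>
     (\<forall>as \<pi>. length as = q \<longrightarrow> \<pi> permutes {..<q} \<longrightarrow>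
        subst sM (\<lambda>i. var (\<pi> i)) (f (map (\<lambda>i. as ! \<pi> i) [0..<q])) = pact sM (of_int (sign \<pi>)) (f as))}"

text \<open>\<open>cochain_at sM f [p\<^sub>1, \<dots>, p\<^sub>q] as\<close> is \<open>f\<^bsub>p\<^sub>1,\<dots>,p\<^sub>q\<^esub>(as)\<close>.\<close>

definition cochain_at ::
  "('r::comm_ring_1 \<Rightarrow> 'm::ab_group_add \<Rightarrow> 'm) \<Rightarrow> ('a list \<Rightarrow> 'm mpol) \<Rightarrow> 'r mpol list \<Rightarrow> 'a list \<Rightarrow> 'm mpol" where
  "cochain_at sM f ps as = subst sM (\<lambda>i. ps ! i) (f as)"

text \<open>The same with a polynomial \<open>w\<close> in the first argument, extended linearly over its coefficients.\<close>

definition cochain_at_poly ::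
  "('r::comm_ring_1 \<Rightarrow> 'm::ab_group_add \<Rightarrow> 'm) \<Rightarrow> ('a list \<Rightarrow> 'm mpol) \<Rightarrow> 'r mpol list \<Rightarrow> 'a::zero mpol \<Rightarrow> 'a list \<Rightarrow> 'm mpol" where
  "cochain_at_poly sM f ps w as =
     (\<Sum>\<alpha>\<in>Poly_Mapping.keys w. pact sM (lmon \<alpha>) (cochain_at sM f ps (Poly_Mapping.lookup w \<alpha> # as)))"

text \<open>
  \<open>nths xs (- {k})\<close> omits the entry number \<open>k\<close>.  Positions are counted from 0, whence the sign
  \<open>(-1)\<^sup>k\<close> in the first sum; in the second sum the parity of \<open>k + l\<close> is unaffected.
\<close>

definition differential ::
  "('f::field poly \<Rightarrow> 'a::ab_group_add \<Rightarrow> 'a) \<Rightarrow> ('a \<Rightarrow> 'a \<Rightarrow> 'a poly) \<Rightarrow>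
   ('f poly \<Rightarrow> 'm::ab_group_add \<Rightarrow> 'm) \<Rightarrow> ('a \<Rightarrow> 'm \<Rightarrow> 'm poly) \<Rightarrow>
   ('a list \<Rightarrow> 'm mpol) \<Rightarrow> 'a list \<Rightarrow> 'm mpol" where
  "differential s br sM act f as = (let n = length as; \<Lambda> = map var [0..<n] in
     (\<Sum>k<n. pact sM ((-1) ^ k)
        (act_at sM act (const (as ! k)) (var k)
          (cochain_at sM f (nths \<Lambda> (- {k})) (nths as (- {k})))))
   + (\<Sum>(k, l)\<in>{(k, l). k < l \<and> l < n}. pact sM ((-1) ^ (k + l))
        (cochain_at_poly sM f ((var k + var l) # nths \<Lambda> (- {k, l}))
          (act_at s br (const (as ! k)) (var k) (const (as ! l))) (nths as (- {k, l})))))"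

definition cochain_del ::
  "('f::field poly \<Rightarrow> 'm::ab_group_add \<Rightarrow> 'm) \<Rightarrow> ('a list \<Rightarrow> 'm mpol) \<Rightarrow> 'a list \<Rightarrow> 'm mpol" where
  "cochain_del sM f as = pact sM (del + (\<Sum>k<length as. var k)) (f as)"


section \<open>Cohomology of complexes of vector spaces\<close>

text \<open>
  Vector spaces are \<open>module\<close> records over \<open>class_ring\<close>, the ring structure of the type \<open>'f\<close>.
  The ring multiplication and unit that these records inherit play no role.
\<close>

definition cochain_space ::
  "('f::field poly \<Rightarrow> 'a::ab_group_add \<Rightarrow> 'a) \<Rightarrow> ('f poly \<Rightarrow> 'm::ab_group_add \<Rightarrow> 'm) \<Rightarrow> nat \<Rightarrow> ('f, 'a list \<Rightarrow> 'm mpol) module" where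
  "cochain_space s sM q = \<lparr>carrier = cochains s sM q, monoid.mult = undefined, one = undefined,
     zero = (\<lambda>as. 0), add = (\<lambda>f g as. f as + g as), module.smult = (\<lambda>k f as. pact sM (const [:k:]) (f as))\<rparr>"

text \<open>The quotient by a subspace \<open>N\<close>; its elements are the cosets of \<open>N\<close>.\<close>

definition quot_module :: "('f, 'v) module \<Rightarrow> 'v set \<Rightarrow> ('f, 'v set) module" where
  "quot_module V N = \<lparr>carrier = a_rcosets\<^bsub>V\<^esub> N, monoid.mult = undefined, one = undefined,
     zero = N, add = set_add V, module.smult = (\<lambda>k X. the_elem ((\<lambda>x. N +>\<^bsub>V\<^esub> (k \<odot>\<^bsub>V\<^esub> x)) ` X))\<rparr>"

definition cohomology :: "(nat \<Rightarrow> ('f, 'v) module) \<Rightarrow> (nat \<Rightarrow> 'v \<Rightarrow> 'v) \<Rightarrow> nat \<Rightarrow> ('f, 'v set) module" where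
  "cohomology C d q =
     quot_module ((C q)\<lparr>carrier := a_kernel (C q) (C (Suc q)) (d q)\<rparr>)
       (case q of 0 \<Rightarrow> {\<zero>\<^bsub>C 0\<^esub>} | Suc p \<Rightarrow> d p ` carrier (C p))"

definition basic_cohomology ::
  "('f::field poly \<Rightarrow> 'a::ab_group_add \<Rightarrow> 'a) \<Rightarrow> ('a \<Rightarrow> 'a \<Rightarrow> 'a poly) \<Rightarrow>
   ('f poly \<Rightarrow> 'm::ab_group_add \<Rightarrow> 'm) \<Rightarrow> ('a \<Rightarrow> 'm \<Rightarrow> 'm poly) \<Rightarrow> nat \<Rightarrow> ('f, ('a list \<Rightarrow> 'm mpol) set) module" where
  "basic_cohomology s br sM act = cohomology (cochain_space s sM) (\<lambda>q. differential s br sM act)"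

definition reduced_space ::
  "('f::field poly \<Rightarrow> 'a::ab_group_add \<Rightarrow> 'a) \<Rightarrow> ('f poly \<Rightarrow> 'm::ab_group_add \<Rightarrow> 'm) \<Rightarrow> nat \<Rightarrow> ('f, ('a list \<Rightarrow> 'm mpol) set) module" where
  "reduced_space s sM q = quot_module (cochain_space s sM q) (cochain_del sM ` cochains s sM q)"

text \<open>The induced map sends the coset of \<open>f\<close> to the coset of its differential.\<close>

definition reduced_differential ::
  "('f::field poly \<Rightarrow> 'a::ab_group_add \<Rightarrow> 'a) \<Rightarrow> ('a \<Rightarrow> 'a \<Rightarrow> 'a poly) \<Rightarrow>
   ('f poly \<Rightarrow> 'm::ab_group_add \<Rightarrow> 'm) \<Rightarrow> ('a \<Rightarrow> 'm \<Rightarrow> 'm poly) \<Rightarrow> nat \<Rightarrow>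
   ('a list \<Rightarrow> 'm mpol) set \<Rightarrow> ('a list \<Rightarrow> 'm mpol) set" where
  "reduced_differential s br sM act q X =
     the_elem ((\<lambda>f. (cochain_del sM ` cochains s sM (Suc q))
       +>\<^bsub>cochain_space s sM (Suc q)\<^esub> differential s br sM act f) ` X)"

definition reduced_cohomology ::
  "('f::field poly \<Rightarrow> 'a::ab_group_add \<Rightarrow> 'a) \<Rightarrow> ('a \<Rightarrow> 'a \<Rightarrow> 'a poly) \<Rightarrow>
   ('f poly \<Rightarrow> 'm::ab_group_add \<Rightarrow> 'm) \<Rightarrow> ('a \<Rightarrow> 'm \<Rightarrow> 'm poly) \<Rightarrow> nat \<Rightarrow> ('f, ('a list \<Rightarrow> 'm mpol) set set) module" where
  "reduced_cohomology s br sM act = cohomology (reduced_space s sM) (reduced_differential s br sM act)"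

text \<open>\<open>vectorspace.dim\<close> is meaningful only for finite-dimensional spaces.\<close>

definition has_dim :: "('f::field, 'v) module \<Rightarrow> nat \<Rightarrow> bool" where
  "has_dim V n \<longleftrightarrow> vectorspace class_ring V \<and> vectorspace.fin_dim class_ring V \<and> vectorspace.dim class_ring V = n"


section \<open>The Lie conformal algebra W(0)\<close>

locale W0_algebra = lie_conformal_algebra s br
  for s :: "'f::field poly \<Rightarrow> 'a::ab_group_add \<Rightarrow> 'a" and br :: "'a \<Rightarrow> 'a \<Rightarrow> 'a poly" +
  fixes L H :: 'a
  assumes distinct_generators: "L \<noteq> H"
    and independent_generators: "independent {L, H}"
    and span_generators: "span {L, H} = UNIV"
    and br_LL: "poly_at s (br L L) (var 0) = pact s (del + 2 * var 0) (const L)"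
    and br_LH: "poly_at s (br L H) (var 0) = pact s (del + var 0) (const H)"
    and br_HL: "poly_at s (br H L) (var 0) = pact s (var 0) (const H)"
    and br_HH: "poly_at s (br H H) (var 0) = 0"


subsection \<open>Existence\<close>

text \<open>The hypotheses of \<^locale>\<open>W0_algebra\<close> are satisfiable over every field.\<close>

context
begin

private abbreviation "lkp \<equiv> Poly_Mapping.lookup"
private abbreviation "kys \<equiv> Poly_Mapping.keys"
private abbreviation "sg \<equiv> Poly_Mapping.single"

private definition sp :: "'f::field poly \<Rightarrow> 'f poly \<times> 'f poly \<Rightarrow> 'f poly \<times> 'f poly" where
  "sp p x = (p * fst x, p * snd x)"
private lemma sp_module: "Modules.module sp"
  by unfold_locales (auto simp: sp_def algebra_simps)

private definition p1 :: "('a::zero \<times> 'a) mpol \<Rightarrow> 'a mpol" where "p1 = Poly_Mapping.map fst"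
private definition p2 :: "('a::zero \<times> 'a) mpol \<Rightarrow> 'a mpol" where "p2 = Poly_Mapping.map snd"
private lemma lk_p1: "lkp (p1 u) \<alpha> = fst (lkp u \<alpha>)" by (simp add: p1_def map.rep_eq when_def)
private lemma lk_p2: "lkp (p2 u) \<alpha> = snd (lkp u \<alpha>)" by (simp add: p2_def map.rep_eq when_def)
private lemma p_eqI: "p1 u = p1 v \<Longrightarrow> p2 u = p2 v \<Longrightarrow> u = v"
  by (rule poly_mapping_eqI) (metis lk_p1 lk_p2 prod_eqI)
private lemma p_add[simp]: "p1 (u+v) = p1 u + p1 v" "p2 (u+v) = p2 u + p2 v" for u :: "('a::ab_group_add \<times> 'a) mpol"
  by (auto intro!: poly_mapping_eqI simp: lk_p1 lk_p2 lookup_add)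
private lemma p_0[simp]: "p1 0 = 0" "p2 0 = 0"
  by (auto intro!: poly_mapping_eqI simp: lk_p1 lk_p2)
private lemma p_uminus[simp]: "p1 (-u) = - p1 u" "p2 (-u) = - p2 u" for u :: "('a::ab_group_add \<times> 'a) mpol"
  by (auto intro!: poly_mapping_eqI simp: lk_p1 lk_p2)
private lemma p_sum: "p1 (sum f A) = (\<Sum>x\<in>A. p1 (f x))" "p2 (sum f A) = (\<Sum>x\<in>A. p2 (f x))" for f :: "_ \<Rightarrow> ('a::ab_group_add \<times> 'a) mpol"
  by (induct A rule: infinite_finite_induct; simp)+
private lemma p_single[simp]: "p1 (sg \<alpha> x) = sg \<alpha> (fst x)" "p2 (sg \<alpha> x) = sg \<alpha> (snd x)"
  by (auto intro!: poly_mapping_eqI simp: lk_p1 lk_p2 lookup_single when_def)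
private lemma p_const[simp]: "p1 (const x) = const (fst x)" "p2 (const x) = const (snd x)" by (simp_all add: const_def)

private lemma times_sup:
  fixes p q :: "'r::comm_ring_1 mpol"
  assumes "finite A" "kys p \<subseteq> A" "finite B" "kys u \<subseteq> B"
  shows "p * u = (\<Sum>\<alpha>\<in>A. \<Sum>\<beta>\<in>B. sg (\<alpha>+\<beta>) (lkp p \<alpha> * lkp u \<beta>))"
proof -
  have e: "f = (\<Sum>\<alpha>\<in>C. sg \<alpha> (lkp f \<alpha>))" if "finite C" "kys f \<subseteq> C" for f :: "'r mpol" and C
  proof -
    show ?thesis by (rule poly_mapping_eqI) (use that in \<open>auto simp: lookup_sum lookup_single when_def in_keys_iff sum.delta\<close>)
  qed
  show ?thesis by (subst e[OF assms(1,2)], subst e[OF assms(3,4)]) (simp add: sum_product mult_single)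
qed

private lemma kys_p: "kys (p1 u) \<subseteq> kys u" "kys (p2 u) \<subseteq> kys u" 
  by (auto simp: in_keys_iff lk_p1 lk_p2)

private lemma p_pact[simp]: "p1 (pact sp p u) = p * p1 u" "p2 (pact sp p u) = p * p2 u"
  using kys_p[of u] by (simp_all add: pact_def p_sum sp_def times_sup[of "kys p" p "kys u"] lk_p1 lk_p2)

private definition Phi :: "('a::ab_group_add \<Rightarrow> 'r::comm_ring_1 mpol) \<Rightarrow> 'a mpol \<Rightarrow> 'r mpol" where
  "Phi h w = (\<Sum>\<alpha>\<in>kys w. lmon \<alpha> * h (lkp w \<alpha>))"
private lemma Phi_sup: assumes "h 0 = 0" "finite A" "kys w \<subseteq> A" shows "Phi h w = (\<Sum>\<alpha>\<in>A. lmon \<alpha> * h (lkp w \<alpha>))"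
  unfolding Phi_def by (rule sum.mono_neutral_left) (use assms in \<open>auto simp: in_keys_iff\<close>)

private lemma mon_mult: "lmon (\<alpha>+\<beta>) = lmon \<alpha> * lmon \<beta>" by (simp add: lmon_def mult_single)
private lemma mon0: "lmon 0 = 1" by (simp add: lmon_def)

text \<open>
  For \<open>a \<in> F[\<partial>]\<close>, \<open>phi y a\<close> is \<open>a(y)\<close>; \<open>PP y\<close> replaces
  \<open>\<partial>\<close> by \<open>y\<close> in an element of \<open>F[\<partial>][\<lambda>\<^sub>0, \<lambda>\<^sub>1, \<dots>]\<close>.
\<close>

private definition cc :: "'f::field \<Rightarrow> 'f poly mpol" where "cc k = const [:k:]"
private definition phi :: "'f poly mpol \<Rightarrow> 'f::field poly \<Rightarrow> 'f poly mpol" where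
  "phi y a = poly (map_poly cc a) y"
private lemma const_ring[simp]: "const (0::'a::comm_ring_1) = 0" "const (1::'a) = 1" "const (a+b) = const a + const (b::'a)" "const (a*b) = const a * const (b::'a)"
  by (simp_all add: const_def single_add mult_single)
private lemma const_add: "const (a+b) = const a + const b" for a :: "'a::ab_group_add" by (simp add: const_def single_add)
private lemma cc_hom: "comm_ring_hom cc"
  by unfold_locales (auto simp: cc_def algebra_simps simp flip: const_ring one_pCons)
    
private lemma phi_hom: "phi y (a+b) = phi y a + phi y b" "phi y (a*b) = phi y a * phi y b" "phi y 0 = 0" "phi y 1 = 1"
  "phi y [:k:] = cc k" "phi y [:0,1:] = y"
proof -
  interpret c: comm_ring_hom cc by (rule cc_hom)
  interpret m: map_poly_comm_ring_hom cc ..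
  show "phi y (a+b) = phi y a + phi y b" "phi y (a*b) = phi y a * phi y b" "phi y 0 = 0" "phi y 1 = 1"
  "phi y [:k:] = cc k" "phi y [:0,1:] = y"
    by (auto simp: phi_def hom_distribs)
qed

private definition PP where "PP y = Phi (phi y)"
private lemma PP_add: "PP y (u+v) = PP y u + PP y v"
proof -
  let ?A = "kys u \<union> kys v"
  have "PP y (u+v) = (\<Sum>\<alpha>\<in>?A. lmon \<alpha> * phi y (lkp (u+v) \<alpha>))"
    unfolding PP_def by (rule Phi_sup) (use keys_add[of u v] in \<open>auto simp: phi_hom\<close>)
  moreover have "PP y u = (\<Sum>\<alpha>\<in>?A. lmon \<alpha> * phi y (lkp (u) \<alpha>))"
    unfolding PP_def by (rule Phi_sup) (auto simp: phi_hom)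
  moreover have "PP y v = (\<Sum>\<alpha>\<in>?A. lmon \<alpha> * phi y (lkp (v) \<alpha>))"
    unfolding PP_def by (rule Phi_sup) (auto simp: phi_hom)
  ultimately show ?thesis by (simp add: lookup_add phi_hom algebra_simps sum.distrib)
qed
private lemma PP_single: "PP y (sg \<alpha> a) = lmon \<alpha> * phi y a"
  unfolding PP_def by (subst Phi_sup[of _ "{\<alpha>}"]) (auto simp: phi_hom)
private lemma PP_0[simp]: "PP y 0 = 0" by (simp add: PP_def Phi_def)
private lemma PP_sum: "PP y (sum f A) = (\<Sum>x\<in>A. PP y (f x))" by (induct A rule: infinite_finite_induct) (auto simp: PP_add)
private lemma PP_mult: "PP y (u*v) = PP y u * PP y v"
proof -
  have "PP y (u*v) = (\<Sum>\<alpha>\<in>kys u. \<Sum>\<beta>\<in>kys v. lmon (\<alpha>+\<beta>) * phi y (lkp u \<alpha> * lkp v \<beta>))"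
    by (subst times_sup[of "kys u" u "kys v" v]) (auto simp: PP_sum PP_single)
  then show ?thesis unfolding PP_def Phi_def sum_product by (simp add: phi_hom mon_mult algebra_simps)
qed
private lemma PP_const[simp]: "PP y (const a) = phi y a" by (simp add: const_def PP_single mon0)
private lemma PP_1: "PP y 1 = 1" using PP_const[of y 1] by (simp add: phi_hom)
private lemma PP_2: "PP y 2 = 2" using PP_add[of y 1 1] by (simp add: PP_1)
private lemma PP_var: "PP y (var i) = var i" by (simp add: var_def) (simp add: lmon_def PP_single phi_hom)
private lemma PP_del: "PP y del = y" by (simp add: del_def phi_hom)
private lemma PP_hom: "comm_ring_hom (PP y)"
  by unfold_locales (auto simp: PP_add PP_mult PP_1)
private lemma PP_uminus: "PP y (- u) = - PP y u"
proof - interpret comm_ring_hom "PP y" by (rule PP_hom) show ?thesis by (simp add: hom_uminus) qed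
private lemma phi_pCons: "phi y (pCons a p) = cc a + y * phi y p"
proof -
  have "pCons a p = [:a:] + [:0,1:] * p" by simp
  then show ?thesis by (simp only: phi_hom)
qed
private lemma PP_phi: "PP y (phi z a) = phi (PP y z) a"
  by (induct a) (simp_all add: phi_pCons PP_add PP_mult cc_def phi_hom)

text \<open>\<open>ng a = a(-\<lambda>)\<close> and \<open>sh a = a(\<partial> + \<lambda>)\<close> in \<open>F[\<partial>][\<lambda>]\<close>.\<close>

private definition ng :: "'f::field poly \<Rightarrow> 'f poly poly" where "ng a = poly (map_poly (\<lambda>k. [:[:k:]:]) a) [:0,-1:]"
private definition sh :: "'f::field poly \<Rightarrow> 'f poly poly" where "sh a = poly (map_poly (\<lambda>k. [:[:k:]:]) a) [:[:0,1:],1:]"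
private definition pr :: "'a::zero poly \<Rightarrow> 'a poly \<Rightarrow> ('a \<times> 'a) poly" where
  "pr P Q = Abs_poly (\<lambda>n. (coeff P n, coeff Q n))"
private lemma coeff_pr: "coeff (pr P Q) n = (coeff P n, coeff Q n)"
proof -
  have "\<forall>\<^sub>\<infinity> n. (coeff P n, coeff Q n) = 0"
    using MOST_conjI[OF MOST_coeff_eq_0[of P] MOST_coeff_eq_0[of Q]] by (simp add: zero_prod_def)
  then show ?thesis by (simp add: pr_def Abs_poly_inverse)
qed

text \<open>
  \<open>[p(\<partial>) a\<^bsub>\<lambda>\<^esub> q(\<partial>) b] = p(-\<lambda>) q(\<partial> + \<lambda>) [a\<^bsub>\<lambda>\<^esub> b]\<close>
  for \<open>a, b \<in> {L, H}\<close>, with \<open>L = (1, 0)\<close> and \<open>H = (0, 1)\<close>.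
\<close>

private definition wbr :: "'f::field poly \<times> 'f poly \<Rightarrow> 'f poly \<times> 'f poly \<Rightarrow> ('f poly \<times> 'f poly) poly" where
  "wbr a b = pr (ng (fst a) * sh (fst b) * [:[:0,1:],2:])
               (ng (fst a) * sh (snd b) * [:[:0,1:],1:] + ng (snd a) * sh (fst b) * [:0,1:])"

private definition ev :: "'f::field poly poly \<Rightarrow> 'f poly mpol \<Rightarrow> 'f poly mpol" where "ev Q x = poly (map_poly const Q) x"
private lemma const_hom: "comm_ring_hom (const :: 'a::comm_ring_1 \<Rightarrow> _)" by unfold_locales auto
private lemma ev_hom: "ev (P+Q) x = ev P x + ev Q x" "ev (P*Q) x = ev P x * ev Q x" "ev [:k:] x = const k" "ev [:0,1:] x = x"
   "ev [:c,d:] x = const c + x * const d"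
proof -
  interpret c: comm_ring_hom "const :: 'a poly \<Rightarrow> _" by (rule const_hom)
  interpret m: map_poly_comm_ring_hom "const :: 'a poly \<Rightarrow> _" ..
  show "ev (P+Q) x = ev P x + ev Q x" "ev (P*Q) x = ev P x * ev Q x" "ev [:k:] x = const k" "ev [:0,1:] x = x" 
   "ev [:c,d:] x = const c + x * const d"
    by (auto simp: ev_def hom_distribs)
qed
private lemma hom_poly_gen:
  assumes "comm_ring_hom (h::'f::field \<Rightarrow> 'f poly poly)" 
  shows "ev (poly (map_poly h a) z) x = poly (map_poly (\<lambda>k. ev (h k) x) a) (ev z x)"
proof -
  interpret h: comm_ring_hom h by fact
  have z: "ev (h 0) x = 0" using ev_hom(3)[of 0 x] by simp
  show ?thesis by (induct a) (auto simp: map_poly_pCons z ev_hom, simp add: ev_def)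
qed
private lemma kk_hom: "comm_ring_hom (\<lambda>k::'f::field. [:[:k:]:])" by unfold_locales (auto simp: one_pCons algebra_simps)
private lemma ev_ng: "ev (ng a) x = phi (-x) a" 
proof -
  have c: "const (-1 :: 'a poly) = -1" by (simp add: const_def single_uminus)
  have "ev [:0,-1:] x = - x" unfolding ev_hom(5) c by simp
  then show ?thesis unfolding ng_def phi_def hom_poly_gen[OF kk_hom] by (simp add: ev_hom cc_def[abs_def])
qed
private lemma ev_sh: "ev (sh a) x = phi (del+x) a" 
  unfolding sh_def phi_def hom_poly_gen[OF kk_hom] by (simp add: ev_hom cc_def[abs_def] del_def)

private lemma ev_sum: "degree Q \<le> N \<Longrightarrow> ev Q x = (\<Sum>n\<le>N. x ^ n * const (coeff Q n))"
proof -
  assume "degree Q \<le> N"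
  then have d: "degree (map_poly const Q) \<le> N" using degree_map_poly_le le_trans by blast
  have "ev Q x = (\<Sum>n\<le>degree (map_poly const Q). x ^ n * const (coeff Q n))"
    unfolding ev_def poly_altdef by (simp add: coeff_map_poly mult.commute)
  also have "\<dots> = (\<Sum>n\<le>N. x ^ n * const (coeff Q n))"
    by (rule sum.mono_neutral_left) (use d coeff_map_poly[of const Q] coeff_eq_0[of "map_poly const Q"] in auto)
  finally show ?thesis .
qed
private lemma pa1: "p1 (poly_at sp (pr P Q) x) = ev P x" "p2 (poly_at sp (pr P Q) x) = ev Q x"
proof -
  have z: "coeff P i = 0 \<and> coeff Q i = 0" if "degree (pr P Q) < i" for i
    using coeff_eq_0[OF that] by (simp add: coeff_pr zero_prod_def)
  have d1: "degree P \<le> degree (pr P Q)" by (rule degree_le) (use z in simp)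
  have d2: "degree Q \<le> degree (pr P Q)" by (rule degree_le) (use z in simp)
  show "p1 (poly_at sp (pr P Q) x) = ev P x"
   unfolding poly_at_def p_sum p_pact p_const coeff_pr fst_conv ev_sum[OF d1, symmetric] ..
  show "p2 (poly_at sp (pr P Q) x) = ev Q x"
   unfolding poly_at_def p_sum p_pact p_const coeff_pr snd_conv ev_sum[OF d2, symmetric] ..
qed
private lemma two: "const 2 = (2 :: 'f::field poly mpol)" using const_ring(3)[of 1 "1::'f poly"] by simp
private lemma pa_wbr: 
  "p1 (poly_at sp (wbr a b) x) = phi (-x) (fst a) * phi (del+x) (fst b) * (del + 2 * x)"
  "p2 (poly_at sp (wbr a b) x) = phi (-x) (fst a) * phi (del+x) (snd b) * (del + x) + phi (-x) (snd a) * phi (del+x) (fst b) * x"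
  unfolding wbr_def pa1 ev_hom ev_ng ev_sh del_def[symmetric] two const_ring by (simp_all only: mult_1_right mult_1_left add_0_left mult.commute[of x])

private lemma PP_p: "PP y (p1 w) = (\<Sum>\<alpha>\<in>kys w. lmon \<alpha> * phi y (fst (lkp w \<alpha>)))" "PP y (p2 w) = (\<Sum>\<alpha>\<in>kys w. lmon \<alpha> * phi y (snd (lkp w \<alpha>)))"
  unfolding PP_def
  by (subst Phi_sup[of _ "kys w"]; simp add: kys_p phi_hom lk_p1 lk_p2)+
private lemma lmon_swap: "lmon (a+b) * (x * y * z) = (lmon a * x) * (lmon b * y) * z" by (simp add: mon_mult ac_simps)
private lemma aa:
  "p1 (act_at sp wbr w x u) = PP (-x) (p1 w) * PP (del+x) (p1 u) * (del + 2 * x)"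
  "p2 (act_at sp wbr w x u) = PP (-x) (p1 w) * PP (del+x) (p2 u) * (del + x) + PP (-x) (p2 w) * PP (del+x) (p1 u) * x"
  by (simp_all add: act_at_def p_sum pa_wbr distrib_left lmon_swap sum.distrib PP_p flip: sum_distrib_right sum_product)
 
private lemma mp_coeff: "coeff (map_poly (sp [:k:]) P) n = sp [:k:] (coeff P n)"
  by (simp add: coeff_map_poly sp_def zero_prod_def)

private lemma ng_hom: "ng (a+b) = ng a + ng b" "ng ([:k:]*b) = Polynomial.smult [:k:] (ng b)"
  "sh (a+b) = sh a + sh b" "sh ([:k:]*b) = Polynomial.smult [:k:] (sh b)"
proof -
  interpret c: comm_ring_hom "\<lambda>k::'a. [:[:k:]:]" by (rule kk_hom)
  interpret m: map_poly_comm_ring_hom "\<lambda>k::'a. [:[:k:]:]" ..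
  have e: "map_poly (\<lambda>k. [:[:k:]:]) [:k:] = [:[:[:k:]:]:]" for k :: 'a by (rule poly_eqI) (simp add: coeff_map_poly coeff_pCons split: nat.split)
  show "ng (a+b) = ng a + ng b" "ng ([:k:]*b) = Polynomial.smult [:k:] (ng b)"
   "sh (a+b) = sh a + sh b" "sh ([:k:]*b) = Polynomial.smult [:k:] (sh b)"
    unfolding ng_def sh_def m.hom_add m.hom_mult poly_add poly_mult e by simp_all
qed

private lemma del_sp: "fst (sp p a) = p * fst a" "snd (sp p a) = p * snd a" by (auto simp: sp_def)
private lemma wlca: "lie_conformal_algebra sp (wbr :: 'f::field poly \<times> _ \<Rightarrow> _)"
proof (intro lie_conformal_algebra.intro sp_module lie_conformal_algebra_axioms.intro)
  fix a b c :: "'f poly \<times> 'f poly" and k :: 'f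
  show "wbr (a+b) c = wbr a c + wbr b c" "wbr a (b+c) = wbr a b + wbr a c"
    by (rule poly_eqI, simp add: wbr_def coeff_pr ng_hom algebra_simps del: mult_pCons_left mult_pCons_right)+
  show "wbr (sp [:k:] a) b = map_poly (sp [:k:]) (wbr a b)" "wbr a (sp [:k:] b) = map_poly (sp [:k:]) (wbr a b)"
    by (rule poly_eqI, simp only: mp_coeff wbr_def coeff_pr del_sp sp_def ng_hom fst_conv snd_conv,
        simp add: distrib_left del: mult_pCons_left mult_pCons_right)+
  show "poly_at sp (wbr (sp [:0, 1:] a) b) (var 0) = pact sp (- var 0) (poly_at sp (wbr a b) (var 0))"
    by (rule p_eqI) (simp_all add: pa_wbr del_sp phi_hom algebra_simps del: mult_pCons_left mult_pCons_right)
  show "poly_at sp (wbr a (sp [:0, 1:] b)) (var 0) = pact sp (del + var 0) (poly_at sp (wbr a b) (var 0))"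
    by (rule p_eqI) (simp_all add: pa_wbr del_sp phi_hom algebra_simps del: mult_pCons_left mult_pCons_right)
  show "poly_at sp (wbr a b) (var 0) = - poly_at sp (wbr b a) (- var 0 - del)"
    by (rule p_eqI) (simp_all add: pa_wbr algebra_simps)
  show "act_at sp wbr (const a) (var 0) (act_at sp wbr (const b) (var 1) (const c)) =
         act_at sp wbr (act_at sp wbr (const a) (var 0) (const b)) (var 0 + var 1) (const c)
       + act_at sp wbr (const b) (var 1) (act_at sp wbr (const a) (var 0) (const c))"
    by (rule p_eqI) (simp_all add: aa PP_add PP_mult PP_phi PP_2 PP_var PP_del PP_uminus, simp_all add: algebra_simps)
qed

private lemma W0_model: "W0_algebra sp wbr (1, 0) (0, 1 :: 'f::field poly)"
proof -
  interpret W: lie_conformal_algebra sp "wbr :: 'f poly \<times> 'f poly \<Rightarrow> _" by (rule wlca)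
  show ?thesis
  proof (unfold_locales)
    show "(1, 0) \<noteq> (0, 1 :: 'f poly)" by simp
    show "W.independent {(1, 0), (0, 1 :: 'f poly)}"
      by (subst W.dependent_finite) (auto simp: sp_def zero_prod_def)
    have "x \<in> W.span {(1, 0), (0, 1 :: 'f poly)}" for x
    proof -
      have "x = sp (fst x) (1, 0) + sp (snd x) (0, 1)" by (simp add: sp_def)
      then show ?thesis by (metis W.span_add W.span_scale W.span_base insertI1 insertI2)
    qed
    then show "W.span {(1, 0), (0, 1 :: 'f poly)} = UNIV" by auto
  qed (rule p_eqI; simp add: pa_wbr phi_hom)+
qed

lemma W0_algebra_exists:
  "\<exists>(s :: 'f::field poly \<Rightarrow> 'f poly \<times> 'f poly \<Rightarrow> 'f poly \<times> 'f poly) br L H. W0_algebra s br L H"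
  using W0_model by blast

end

end

theory Submission
  imports Defs "HOL-Library.Function_Algebras"
begin

text \<open>
  Evaluating the variables \<open>\<lambda>\<^sub>i\<close> at elements of \<open>F\<close> turns a cochain into an alternating
  function of arguments \<open>(a, x)\<close> in \<open>A \<times> F\<close>, where \<open>(a, x)\<close> stands for \<open>a\<^bsub>\<lambda>\<^esub>\<close> at
  \<open>\<lambda> = x\<close>; as \<open>F\<close> is infinite, no information is lost. With the bracket
  \<open>[(a, x), (b, y)] = ([a\<^bsub>x\<^esub> b], x + y)\<close> the differential becomes the Chevalley-Eilenberg
  differential. This bracket satisfies the Jacobi identity, and it is skew-symmetric up to terms on
  which cochains vanish. Cartan's calculus, run by recursion on the list of arguments, then gives
  \<open>d\<^sup>2 = 0\<close> (\<open>ce_d_ce_d\<close>) and the homotopy formula \<open>cartan_homotopy\<close>: if \<open>\<iota>\<^sub>n f\<close> is the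
  coefficient of \<open>\<lambda>\<^sub>0\<^sup>n\<close> in \<open>f(L, \<dots>)\<close>, then \<open>d \<iota>\<^sub>n + \<iota>\<^sub>n d\<close> is the coefficient of \<open>t\<^sup>n\<close> in
  the Lie derivative along \<open>(L, t)\<close>.

  For \<open>n = 0\<close> this coefficient is the operator \<open>\<partial>\<close> on cochains (\<open>homotopy_del\<close>), because the
  action of \<open>L\<close> at \<open>\<lambda> = 0\<close> on \<open>W(0)\<close> is \<open>\<partial>\<close>. Hence \<open>\<partial>\<close> acts as 0 on the basic
  cohomology. It is injective on cochains, so the long exact sequence breaks up and the dimension of
  the reduced cohomology in degree \<open>q\<close> is the sum of the dimensions of the basic cohomology in
  degrees \<open>q\<close> and \<open>q + 1\<close> (\<open>has_dim_reduced\<close>).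

  For \<open>n = 1\<close> it is an Euler operator. Take a list of \<open>k\<close> copies of \<open>L\<close> and \<open>j\<close> copies of
  \<open>H\<close>; on the coefficient of \<open>\<lambda>\<^sup>\<alpha> \<partial>\<^sup>n X\<close> in the value of a cochain there, the operator is
  multiplication by \<open>\<bar>\<alpha>\<bar> + n - k + w\<close>, with \<open>w = 2\<close> for \<open>X = L\<close> and \<open>w = 1\<close> for \<open>X = H\<close>
  (\<open>co_E\<close>). It is diagonalizable and homotopic to 0, so the basic cohomology is that of the
  subcomplex on which it vanishes. There, skew-symmetry forces the exponents of the variables of
  equal generators to be distinct, whence \<open>\<bar>\<alpha>\<bar> \<ge> k(k - 1)/2 + j(j - 1)/2\<close>, and
  \<open>\<bar>\<alpha>\<bar> = k - n - w\<close> leaves only the cochains \<open>L \<mapsto> H\<close>, \<open>(L, H) \<mapsto> H\<close>,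
  \<open>(L, L) \<mapsto> (\<lambda>\<^sub>0 - \<lambda>\<^sub>1) H\<close> and \<open>(L, L, H) \<mapsto> (\<lambda>\<^sub>0 - \<lambda>\<^sub>1) H\<close>
  (\<open>weight_zero_support\<close>). All four are cocycles (\<open>differential_weight_zero\<close>), so the basic
  cohomology has dimension 1, 2, 1 in degrees 1, 2, 3 and vanishes otherwise.
\<close>

section \<open>Evaluating polynomials with coefficients in a module\<close>

abbreviation "lookup \<equiv> Poly_Mapping.lookup"
abbreviation "keys \<equiv> Poly_Mapping.keys"
abbreviation "single \<equiv> Poly_Mapping.single"
abbreviation "map_key \<equiv> Poly_Mapping.map_key"

lemma const_poly_mult: "[:a:] * [:b:] = [:a * b:]" for a b :: "'f::comm_semiring_0"
  by (simp add: mult.commute)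

lemma const_poly_power: "[:a:] ^ n = [:a ^ n:]" for a :: "'f::comm_semiring_1"
  by (induction n) (auto simp: one_pCons mult.commute)

lemma const_poly_sum: "(\<Sum>i\<in>A. [:g i:]) = [:\<Sum>i\<in>A. g i:]" for g :: "'i \<Rightarrow> 'f::comm_monoid_add"
  by (induction A rule: infinite_finite_induct) auto

definition mval :: "(nat \<Rightarrow> 'f::comm_ring_1) \<Rightarrow> (nat \<Rightarrow>\<^sub>0 nat) \<Rightarrow> 'f" where
  "mval x \<alpha> = (\<Prod>i\<in>keys \<alpha>. x i ^ lookup \<alpha> i)"

lemma mval_superset:
  assumes "finite A" "keys \<alpha> \<subseteq> A"
  shows "mval x \<alpha> = (\<Prod>i\<in>A. x i ^ lookup \<alpha> i)"
  unfolding mval_def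
  by (rule prod.mono_neutral_left) (use assms in \<open>auto simp: in_keys_iff\<close>)

lemma mval_0 [simp]: "mval x 0 = 1"
  by (simp add: mval_def)

lemma mval_add: "mval x (\<alpha> + \<beta>) = mval x \<alpha> * mval x \<beta>"
proof -
  let ?A = "keys \<alpha> \<union> keys \<beta>"
  have "mval x (\<alpha> + \<beta>) = (\<Prod>i\<in>?A. x i ^ lookup (\<alpha> + \<beta>) i)"
    by (rule mval_superset) (use keys_add[of \<alpha> \<beta>] in auto)
  also have "\<dots> = mval x \<alpha> * mval x \<beta>"
    by (simp add: mval_superset[of ?A] lookup_add power_add prod.distrib)
  finally show ?thesis .
qed

lemma mval_single [simp]: "mval x (single i n) = x i ^ n"
  by (simp add: mval_def)

lemma mval_cong:
  "(\<And>i. i \<in> keys \<alpha> \<Longrightarrow> x i = y i) \<Longrightarrow> mval x \<alpha> = mval y \<alpha>"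
  by (simp add: mval_def)

text \<open>
  Since scalars are substituted, the value lies in the module again. Identities between
  polynomials are proved at all points and lifted by \<open>eval_inject\<close>.
\<close>

definition eval :: "('f::field poly \<Rightarrow> 'm::ab_group_add \<Rightarrow> 'm) \<Rightarrow> (nat \<Rightarrow> 'f) \<Rightarrow> 'm mpol \<Rightarrow> 'm" where
  "eval s x u = (\<Sum>\<alpha>\<in>keys u. s [:mval x \<alpha>:] (lookup u \<alpha>))"

abbreviation rval :: "(nat \<Rightarrow> 'f::field) \<Rightarrow> 'f poly mpol \<Rightarrow> 'f poly" where
  "rval \<equiv> eval (*)"

text \<open>
  In contrast to \<open>poly_at\<close>, the value lies in the module itself. The argument may involve
  \<open>\<partial>\<close>, as in \<open>[b\<^bsub>-x-\<partial>\<^esub> a]\<close>.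
\<close>

definition pev :: "('r::comm_ring_1 \<Rightarrow> 'm::ab_group_add \<Rightarrow> 'm) \<Rightarrow> 'm poly \<Rightarrow> 'r \<Rightarrow> 'm" where
  "pev s P r = (\<Sum>n\<le>degree P. s (r ^ n) (coeff P n))"

lemma module_poly_ring: "Modules.module ((*) :: 'f::field poly \<Rightarrow> _)"
  by unfold_locales (auto simp: algebra_simps)

context Modules.module
begin

lemma pev_bound:
  assumes "degree P \<le> N"
  shows "pev scale P r = (\<Sum>n\<le>N. r ^ n *s coeff P n)"
  unfolding pev_def
  by (rule sum.mono_neutral_left) (use assms in \<open>auto simp: coeff_eq_0\<close>)

lemma pev_0 [simp]: "pev scale 0 r = 0"
  by (simp add: pev_def)

lemma pev_add: "pev scale (P + Q) r = pev scale P r + pev scale Q r"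
proof -
  let ?N = "max (degree P) (degree Q)"
  show ?thesis
    using pev_bound[of "P + Q" ?N r] pev_bound[of P ?N r] pev_bound[of Q ?N r]
    by (simp add: degree_add_le scale_right_distrib sum.distrib)
qed

lemma pev_map_poly:
  assumes "f 0 = 0" "\<And>m n. f (m + n) = f m + f n" "\<And>n m. f (r ^ n *s m) = r ^ n *s f m"
  shows "pev scale (map_poly f P) r = f (pev scale P r)"
proof -
  have fsum: "f (sum g A) = (\<Sum>x\<in>A. f (g x))" for g and A :: "nat set"
    by (induction A rule: infinite_finite_induct) (auto simp: assms)
  have "degree (map_poly f P) \<le> degree P" by (rule degree_map_poly_le)
  then show ?thesis
    by (simp add: pev_bound pev_def[of _ P] fsum assms coeff_map_poly)
qed

lemma pev_monom: "pev scale (monom m n) r = r ^ n *s m"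
proof -
  have "pev scale (monom m n) r = (\<Sum>k\<le>n. r ^ k *s coeff (monom m n) k)"
    by (rule pev_bound) (rule degree_monom_le)
  also have "\<dots> = (\<Sum>k\<le>n. if k = n then r ^ n *s m else 0)"
    by (rule sum.cong) (auto)
  finally show ?thesis by simp
qed

end

locale poly_module = Modules.module s
  for s :: "'f::field_char_0 poly \<Rightarrow> 'm::ab_group_add \<Rightarrow> 'm"
begin

lemma vector_space_consts: "vector_space (\<lambda>k. s [:k:])"
  by unfold_locales
    (auto simp: scale_right_distrib mult.commute simp flip: scale_left_distrib one_pCons)

lemma eval_superset:
  assumes "finite A" "keys u \<subseteq> A"
  shows "eval s x u = (\<Sum>\<alpha>\<in>A. s [:mval x \<alpha>:] (lookup u \<alpha>))"
  unfolding eval_def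
  by (rule sum.mono_neutral_left) (use assms in \<open>auto simp: in_keys_iff\<close>)

lemma eval_0 [simp]: "eval s x 0 = 0"
  by (simp add: eval_def)

lemma eval_add: "eval s x (u + v) = eval s x u + eval s x v"
proof -
  let ?A = "keys u \<union> keys v"
  have "eval s x (u + v) = (\<Sum>\<alpha>\<in>?A. s [:mval x \<alpha>:] (lookup (u + v) \<alpha>))"
    by (rule eval_superset) (use keys_add[of u v] in auto)
  also have "\<dots> = eval s x u + eval s x v"
    by (simp add: eval_superset[of ?A] lookup_add scale_right_distrib sum.distrib)
  finally show ?thesis .
qed

lemma eval_uminus: "eval s x (- u) = - eval s x u"
  using eval_add[of x u "- u"] by (simp add: eq_neg_iff_add_eq_0 add.commute)

lemma eval_diff: "eval s x (u - v) = eval s x u - eval s x v"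
  using eval_add[of x u "- v"] by (simp add: eval_uminus)

lemma eval_sum: "eval s x (sum f A) = (\<Sum>i\<in>A. eval s x (f i))"
  by (induction A rule: infinite_finite_induct) (auto simp: eval_add)

lemma eval_single [simp]: "eval s x (single \<alpha> m) = s [:mval x \<alpha>:] m"
  by (simp add: eval_def)

lemma eval_const [simp]: "eval s x (const m) = m"
  by (simp add: const_def flip: one_pCons)

end

lemma poly_module_ring: "poly_module ((*) :: 'f::field_char_0 poly \<Rightarrow> _)"
  by (simp add: poly_module_def module_poly_ring)

interpretation rval: poly_module "(*) :: 'f::field_char_0 poly \<Rightarrow> _"
  by (rule poly_module_ring)

context poly_module
begin

lemma eval_pact: "eval s x (pact s p u) = s (rval x p) (eval s x u)"
proof -
  let ?p = "\<lambda>\<alpha>. [:mval x \<alpha>:] * lookup p \<alpha>"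
    and ?u = "\<lambda>\<beta>. s [:mval x \<beta>:] (lookup u \<beta>)"
  have "s (rval x p) (eval s x u) =
      (\<Sum>\<alpha>\<in>keys p. \<Sum>\<beta>\<in>keys u. s (?p \<alpha>) (?u \<beta>))"
    unfolding eval_def[of "(*)"] eval_def[of s x u] scale_sum_left
    by (intro sum.cong refl) (rule scale_sum_right)
  then show ?thesis
    unfolding pact_def eval_sum by (simp add: mval_add mult_ac)
qed

end

text \<open>
  The ring \<open>F[\<partial>][\<lambda>\<^sub>0, \<lambda>\<^sub>1, \<dots>]\<close> is the case of the module \<open>F[\<partial>]\<close> over itself, so that
  the facts on \<open>eval\<close> show that \<open>rval\<close> is a ring homomorphism.
\<close>

lemma pact_mult: "pact (*) p u = p * (u :: 'f::field_char_0 poly mpol)"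
proof -
  have e: "f = (\<Sum>\<alpha>\<in>keys f. single \<alpha> (lookup f \<alpha>))"
    for f :: "'f poly mpol"
    by (rule poly_mapping_eqI)
      (auto simp: lookup_sum lookup_single when_def in_keys_iff sum.delta)
  show ?thesis
    by (subst (2) e[of p], subst (2) e[of u]) (simp add: pact_def sum_product mult_single)
qed

lemma rval_mult: "rval x (p * u) = rval x p * rval x (u :: 'f::field_char_0 poly mpol)"
  using rval.eval_pact[of x p u] by (simp add: pact_mult)

lemma rval_1 [simp]: "rval x (1 :: 'f::field_char_0 poly mpol) = 1"
  using rval.eval_const[of x 1] by (simp add: const_def)

lemma rval_power: "rval x (p ^ n) = rval x (p :: 'f::field_char_0 poly mpol) ^ n"
  by (induction n) (auto simp: rval_mult)

lemma rval_prod: "rval x (prod f A) = (\<Prod>i\<in>A. rval x (f i :: 'f::field_char_0 poly mpol))"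
  by (induction A rule: infinite_finite_induct) (auto simp: rval_mult)

lemma rval_lmon [simp]: "rval x (lmon \<alpha>) = [:mval x (\<alpha>) :: 'f::field_char_0:]"
  by (simp add: lmon_def)

lemma rval_var [simp]: "rval x (var i) = [:x i :: 'f::field_char_0:]"
  by (simp add: var_def)

lemma rval_del [simp]: "rval x (del :: 'f::field_char_0 poly mpol) = [:0, 1:]"
  by (simp add: del_def)

lemma rval_numeral: "rval x (2 :: 'f::field_char_0 poly mpol) = 2"
  using rval.eval_add[of x 1 1] by simp

lemma rval_of_int [simp]: "rval x (of_int k :: 'f::field_char_0 poly mpol) = of_int k"
proof -
  have "rval x (of_nat n :: 'f poly mpol) = of_nat n" for n
    by (induction n) (auto simp: rval.eval_add)
  then show ?thesis
    by (cases k) (auto simp: rval.eval_uminus rval.eval_diff)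
qed

lemmas rval_simps = rval_mult rval_power rval_prod rval_numeral rval.eval_add rval.eval_uminus
  rval.eval_diff rval.eval_sum

context poly_module
begin

text \<open>
  The substituted polynomials are constrained only at the variables that occur: a substitution
  given by a list is arbitrary beyond the length of the list.
\<close>

lemma eval_subst:
  assumes "\<And>\<alpha> i. \<alpha> \<in> keys u \<Longrightarrow> i \<in> keys \<alpha> \<Longrightarrow> rval x (\<sigma> i) = [:y i:]"
  shows "eval s x (subst s \<sigma> u) = eval s y u"
proof -
  have *: "(\<Prod>i\<in>A. [:g i:]) = [:\<Prod>i\<in>A. g i:]" for A :: "nat set" and g :: "nat \<Rightarrow> 'f"
    by (induction A rule: infinite_finite_induct) (auto simp: one_pCons)
  show ?thesis
    unfolding subst_def eval_sum eval_def[of s y]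
    by (intro sum.cong refl) (simp add: eval_pact rval_simps assms mval_def const_poly_power flip: *)
qed

lemma eval_poly_at: "eval s x (poly_at s P p) = pev s P (rval x p)"
  by (simp add: poly_at_def pev_def eval_sum eval_pact rval_simps)

end

text \<open>
  Uniqueness of expansions in base \<open>N\<close>, which makes the Kronecker substitution below injective
  on monomials.
\<close>

lemma digits_inject:
  fixes a b :: "nat \<Rightarrow> nat"
  assumes "\<And>i. i < n \<Longrightarrow> a i < N" "\<And>i. i < n \<Longrightarrow> b i < N"
    and "(\<Sum>i<n. a i * N ^ i) = (\<Sum>i<n. b i * N ^ i)" "i < n"
  shows "a i = b i"
  using assms
proof (induction n arbitrary: a b i)
  case (Suc n)
  have split: "(\<Sum>i<Suc n. c i * N ^ i) = c 0 + N * (\<Sum>i<n. c (Suc i) * N ^ i)" for c :: "nat \<Rightarrow> nat"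
    unfolding sum.lessThan_Suc_shift sum_distrib_left by (simp add: mult_ac)
  let ?A = "\<Sum>i<n. a (Suc i) * N ^ i" and ?B = "\<Sum>i<n. b (Suc i) * N ^ i"
  have eq: "a 0 + N * ?A = b 0 + N * ?B"
    using Suc.prems(3) by (simp only: split)
  have "a 0 < N" "b 0 < N" using Suc.prems(1,2) by auto
  then have "a 0 = (a 0 + N * ?A) mod N" "b 0 = (b 0 + N * ?B) mod N"
    by auto
  then have 0: "a 0 = b 0" using eq by simp
  then have "?A = ?B" using eq \<open>a 0 < N\<close> by auto
  then have "a (Suc j) = b (Suc j)" if "j < n" for j
    using Suc.IH[of "\<lambda>i. a (Suc i)" "\<lambda>i. b (Suc i)" j] Suc.prems(1,2) that by auto
  with 0 Suc.prems(4) show ?case by (cases i) auto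
qed simp

text \<open>
  Kronecker's substitution: if \<open>N\<close> exceeds all exponents, then \<open>x\<^sub>i = t ^ N ^ i\<close> sends distinct
  monomials to distinct powers of \<open>t\<close>. The result is a nonzero polynomial in one variable, and
  over an infinite field it has a nonroot.
\<close>

lemma exists_nonroot:
  fixes c :: "(nat \<Rightarrow>\<^sub>0 nat) \<Rightarrow> 'f::field_char_0"
  assumes fin: "finite A" and "\<alpha> \<in> A" "c \<alpha> \<noteq> 0"
  shows "\<exists>x. (\<Sum>\<beta>\<in>A. c \<beta> * mval x \<beta>) \<noteq> 0"
proof -
  let ?I = "\<Union>\<beta>\<in>A. keys \<beta>"
  have finI: "finite ?I" using fin by auto
  obtain n where n: "?I \<subseteq> {..<n}" using finite_nat_iff_bounded[of ?I] finI by blast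
  have "finite (\<Union>\<beta>\<in>A. lookup \<beta> ` {..<n})" using fin by auto
  then obtain N where N: "(\<Union>\<beta>\<in>A. lookup \<beta> ` {..<n}) \<subseteq> {..<N}"
    using finite_nat_iff_bounded by blast
  define code where "code \<beta> = (\<Sum>i<n. lookup \<beta> i * N ^ i)" for \<beta>
  have inj: "inj_on code A"
  proof (rule inj_onI)
    fix \<beta> \<gamma> assume *: "\<beta> \<in> A" "\<gamma> \<in> A" "code \<beta> = code \<gamma>"
    have "lookup \<beta> i = lookup \<gamma> i" for i
    proof (cases "i < n")
      case True
      show ?thesis
        by (rule digits_inject[of n _ N]) (use * N True in \<open>auto simp: code_def\<close>)
    next
      case False
      then have "i \<notin> keys \<beta>" "i \<notin> keys \<gamma>" using * n by auto
      then show ?thesis by (simp add: in_keys_iff)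
    qed
    then show "\<beta> = \<gamma>" by (rule poly_mapping_eqI)
  qed
  define P where "P = (\<Sum>\<beta>\<in>A. monom (c \<beta>) (code \<beta>))"
  have "coeff P (code \<alpha>) = (\<Sum>\<beta>\<in>A. if \<beta> = \<alpha> then c \<beta> else 0)"
    unfolding P_def coeff_sum
    by (rule sum.cong) (use inj assms in \<open>auto simp: inj_on_def\<close>)
  then have "P \<noteq> 0" using assms by auto
  then obtain t where t: "poly P t \<noteq> 0" using poly_all_0_iff_0 by blast
  have m: "mval (\<lambda>i. t ^ N ^ i) \<beta> = t ^ code \<beta>" if "\<beta> \<in> A" for \<beta>
  proof -
    have "mval (\<lambda>i. t ^ N ^ i) \<beta> = (\<Prod>i<n. (t ^ N ^ i) ^ lookup \<beta> i)"
      by (rule mval_superset) (use n that in auto)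
    also have "\<dots> = t ^ code \<beta>"
      by (simp add: code_def power_sum mult.commute flip: power_mult)
    finally show ?thesis .
  qed
  have "(\<Sum>\<beta>\<in>A. c \<beta> * mval (\<lambda>i. t ^ N ^ i) \<beta>) = poly P t"
    by (simp add: P_def poly_sum poly_monom m)
  with t show ?thesis by metis
qed

context poly_module
begin

text \<open>
  Linear functionals reduce statements on polynomials with coefficients in a module to
  polynomials with coefficients in the field.
\<close>

lemma exists_functional:
  assumes "m \<noteq> 0"
  obtains \<phi> :: "'m \<Rightarrow> 'f" where
    "\<And>a b. \<phi> (a + b) = \<phi> a + \<phi> b" "\<And>k a. \<phi> (s [:k:] a) = k * \<phi> a" "\<phi> m = 1"
proof -
  interpret v1: vector_space "\<lambda>k. s [:k:]" by (rule vector_space_consts)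
  interpret v2: vector_space "(*) :: 'f \<Rightarrow> 'f \<Rightarrow> 'f"
    by unfold_locales (auto simp: algebra_simps)
  interpret vp: vector_space_pair "\<lambda>k. s [:k:]" "(*) :: 'f \<Rightarrow> 'f \<Rightarrow> 'f" ..
  have "v1.independent {m}" using assms v1.independent_insert[of m "{}"] by simp
  from vp.linear_independent_extend[OF this, of "\<lambda>_. 1"]
  obtain g where g: "Vector_Spaces.linear (\<lambda>k. s [:k:]) (*) g" "g m = 1" by auto
  interpret l: Vector_Spaces.linear "\<lambda>k. s [:k:]" "(*)" g by (rule g)
  show ?thesis using that[of g] g l.add l.scale by blast
qed

lemma eval_eq_0:
  assumes "\<And>x. eval s x u = 0"
  shows "u = 0"
proof (rule ccontr)
  assume "u \<noteq> 0"
  then obtain \<alpha> where \<alpha>: "\<alpha> \<in> keys u" by fastforce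
  then have nz: "lookup u \<alpha> \<noteq> 0" by (simp add: in_keys_iff)
  obtain \<phi> :: "'m \<Rightarrow> 'f" where \<phi>: "\<And>a b. \<phi> (a + b) = \<phi> a + \<phi> b"
      "\<And>k a. \<phi> (s [:k:] a) = k * \<phi> a" "\<phi> (lookup u \<alpha>) = 1"
    using exists_functional[OF nz] by blast
  have \<phi>0: "\<phi> 0 = 0" using \<phi>(1)[of 0 0] by simp
  have \<phi>sum: "\<phi> (sum g A) = (\<Sum>i\<in>A. \<phi> (g i))" for g and A :: "(nat \<Rightarrow>\<^sub>0 nat) set"
    by (induction A rule: infinite_finite_induct) (auto simp: \<phi> \<phi>0)
  obtain x where "(\<Sum>\<beta>\<in>keys u. \<phi> (lookup u \<beta>) * mval x \<beta>) \<noteq> 0"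
    using exists_nonroot[of "keys u" \<alpha> "\<lambda>\<beta>. \<phi> (lookup u \<beta>)"] \<alpha> \<phi> by auto
  then have "\<phi> (eval s x u) \<noteq> 0"
    by (simp add: eval_def \<phi>sum \<phi> mult.commute)
  with assms \<phi>0 show False by simp
qed

lemma eval_inject:
  assumes "\<And>x. eval s x u = eval s x v"
  shows "u = v"
  using eval_eq_0[of "u - v"] assms by (simp add: eval_diff)

text \<open>
  Deleting all monomials that involve a variable of index at least \<open>q\<close> amounts to evaluating
  these variables at 0, which by assumption changes no value.
\<close>

lemma keys_subset_if_eval_local:
  assumes "\<And>x y. (\<And>i. i < q \<Longrightarrow> x i = y i) \<Longrightarrow> eval s x u = eval s y u"
    and "\<alpha> \<in> keys u"
  shows "keys \<alpha> \<subseteq> {..<q}"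
proof -
  let ?K = "{\<alpha>\<in>keys u. keys \<alpha> \<subseteq> {..<q}}"
  define u' where "u' = (\<Sum>\<alpha>\<in>?K. single \<alpha> (lookup u \<alpha>))"
  have "eval s x u' = eval s x u" for x
  proof -
    define y where "y i = (if i < q then x i else 0)" for i
    have y: "mval y \<alpha> = (if keys \<alpha> \<subseteq> {..<q} then mval x \<alpha> else 0)" for \<alpha>
    proof (cases "keys \<alpha> \<subseteq> {..<q}")
      case True
      then show ?thesis by (auto simp: y_def intro!: mval_cong)
    next
      case False
      then obtain i where "i \<in> keys \<alpha>" "\<not> i < q" by auto
      then show ?thesis
        using False unfolding mval_def by (auto simp: y_def in_keys_iff intro!: prod_zero bexI[of _ i])
    qed
    have "eval s x u' = (\<Sum>\<alpha>\<in>?K. s [:mval x \<alpha>:] (lookup u \<alpha>))"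
      by (simp add: u'_def eval_sum)
    also have "\<dots> = eval s y u"
      unfolding eval_def by (rule sum.mono_neutral_cong_left) (auto simp: y)
    also have "\<dots> = eval s x u" by (rule assms) (simp add: y_def)
    finally show ?thesis .
  qed
  then have "u' = u" by (rule eval_inject)
  moreover have "keys u' \<subseteq> ?K"
    unfolding u'_def by (rule order_trans[OF keys_sum]) auto
  ultimately show ?thesis using assms(2) by auto
qed

lemma eval_local:
  assumes "\<And>\<alpha>. \<alpha> \<in> keys u \<Longrightarrow> keys \<alpha> \<subseteq> {..<q}"
    and "\<And>i. i < q \<Longrightarrow> x i = y i"
  shows "eval s x u = eval s y u"
  unfolding eval_def using assms
  by (intro sum.cong refl arg_cong2[where f = s] arg_cong[where f = "\<lambda>c. [:c:]"] mval_cong)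
    (auto dest!: subsetD)

text \<open>
  The coefficient at \<open>t ^ n\<close> of a polynomial function. As a relation it follows the structure of
  \<open>\<phi>\<close> by introduction rules, and \<open>tcoeff_unique\<close> turns two derivations into an equation.
\<close>

definition tcoeff :: "nat \<Rightarrow> ('f \<Rightarrow> 'm) \<Rightarrow> 'm \<Rightarrow> bool" where
  "tcoeff n \<phi> m \<longleftrightarrow> (\<exists>P. (\<forall>t. \<phi> t = pev s P [:t:]) \<and> coeff P n = m)"

lemma pev_eq_0:
  assumes "\<And>t. pev s P [:t:] = 0"
  shows "P = 0"
proof (rule poly_eqI)
  fix n
  let ?u = "(\<Sum>k\<le>degree P. single (single 0 k) (coeff P k)) :: 'm mpol"
  have "eval s x ?u = 0" for x
    using assms[of "x 0"] by (simp add: eval_sum pev_def const_poly_power)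
  then have "?u = 0" by (rule eval_eq_0)
  then have "0 = lookup ?u (single 0 n)" by simp
  also have "\<dots> = (\<Sum>k\<le>degree P. if k = n then coeff P n else 0)"
    unfolding lookup_sum by (rule sum.cong) (auto simp: lookup_single when_def dest: inj_onD[OF inj_single])
  finally show "coeff P n = coeff 0 n" by (auto simp: coeff_eq_0 split: if_splits)
qed

lemma pev_uminus: "pev s (- P) r = - pev s P r"
  by (simp add: pev_def sum_negf)

lemma tcoeff_unique:
  assumes "tcoeff n \<phi> m" "tcoeff n \<phi> m'"
  shows "m = m'"
proof -
  obtain P Q where *: "\<forall>t. \<phi> t = pev s P [:t:]" "coeff P n = m"
      "\<forall>t. \<phi> t = pev s Q [:t:]" "coeff Q n = m'"
    using assms by (auto simp: tcoeff_def)
  then have "pev s (P + (- Q)) [:t:] = 0" for t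
    unfolding pev_add pev_uminus by (metis add.right_inverse)
  then have "P + (- Q) = 0" by (rule pev_eq_0)
  then show ?thesis using * by auto
qed

lemma tcoeff_add:
  "tcoeff n \<phi> m \<Longrightarrow> tcoeff n \<psi> m' \<Longrightarrow> tcoeff n (\<lambda>t. \<phi> t + \<psi> t) (m + m')"
  unfolding tcoeff_def by (metis pev_add coeff_add)

lemma tcoeff_scale:
  assumes "tcoeff n \<phi> m"
  shows "tcoeff n (\<lambda>t. s p (\<phi> t)) (s p m)"
proof -
  obtain P where P: "\<forall>t. \<phi> t = pev s P [:t:]" "coeff P n = m"
    using assms by (auto simp: tcoeff_def)
  have "pev s (map_poly (s p) P) r = s p (pev s P r)" for r
    by (rule pev_map_poly) (auto simp: scale_right_distrib mult.commute)
  with P show ?thesis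
    unfolding tcoeff_def by (intro exI[of _ "map_poly (s p) P"]) (auto simp: coeff_map_poly)
qed

lemma tcoeff_uminus: "tcoeff n \<phi> m \<Longrightarrow> tcoeff n (\<lambda>t. - \<phi> t) (- m)"
  using tcoeff_scale[of n \<phi> m "-1"] by simp

lemma tcoeff_diff:
  "tcoeff n \<phi> m \<Longrightarrow> tcoeff n \<psi> m' \<Longrightarrow> tcoeff n (\<lambda>t. \<phi> t - \<psi> t) (m - m')"
  using tcoeff_add[of n \<phi> m "\<lambda>t. - \<psi> t" "- m'"] tcoeff_uminus by simp

lemma tcoeff_0: "tcoeff n (\<lambda>t. 0) 0"
  unfolding tcoeff_def by (intro exI[of _ 0]) auto

lemma tcoeff_sum:
  "(\<And>i. i \<in> A \<Longrightarrow> tcoeff n (\<phi> i) (m i)) \<Longrightarrow> tcoeff n (\<lambda>t. \<Sum>i\<in>A. \<phi> i t) (\<Sum>i\<in>A. m i)"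
  by (induction A rule: infinite_finite_induct) (auto intro: tcoeff_add tcoeff_0)

lemma tcoeff_pev: "tcoeff n (\<lambda>t. pev s P [:t:]) (coeff P n)"
  unfolding tcoeff_def by auto

lemma tcoeff_monom: "tcoeff n (\<lambda>t. s [:t ^ k:] m) (if k = n then m else 0)"
proof -
  show ?thesis using tcoeff_pev[of n "monom m k"] by (simp add: pev_monom const_poly_power)
qed

lemma tcoeff_poly: "tcoeff n (\<lambda>t. s [:poly p t:] m) (s [:coeff p n:] m)"
proof -
  have "tcoeff n (\<lambda>t. \<Sum>k\<le>degree p. s [:coeff p k:] (s [:t ^ k:] m))
      (\<Sum>k\<le>degree p. s [:coeff p k:] (if k = n then m else 0))"
    by (intro tcoeff_sum tcoeff_scale tcoeff_monom)
  moreover have "(\<Sum>k\<le>degree p. s [:coeff p k:] (if k = n then m else 0)) = s [:coeff p n:] m"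
  proof -
    have "(\<Sum>k\<le>degree p. s [:coeff p k:] (if k = n then m else 0)) =
        (\<Sum>k\<le>degree p. if k = n then s [:coeff p n:] m else 0)"
      by (rule sum.cong) auto
    then show ?thesis by (auto simp: coeff_eq_0)
  qed
  moreover have "(\<Sum>k\<le>degree p. s [:coeff p k:] (s [:t ^ k:] m)) = s [:poly p t:] m" for t
    by (simp add: poly_altdef mult.commute flip: scale_sum_left const_poly_sum)
  ultimately show ?thesis by simp
qed

lemma tcoeff_0_eval: "tcoeff 0 \<phi> m \<Longrightarrow> \<phi> 0 = m"
proof -
  assume "tcoeff 0 \<phi> m"
  then obtain P where P: "\<forall>t. \<phi> t = pev s P [:t:]" "coeff P 0 = m"
    by (auto simp: tcoeff_def)
  have "pev s P 0 = (\<Sum>n\<le>degree P. if n = 0 then coeff P 0 else 0)"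
    unfolding pev_def by (rule sum.cong) (auto simp: power_0_left)
  with P show ?thesis by simp
qed

lemma pev_pCons: "pev s (pCons m P) r = m + s r (pev s P r)"
proof -
  have "pev s (pCons m P) r = (\<Sum>n\<le>Suc (degree P). s (r ^ n) (coeff (pCons m P) n))"
    by (rule pev_bound) (rule degree_pCons_le)
  also have "\<dots> = m + (\<Sum>n\<le>degree P. s r (s (r ^ n) (coeff P n)))"
    by (subst sum.atMost_Suc_shift) simp
  finally show ?thesis by (simp add: pev_def scale_sum_right del: scale_scale)
qed

lemma tcoeff_times_t:
  assumes "tcoeff n \<phi> m"
  shows "tcoeff (Suc n) (\<lambda>t. s [:t:] (\<phi> t)) m" "tcoeff 0 (\<lambda>t. s [:t:] (\<phi> t)) 0"
proof -
  obtain P where P: "\<forall>t. \<phi> t = pev s P [:t:]" "coeff P n = m"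
    using assms by (auto simp: tcoeff_def)
  then have "\<forall>t. s [:t:] (\<phi> t) = pev s (pCons 0 P) [:t:]"
    by (simp add: pev_pCons)
  with P show "tcoeff (Suc n) (\<lambda>t. s [:t:] (\<phi> t)) m" "tcoeff 0 (\<lambda>t. s [:t:] (\<phi> t)) 0"
    unfolding tcoeff_def by (intro exI[of _ "pCons 0 P"]; simp)+
qed

lemma tcoeff_const: "tcoeff 0 (\<lambda>t. m) m" "tcoeff (Suc n) (\<lambda>t. m) 0"
  using tcoeff_monom[of 0 0 m] tcoeff_monom[of "Suc n" 0 m] by (simp_all flip: one_pCons)

text \<open>The first two Taylor coefficients of \<open>p(\<partial> + t)\<close>.\<close>

lemma tcoeff_shift:
  "tcoeff 0 (\<lambda>t. s (pcompose p [:t, 1:]) m) (s p m)"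
  "tcoeff (Suc 0) (\<lambda>t. s (pcompose p [:t, 1:]) m) (s (pderiv p) m)"
proof -
  have "tcoeff 0 (\<lambda>t. s (pcompose p [:t, 1:]) m) (s p m) \<and>
    tcoeff (Suc 0) (\<lambda>t. s (pcompose p [:t, 1:]) m) (s (pderiv p) m)"
  proof (induction p)
    case 0
    show ?case by (simp add: tcoeff_0)
  next
    case (pCons c p)
    let ?\<phi> = "\<lambda>t. s (pcompose p [:t, 1:]) m"
    have eq: "s (pcompose (pCons c p) [:t, 1:]) m = s [:c:] m + (s [:0, 1:] (?\<phi> t) + s [:t:] (?\<phi> t))" for t
    proof -
      have "pcompose (pCons c p) [:t, 1:] = [:c:] + ([:0, 1:] * pcompose p [:t, 1:] + [:t:] * pcompose p [:t, 1:])"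
        by (simp add: pcompose_pCons add.commute)
      then show ?thesis by (simp only: scale_left_distrib scale_scale)
    qed
    have "tcoeff 0 (\<lambda>t. s [:c:] m + (s [:0, 1:] (?\<phi> t) + s [:t:] (?\<phi> t))) (s [:c:] m + (s [:0, 1:] (s p m) + 0))"
      using pCons.IH by (intro tcoeff_add tcoeff_const tcoeff_scale tcoeff_times_t) auto
    moreover have "tcoeff (Suc 0) (\<lambda>t. s [:c:] m + (s [:0, 1:] (?\<phi> t) + s [:t:] (?\<phi> t)))
        (0 + (s [:0, 1:] (s (pderiv p) m) + s p m))"
      using pCons.IH by (intro tcoeff_add tcoeff_const tcoeff_scale tcoeff_times_t) auto
    ultimately show ?case
      unfolding eq by (simp add: pderiv_pCons add.commute flip: scale_left_distrib)
  qed
  then show "tcoeff 0 (\<lambda>t. s (pcompose p [:t, 1:]) m) (s p m)"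
    "tcoeff (Suc 0) (\<lambda>t. s (pcompose p [:t, 1:]) m) (s (pderiv p) m)" by auto
qed

lemma lookup_pact_const: "lookup (pact s (const r) u) \<alpha> = s r (lookup u \<alpha>)"
proof (cases "r = 0")
  case True
  then show ?thesis by (simp add: pact_def const_def)
next
  case False
  then have "lookup (pact s (const r) u) \<alpha>
      = (\<Sum>\<beta>\<in>keys u. if \<beta> = \<alpha> then s r (lookup u \<beta>) else 0)"
    by (simp add: pact_def const_def lookup_sum lookup_single when_def)
  then show ?thesis by (simp add: sum.delta in_keys_iff)
qed

end

text \<open>
  The coefficient of \<open>\<lambda>\<^sub>0 ^ n\<close>. The key \<open>map_key Suc \<alpha>\<close> is \<open>\<alpha> \<circ> Suc\<close>: it forgets the
  exponent of \<open>\<lambda>\<^sub>0\<close> and renumbers the remaining variables from 0.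
\<close>

definition slice :: "nat \<Rightarrow> 'm::ab_group_add mpol \<Rightarrow> 'm mpol" where
  "slice n u = (\<Sum>\<alpha>\<in>{\<alpha>\<in>keys u. lookup \<alpha> 0 = n}.
     single (map_key Suc \<alpha>) (lookup u \<alpha>))"

lemma mval_case_nat:
  "mval (case_nat t x) \<alpha> = t ^ lookup \<alpha> 0 * mval x (map_key Suc \<alpha>)"
proof -
  obtain n where n: "keys \<alpha> \<subseteq> {..<n}"
    using finite_nat_iff_bounded[of "keys \<alpha>"] by auto
  have "mval (case_nat t x) \<alpha> = (\<Prod>i<Suc n. case_nat t x i ^ lookup \<alpha> i)"
    by (rule mval_superset) (use n in auto)
  also have "\<dots> = t ^ lookup \<alpha> 0 * (\<Prod>i<n. x i ^ lookup \<alpha> (Suc i))"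
    unfolding prod.lessThan_Suc_shift by simp
  also have "(\<Prod>i<n. x i ^ lookup \<alpha> (Suc i)) = mval x (map_key Suc \<alpha>)"
    by (subst mval_superset[of "{..<n}"])
      (use n in \<open>auto simp: keys_map_key map_key.rep_eq\<close>)
  finally show ?thesis .
qed

lemma (in poly_module) tcoeff_slice:
  "tcoeff n (\<lambda>t. eval s (case_nat t x) u) (eval s x (slice n u))"
proof -
  let ?m = "\<lambda>\<alpha>. s [:mval x (map_key Suc \<alpha>):] (lookup u \<alpha>)"
  have "tcoeff n (\<lambda>t. \<Sum>\<alpha>\<in>keys u. s [:t ^ lookup \<alpha> 0:] (?m \<alpha>))
      (\<Sum>\<alpha>\<in>keys u. if lookup \<alpha> 0 = n then ?m \<alpha> else 0)"
    by (intro tcoeff_sum tcoeff_monom)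
  moreover have "(\<Sum>\<alpha>\<in>keys u. if lookup \<alpha> 0 = n then ?m \<alpha> else 0) =
      eval s x (slice n u)"
    by (simp add: slice_def eval_sum sum.If_cases Int_def)
  moreover have "(\<Sum>\<alpha>\<in>keys u. s [:t ^ lookup \<alpha> 0:] (?m \<alpha>)) =
      eval s (case_nat t x) u" for t
    by (simp add: eval_def mval_case_nat mult.commute)
  ultimately show ?thesis by simp
qed

lemma mval_upd: "mval (x(i := y)) \<alpha> = y ^ lookup \<alpha> i * mval (x(i := 1)) \<alpha>"
proof -
  let ?A = "insert i (keys \<alpha>)"
  have "mval (x(i := y)) \<alpha> = y ^ lookup \<alpha> i * (\<Prod>j\<in>keys \<alpha> - {i}. x j ^ lookup \<alpha> j)" for y
  proof -
    have "mval (x(i := y)) \<alpha> = (\<Prod>j\<in>?A. (x(i := y)) j ^ lookup \<alpha> j)"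
      by (rule mval_superset) auto
    also have "?A = insert i (keys \<alpha> - {i})" by auto
    also have "(\<Prod>j\<in>insert i (keys \<alpha> - {i}). (x(i := y)) j ^ lookup \<alpha> j)
        = y ^ lookup \<alpha> i * (\<Prod>j\<in>keys \<alpha> - {i}. (x(i := y)) j ^ lookup \<alpha> j)"
      by (subst prod.insert) auto
    also have "(\<Prod>j\<in>keys \<alpha> - {i}. (x(i := y)) j ^ lookup \<alpha> j) = (\<Prod>j\<in>keys \<alpha> - {i}. x j ^ lookup \<alpha> j)"
      by (rule prod.cong) auto
    finally show ?thesis .
  qed
  from this[of y] this[of 1] show ?thesis by simp
qed

lemma mval_split: "mval x \<alpha> = x i ^ lookup \<alpha> i * mval (x(i := 1)) \<alpha>"
  using mval_upd[of x i "x i" \<alpha>] by simp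

text \<open>
  The factor \<open>y\<close> in the second equation avoids the exponent \<open>a - 1\<close>, which would be truncated
  for \<open>a = 0\<close>.
\<close>

lemma coeff_linear_power:
  fixes y :: "'f::comm_ring_1"
  shows "coeff ([:y, 1:] ^ a) 0 = y ^ a" "y * coeff ([:y, 1:] ^ a) (Suc 0) = of_nat a * y ^ a"
proof -
  show 0: "coeff ([:y, 1:] ^ a) 0 = y ^ a" for a
    by (induction a) auto
  show "y * coeff ([:y, 1:] ^ a) (Suc 0) = of_nat a * y ^ a"
    by (induction a) (auto simp: 0 algebra_simps)
qed

lemma transpose_invol: "Transposition.transpose i j (Transposition.transpose i j k) = k"
  by simp

lemma lookup_map_key_transpose:
  "lookup (map_key (Transposition.transpose i j) \<alpha>) k
    = lookup \<alpha> (Transposition.transpose i j k)"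
  by (simp add: map_key.rep_eq)

lemma map_key_transpose_invol:
  "map_key (Transposition.transpose i j) (map_key (Transposition.transpose i j) \<alpha>) = \<alpha>"
  by (rule poly_mapping_eqI) (simp add: lookup_map_key_transpose)

lemma mval_map_key_transpose:
  "mval x (map_key (Transposition.transpose i j) \<alpha>) = mval (x \<circ> Transposition.transpose i j) \<alpha>"
proof -
  let ?t = "Transposition.transpose i j"
  have "mval x (map_key ?t \<alpha>)
      = (\<Prod>k\<in>?t ` keys \<alpha>. x k ^ lookup \<alpha> (?t k))"
  proof (subst mval_superset[of "?t ` keys \<alpha>"])
    show "keys (map_key ?t \<alpha>) \<subseteq> ?t ` keys \<alpha>"
    proof
      fix k assume "k \<in> keys (map_key ?t \<alpha>)"
      then have "?t k \<in> keys \<alpha>" by (simp add: in_keys_iff lookup_map_key_transpose)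
      then show "k \<in> ?t ` keys \<alpha>" by (metis imageI transpose_invol)
    qed
  qed (auto simp: lookup_map_key_transpose)
  also have "\<dots> = mval (x \<circ> ?t) \<alpha>"
    by (subst prod.reindex) (auto simp: mval_def)
  finally show ?thesis .
qed

section \<open>Modules evaluated at points\<close>

text \<open>The \<open>\<lambda>\<close>-action \<open>a\<^bsub>\<lambda>\<^esub> m\<close> at \<open>\<lambda> = x\<close>, for \<open>u = (a, x)\<close>.\<close>

definition lact :: "('f::field poly \<Rightarrow> 'm::ab_group_add \<Rightarrow> 'm) \<Rightarrow> ('a \<Rightarrow> 'm \<Rightarrow> 'm poly) \<Rightarrow> 'a \<times> 'f \<Rightarrow> 'm \<Rightarrow> 'm" where
  "lact s act u m = pev s (act (fst u) m) [:snd u:]"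

text \<open>
  In the differential, \<open>[a\<^bsub>\<lambda>\<^esub> b]\<close> becomes an argument with the variable \<open>\<lambda> + \<mu>\<close>; hence the
  parameters add up.
\<close>

definition lbr :: "('f::field poly \<Rightarrow> 'a::ab_group_add \<Rightarrow> 'a) \<Rightarrow> ('a \<Rightarrow> 'a \<Rightarrow> 'a poly) \<Rightarrow> 'a \<times> 'f \<Rightarrow> 'a \<times> 'f \<Rightarrow> 'a \<times> 'f" where
  "lbr s br u v = (lact s br u (fst v), snd u + snd v)"

locale conformal_module_char0 = lie_conformal_module s br sM act
  for s :: "'f::field_char_0 poly \<Rightarrow> 'a::ab_group_add \<Rightarrow> 'a" and br
    and sM :: "'f poly \<Rightarrow> 'm::ab_group_add \<Rightarrow> 'm" and act
begin

sublocale PA: poly_module s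
  by (simp add: poly_module_def A.module_axioms)

sublocale PM: poly_module sM
  by (simp add: poly_module_def M.module_axioms)

abbreviation app :: "'a \<times> 'f \<Rightarrow> 'm \<Rightarrow> 'm" where "app \<equiv> lact sM act"
abbreviation brk :: "'a \<times> 'f \<Rightarrow> 'a \<times> 'f \<Rightarrow> 'a \<times> 'f" where "brk \<equiv> lbr s br"

lemma app_add_right: "app u (m + n) = app u m + app u n"
  by (simp add: lact_def act_add_right M.pev_add)

lemma app_0_right [simp]: "app u 0 = 0"
  using app_add_right[of u 0 0] by simp

lemma app_uminus_right: "app u (- m) = - app u m"
  using app_add_right[of u m "- m"] by (simp add: eq_neg_iff_add_eq_0 add.commute)

lemma app_diff_right: "app u (m - n) = app u m - app u n"
  using app_add_right[of u m "- n"] by (simp add: app_uminus_right)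

lemma app_sum_right: "app u (sum g A) = (\<Sum>i\<in>A. app u (g i))"
  by (induction A rule: infinite_finite_induct) (auto simp: app_add_right)

lemma app_add_left: "app (a + b, x) m = app (a, x) m + app (b, x) m"
  by (simp add: lact_def act_add_left M.pev_add)

lemma app_0_left [simp]: "app (0, x) m = 0"
  using app_add_left[of 0 0 x m] by simp

lemma app_sum_left: "app (sum g A, x) m = (\<Sum>i\<in>A. app (g i, x) m)"
  by (induction A rule: infinite_finite_induct) (auto simp: app_add_left)

lemma pev_map_const: "pev sM (map_poly (sM [:k:]) P) r = sM [:k:] (pev sM P r)"
  by (rule M.pev_map_poly) (auto simp: M.scale_right_distrib mult.commute)

lemma app_scale_right: "app u (sM [:k:] m) = sM [:k:] (app u m)"
  by (simp add: lact_def act_scale_right pev_map_const)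

lemma app_scale_left: "app (s [:k:] a, x) m = sM [:k:] (app (a, x) m)"
  by (simp add: lact_def act_scale_left pev_map_const)

lemma app_del_left: "app (s [:0, 1:] a, x) m = sM [:- x:] (app (a, x) m)"
  using arg_cong[OF act_del_left[of a m], of "eval sM (\<lambda>_. x)"]
  by (simp add: PM.eval_poly_at PM.eval_pact rval_simps lact_def)

lemma app_del_right: "app (a, x) (sM [:0, 1:] m) = sM [:x, 1:] (app (a, x) m)"
  using arg_cong[OF act_del_right[of a m], of "eval sM (\<lambda>_. x)"]
  by (simp add: PM.eval_poly_at PM.eval_pact rval_simps lact_def)

text \<open>The action commutes with evaluation because it is bilinear over the constants.\<close>

lemma eval_act_at:
  assumes "rval x p = [:y:]"
  shows "eval sM x (act_at sM act w p u) = app (eval s x w, y) (eval sM x u)"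
proof -
  have "app (eval s x w, y) (eval sM x u) =
      (\<Sum>\<alpha>\<in>keys w. \<Sum>\<beta>\<in>keys u.
        sM [:mval x \<alpha> * mval x \<beta>:]
          (app (lookup w \<alpha>, y) (lookup u \<beta>)))"
    unfolding eval_def[of s] eval_def[of sM x u] app_sum_left app_sum_right
    by (simp add: app_scale_left app_scale_right mult.commute)
      (subst sum.swap, simp add: mult.commute)
  also have "\<dots> = eval sM x (act_at sM act w p u)"
    unfolding act_at_def PM.eval_sum
    by (simp add: PM.eval_pact PM.eval_poly_at assms mval_add lact_def)
  finally show ?thesis by simp
qed

lemma app_scale_poly_left: "app (s p a, x) m = sM [:poly p (- x):] (app (a, x) m)"
proof (induction p)
  case (pCons c p)
  have "s (pCons c p) a = s [:c:] a + s [:0, 1:] (s p a)"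
    by (simp flip: A.scale_left_distrib)
  then show ?case
    by (simp only: app_add_left app_scale_left app_del_left pCons.IH)
      (simp add: mult.commute flip: M.scale_left_distrib)
qed simp

lemma app_scale_poly_right: "app (a, x) (sM p m) = sM (pcompose p [:x, 1:]) (app (a, x) m)"
proof (induction p)
  case (pCons c p)
  have "sM (pCons c p) m = sM [:c:] m + sM [:0, 1:] (sM p m)"
    by (simp flip: M.scale_left_distrib)
  then show ?case
    by (simp only: app_add_right app_scale_right app_del_right pCons.IH)
      (simp add: pcompose_pCons flip: M.scale_left_distrib)
qed simp

lemma adjoint_char0: "conformal_module_char0 s br s br"
  by (simp add: conformal_module_char0_def A.adjoint_module)

lemma app_jacobi: "app u (app v m) - app v (app u m) = app (brk u v) m"
proof -
  let ?x = "case_nat (snd u) (\<lambda>_. snd v) :: nat \<Rightarrow> 'f"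
  have r: "rval ?x (var 0) = [:snd u:]" "rval ?x (var 1) = [:snd v:]"
      "rval ?x (var 0 + var 1) = [:snd u + snd v:]"
    by (simp_all add: rval_simps)
  have "eval sM ?x (act_at sM act (const (fst u)) (var 0)
        (act_at sM act (const (fst v)) (var 1) (const m))
      - act_at sM act (const (fst v)) (var 1)
        (act_at sM act (const (fst u)) (var 0) (const m))) =
    eval sM ?x (act_at sM act (act_at s br (const (fst u)) (var 0) (const (fst v)))
      (var 0 + var 1) (const m))"
    by (simp only: act_jacobi)
  then show ?thesis
    by (simp only: PM.eval_diff eval_act_at[OF r(1)] eval_act_at[OF r(2)] eval_act_at[OF r(3)]
        PM.eval_const PA.eval_const conformal_module_char0.eval_act_at[OF adjoint_char0 r(1)])
      (simp add: lbr_def lact_def)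
qed

lemmas br_add_right' = conformal_module_char0.app_add_right[OF adjoint_char0]
lemmas br_add_left' = conformal_module_char0.app_add_left[OF adjoint_char0]
lemmas br_scale_poly_right' = conformal_module_char0.app_scale_poly_right[OF adjoint_char0]
lemmas br_scale_poly_left' = conformal_module_char0.app_scale_poly_left[OF adjoint_char0]
lemmas br_jacobi' = conformal_module_char0.app_jacobi[OF adjoint_char0]

section \<open>Cartan calculus\<close>

text \<open>
  The rule \<open>f(\<dots>, \<partial> a, \<dots>) = - \<lambda> f(\<dots>, a, \<dots>)\<close> and linearity over \<open>F\<close> together say that a
  polynomial \<open>p(\<partial>)\<close> in a slot with parameter \<open>x\<close> acts by \<open>p(- x)\<close>.
\<close>

definition slotwise :: "(('a \<times> 'f) list \<Rightarrow> 'm) \<Rightarrow> bool" where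
  "slotwise G \<longleftrightarrow> (\<forall>us vs x. (\<forall>a b. G (us @ (a + b, x) # vs) = G (us @ (a, x) # vs) + G (us @ (b, x) # vs))
     \<and> (\<forall>p a. G (us @ (s p a, x) # vs) = sM [:poly p (- x):] (G (us @ (a, x) # vs))))"

lemma slotwise_Cons: "slotwise G \<Longrightarrow> slotwise (\<lambda>ws. G (v # ws))"
  unfolding slotwise_def by (metis append_Cons)

lemma slotwiseD:
  assumes "slotwise G"
  shows "G (us @ (a + b, x) # vs) = G (us @ (a, x) # vs) + G (us @ (b, x) # vs)"
    and "G (us @ (s p a, x) # vs) = sM [:poly p (- x):] (G (us @ (a, x) # vs))"
    and "G ((a + b, x) # vs) = G ((a, x) # vs) + G ((b, x) # vs)"
    and "G ((s p a, x) # vs) = sM [:poly p (- x):] (G ((a, x) # vs))"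
proof -
  show 1: "G (us @ (a + b, x) # vs) = G (us @ (a, x) # vs) + G (us @ (b, x) # vs)"
    and 2: "G (us @ (s p a, x) # vs) = sM [:poly p (- x):] (G (us @ (a, x) # vs))" for us
    using assms by (simp_all add: slotwise_def)
  show "G ((a + b, x) # vs) = G ((a, x) # vs) + G ((b, x) # vs)"
    and "G ((s p a, x) # vs) = sM [:poly p (- x):] (G ((a, x) # vs))"
    using 1[of "[]"] 2[of "[]"] by simp_all
qed

lemma slotwise_0:
  assumes "slotwise G"
  shows "G (us @ (0, x) # vs) = 0"
  using slotwiseD(1)[OF assms, of us 0 0 x vs] by simp

lemma slotwise_uminus:
  assumes "slotwise G"
  shows "G (us @ (- a, x) # vs) = - G (us @ (a, x) # vs)"
  using slotwiseD(1)[OF assms, of us a "- a" x vs] slotwise_0[OF assms]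
  by (simp add: eq_neg_iff_add_eq_0 add.commute)

text \<open>
  Adjacent transpositions generate all permutations (\<open>alternating_permute\<close>), and unlike these
  they fit recursion on lists.
\<close>

definition alternating :: "(('a \<times> 'f) list \<Rightarrow> 'm) \<Rightarrow> bool" where
  "alternating G \<longleftrightarrow> (\<forall>us v w vs. G (us @ v # w # vs) = - G (us @ w # v # vs))"

lemma alternating_Cons: "alternating G \<Longrightarrow> alternating (\<lambda>ws. G (v # ws))"
  unfolding alternating_def by (metis append_Cons)

lemma alternatingD:
  assumes "alternating G"
  shows "G (us @ v # w # vs) = - G (us @ w # v # vs)"
    and "G (v # w # vs) = - G (w # v # vs)"
  using assms append_Nil unfolding alternating_def by metis+

lemma slotwise_pev:
  assumes "slotwise G"
  shows "G (us @ (pev s P r, x) # vs) = G (us @ (pev s P [:poly r (- x):], x) # vs)"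
proof -
  have sum: "G (us @ (sum g A, x) # vs) = (\<Sum>i\<in>A. G (us @ (g i, x) # vs))"
    for g and A :: "nat set"
    by (induction A rule: infinite_finite_induct)
      (auto simp: slotwise_0[OF assms] slotwiseD[OF assms])
  show ?thesis
    by (simp add: pev_def sum slotwiseD[OF assms])
qed

text \<open>
  By the skew-symmetry axiom \<open>[a\<^bsub>x\<^esub> b] = - [b\<^bsub>-x-\<partial>\<^esub> a]\<close>. In a slot with parameter \<open>x + y\<close>
  the operator \<open>\<partial>\<close> is \<open>- x - y\<close>, so that \<open>- x - \<partial>\<close> becomes \<open>y\<close>.
\<close>

lemma brk_skew:
  assumes "slotwise G"
  shows "G (us @ brk u v # vs) = - G (us @ brk v u # vs)"
proof -
  obtain a x b y where uv: "u = (a, x)" "v = (b, y)" by (metis surj_pair)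
  have "eval s (\<lambda>_. x) (poly_at s (br a b) (var 0)) = eval s (\<lambda>_. x) (- poly_at s (br b a) (- var 0 - del))"
    by (simp only: A.br_skew[of a b])
  then have "pev s (br a b) [:x:] = - pev s (br b a) [:- x, - 1:]"
    by (simp add: PA.eval_uminus PA.eval_poly_at rval_simps)
  then show ?thesis
    by (simp add: lbr_def lact_def uv slotwise_uminus[OF assms] add.commute
        slotwise_pev[OF assms, of us "br b a" "[:- x, - 1:]"])
qed

text \<open>
  Write \<open>\<iota>\<^sub>v G\<close> for \<open>\<lambda>ws. G (v # ws)\<close>. The Lie derivative is defined by
  \<open>\<iota>\<^sub>v \<theta>\<^sub>u = \<theta>\<^sub>u \<iota>\<^sub>v - \<iota>\<^bsub>[u, v]\<^esub>\<close>, and the Chevalley-Eilenberg differential by Cartan's formula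
  \<open>\<iota>\<^sub>u d = \<theta>\<^sub>u - d \<iota>\<^sub>u\<close>. That this agrees with the usual sum is \<open>ce_sum_eq_ce_d\<close>.
\<close>

primrec lie_d :: "'a \<times> 'f \<Rightarrow> (('a \<times> 'f) list \<Rightarrow> 'm) \<Rightarrow> ('a \<times> 'f) list \<Rightarrow> 'm" where
  "lie_d u G [] = app u (G [])"
| "lie_d u G (v # us) = lie_d u (\<lambda>ws. G (v # ws)) us - G (brk u v # us)"

primrec ce_d :: "(('a \<times> 'f) list \<Rightarrow> 'm) \<Rightarrow> ('a \<times> 'f) list \<Rightarrow> 'm" where
  "ce_d G [] = 0"
| "ce_d G (u # us) = lie_d u G us - ce_d (\<lambda>ws. G (u # ws)) us"

declare lie_d.simps(2) [simp del] ce_d.simps(2) [simp del]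

lemma lie_d_add: "lie_d u (\<lambda>ws. G ws + G' ws) us = lie_d u G us + lie_d u G' us"
  by (induction us arbitrary: G G') (auto simp: app_add_right lie_d.simps(2))

lemma lie_d_diff: "lie_d u (\<lambda>ws. G ws - G' ws) us = lie_d u G us - lie_d u G' us"
  by (induction us arbitrary: G G') (auto simp: app_diff_right lie_d.simps(2))

lemma lie_d_uminus: "lie_d u (\<lambda>ws. - G ws) us = - lie_d u G us"
  by (induction us arbitrary: G) (auto simp: app_uminus_right lie_d.simps(2))

lemma lie_d_scale: "lie_d u (\<lambda>ws. sM [:k:] (G ws)) us = sM [:k:] (lie_d u G us)"
  by (induction us arbitrary: G) (auto simp: app_scale_right M.scale_right_diff_distrib lie_d.simps(2))

lemma ce_d_add: "ce_d (\<lambda>ws. G ws + G' ws) us = ce_d G us + ce_d G' us"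
  by (induction us arbitrary: G G') (auto simp: lie_d_add ce_d.simps(2))

lemma ce_d_diff: "ce_d (\<lambda>ws. G ws - G' ws) us = ce_d G us - ce_d G' us"
  by (induction us arbitrary: G G') (auto simp: lie_d_diff ce_d.simps(2))

lemma ce_d_uminus: "ce_d (\<lambda>ws. - G ws) us = - ce_d G us"
  by (induction us arbitrary: G) (auto simp: lie_d_uminus ce_d.simps(2))

lemma ce_d_scale: "ce_d (\<lambda>ws. sM [:k:] (G ws)) us = sM [:k:] (ce_d G us)"
  by (induction us arbitrary: G) (auto simp: lie_d_scale M.scale_right_diff_distrib ce_d.simps(2))

lemma brk_add_right: "brk u (a + b, x) = (fst (brk u (a, x)) + fst (brk u (b, x)), snd u + x)"
  by (simp add: lbr_def br_add_right')

lemma brk_scale_right: "brk u (s p a, x) = (s (pcompose p [:snd u, 1:]) (fst (brk u (a, x))), snd u + x)"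
  using br_scale_poly_right'[of "fst u" "snd u" p a] by (simp add: lbr_def)

lemma brk_add_left: "brk (a + b, x) v = (fst (brk (a, x) v) + fst (brk (b, x) v), x + snd v)"
  by (simp add: lbr_def br_add_left')

lemma brk_scale_left: "brk (s p a, x) v = (s [:poly p (- x):] (fst (brk (a, x) v)), x + snd v)"
  by (simp add: lbr_def br_scale_poly_left')

lemma snd_brk [simp]: "snd (brk u v) = snd u + snd v"
  by (simp add: lbr_def)

lemma brk_eta: "(fst (brk u (a, x)), snd u + x) = brk u (a, x)"
  "(fst (brk (a, x) v), x + snd v) = brk (a, x) v"
  by (simp_all add: lbr_def)

lemma lie_d_slotwise:
  assumes "slotwise G"
  shows "slotwise (lie_d u G)"
proof -
  have "lie_d u G (us @ (a + b, x) # vs) = lie_d u G (us @ (a, x) # vs) + lie_d u G (us @ (b, x) # vs) \<and>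
      lie_d u G (us @ (s p a, x) # vs) = sM [:poly p (- x):] (lie_d u G (us @ (a, x) # vs))"
    for us vs a b x p
    using assms
  proof (induction us arbitrary: G)
    case Nil
    have "G (brk u (s p a, x) # vs) = sM [:poly p (- x):] (G (brk u (a, x) # vs))"
      by (simp add: brk_scale_right slotwiseD[OF Nil] poly_pcompose brk_eta)
    moreover have "G (brk u (a + b, x) # vs) = G (brk u (a, x) # vs) + G (brk u (b, x) # vs)"
      by (simp add: brk_add_right slotwiseD[OF Nil] brk_eta)
    ultimately show ?case
      by (simp add: lie_d.simps(2) slotwiseD[OF Nil] lie_d_add lie_d_scale M.scale_right_diff_distrib)
  next
    case (Cons w us)
    note Cons.IH[OF slotwise_Cons[OF Cons.prems]]
    with slotwiseD(1,2)[OF Cons.prems, of "brk u w # us"] show ?case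
      by (simp add: lie_d.simps(2) M.scale_right_diff_distrib)
  qed
  then show ?thesis unfolding slotwise_def by blast
qed

lemma lie_d_add_left:
  "slotwise G \<Longrightarrow> lie_d (a + b, x) G us = lie_d (a, x) G us + lie_d (b, x) G us"
proof (induction us arbitrary: G)
  case (Cons w us)
  have "G (brk (a + b, x) w # us) = G (brk (a, x) w # us) + G (brk (b, x) w # us)"
    by (simp add: brk_add_left slotwiseD[OF Cons.prems] brk_eta)
  then show ?case
    by (simp add: lie_d.simps(2) Cons.IH[OF slotwise_Cons[OF Cons.prems]])
qed (simp add: app_add_left)

lemma lie_d_scale_left:
  "slotwise G \<Longrightarrow> lie_d (s p a, x) G us = sM [:poly p (- x):] (lie_d (a, x) G us)"
proof (induction us arbitrary: G)
  case (Cons w us)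
  have "G (brk (s p a, x) w # us) = sM [:poly p (- x):] (G (brk (a, x) w # us))"
    by (simp add: brk_scale_left slotwiseD[OF Cons.prems] brk_eta)
  then show ?case
    by (simp add: lie_d.simps(2) Cons.IH[OF slotwise_Cons[OF Cons.prems]] M.scale_right_diff_distrib)
qed (simp add: app_scale_poly_left)

lemma ce_d_slotwise:
  assumes "slotwise G"
  shows "slotwise (ce_d G)"
proof -
  have "ce_d G (us @ (a + b, x) # vs) = ce_d G (us @ (a, x) # vs) + ce_d G (us @ (b, x) # vs) \<and>
      ce_d G (us @ (s p a, x) # vs) = sM [:poly p (- x):] (ce_d G (us @ (a, x) # vs))"
    for us vs a b x p
    using assms
  proof (induction us arbitrary: G)
    case Nil
    show ?case
      by (simp add: ce_d.simps(2) lie_d_add_left[OF Nil] lie_d_scale_left[OF Nil] slotwiseD[OF Nil]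
          ce_d_add ce_d_scale M.scale_right_diff_distrib)
  next
    case (Cons w us)
    note Cons.IH[OF slotwise_Cons[OF Cons.prems]]
    with slotwiseD(1,2)[OF lie_d_slotwise[OF Cons.prems], of w us] show ?case
      by (simp add: ce_d.simps(2) M.scale_right_diff_distrib)
  qed
  then show ?thesis unfolding slotwise_def by blast
qed

text \<open>
  In the first two arguments, \<open>ce_d G (v # w # us)\<close> is \<open>\<theta>\<^sub>v \<iota>\<^sub>w G - \<theta>\<^sub>w \<iota>\<^sub>v G\<close>, minus \<open>G\<close> at
  \<open>[v, w]\<close>, plus \<open>d\<close> of the double contraction; each of the three parts changes sign when
  \<open>v\<close> and \<open>w\<close> are exchanged. For later arguments the recursion applies.
\<close>

lemma ce_d_alternating:
  assumes "slotwise G" "alternating G"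
  shows "alternating (ce_d G)"
proof -
  have "ce_d G (us @ v # w # vs) = - ce_d G (us @ w # v # vs)" for us v w vs
    using assms
  proof (induction us arbitrary: G)
    case Nil
    have "(\<lambda>ws. G (v # w # ws)) = (\<lambda>ws. - G (w # v # ws))"
      using alternatingD(2)[OF Nil(2), of v w] by auto
    then have "ce_d (\<lambda>ws. G (v # w # ws)) vs = - ce_d (\<lambda>ws. G (w # v # ws)) vs"
      by (simp add: ce_d_uminus)
    then show ?case
      using brk_skew[OF Nil(1), of "[]" v w vs]
      by (simp add: ce_d.simps(2) lie_d.simps(2))
  next
    case (Cons u us)
    have "lie_d u G (us @ v # w # vs) = - lie_d u G (us @ w # v # vs)"
      using Cons.prems
    proof (induction us arbitrary: G)
      case Nil
      have "(\<lambda>ws. G (v # w # ws)) = (\<lambda>ws. - G (w # v # ws))"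
        using alternatingD(2)[OF Nil(2), of v w] by auto
      then have "lie_d u (\<lambda>ws. G (v # w # ws)) vs = - lie_d u (\<lambda>ws. G (w # v # ws)) vs"
        by (simp add: lie_d_uminus)
      then show ?case
        using alternatingD(2)[OF Nil(2), of v] alternatingD(2)[OF Nil(2), of "brk u v" w]
        by (simp add: lie_d.simps(2))
    next
      case (Cons t us)
      then show ?case
        using Cons.IH[OF slotwise_Cons[OF Cons.prems(1)] alternating_Cons[OF Cons.prems(2)]]
          alternatingD(1)[OF Cons.prems(2), of "brk u t # us" v w vs]
        by (simp add: lie_d.simps(2))
    qed
    then show ?case
      using Cons.IH[OF slotwise_Cons[OF Cons.prems(1)] alternating_Cons[OF Cons.prems(2)]]
      by (simp add: ce_d.simps(2))
  qed
  then show ?thesis unfolding alternating_def by blast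
qed

text \<open>
  The commutator of both sides with \<open>\<iota>\<^sub>w\<close> reduces the claim to the Jacobi identity and to lists
  that are shorter by one.
\<close>

lemma lie_d_commutator:
  "slotwise G \<Longrightarrow> lie_d u (lie_d v G) us - lie_d v (lie_d u G) us = lie_d (brk u v) G us"
proof (induction us arbitrary: G)
  case Nil
  then show ?case by (simp add: app_jacobi)
next
  case (Cons w us)
  have "fst (brk u (brk v w)) = fst (brk (brk u v) w) + fst (brk v (brk u w))"
    using br_jacobi'[of u v "fst w"] by (simp add: lbr_def algebra_simps)
  then have "brk u (brk v w) = (fst (brk (brk u v) w) + fst (brk v (brk u w)), snd u + snd v + snd w)"
    by (simp add: prod_eq_iff)
  then have "G (brk u (brk v w) # us) = G ((fst (brk (brk u v) w), snd u + snd v + snd w) # us) +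
      G ((fst (brk v (brk u w)), snd u + snd v + snd w) # us)"
    by (simp add: slotwiseD[OF Cons.prems])
  moreover have "(fst (brk (brk u v) w), snd u + snd v + snd w) = brk (brk u v) w"
    "(fst (brk v (brk u w)), snd u + snd v + snd w) = brk v (brk u w)"
    by (simp_all add: prod_eq_iff)
  ultimately have *: "G (brk u (brk v w) # us) = G (brk (brk u v) w # us) + G (brk v (brk u w) # us)"
    by simp
  have "lie_d u (lie_d v G) (w # us) = lie_d u (lie_d v (\<lambda>ws. G (w # ws))) us
      - lie_d u (\<lambda>ws. G (brk v w # ws)) us - lie_d v (\<lambda>ws. G (brk u w # ws)) us + G (brk v (brk u w) # us)"
    for u v
    by (simp add: lie_d.simps(2) lie_d_diff)
  then show ?case
    using Cons.IH[OF slotwise_Cons[OF Cons.prems], of w] *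
    by (simp add: lie_d.simps(2) algebra_simps)
qed

lemma lie_d_ce_d:
  "slotwise G \<Longrightarrow> lie_d u (ce_d G) us = ce_d (lie_d u G) us"
proof (induction us arbitrary: G)
  case (Cons v us)
  have "lie_d u (ce_d G) (v # us) = lie_d u (lie_d v G) us - lie_d u (ce_d (\<lambda>ws. G (v # ws))) us
      - lie_d (brk u v) G us + ce_d (\<lambda>ws. G (brk u v # ws)) us"
    by (simp add: lie_d.simps(2) ce_d.simps(2) lie_d_diff)
  also have "\<dots> = lie_d v (lie_d u G) us - ce_d (lie_d u (\<lambda>ws. G (v # ws))) us + ce_d (\<lambda>ws. G (brk u v # ws)) us"
    using lie_d_commutator[OF Cons.prems, of u v us] Cons.IH[OF slotwise_Cons[OF Cons.prems], of v]
    by (simp add: algebra_simps)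
  also have "\<dots> = ce_d (lie_d u G) (v # us)"
    by (simp add: lie_d.simps(2) ce_d.simps(2) ce_d_diff)
  finally show ?case .
qed simp

text \<open>
  \<open>\<iota>\<^sub>u d d = \<theta>\<^sub>u d - d \<iota>\<^sub>u d = \<theta>\<^sub>u d - d \<theta>\<^sub>u + d d \<iota>\<^sub>u\<close>, and \<open>\<theta>\<^sub>u\<close> commutes with \<open>d\<close>.
\<close>

theorem ce_d_ce_d: "slotwise G \<Longrightarrow> ce_d (ce_d G) us = 0"
proof (induction us arbitrary: G)
  case (Cons u us)
  then show ?case
    by (simp add: ce_d.simps(2) lie_d_ce_d ce_d_diff slotwise_Cons)
qed simp

end

section \<open>Cochains as functions on evaluated arguments\<close>

text \<open>
  The default value 0 beyond the list makes \<open>pt_Cons\<close> hold without side conditions.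
\<close>

definition pt :: "('a \<times> 'f::zero) list \<Rightarrow> nat \<Rightarrow> 'f" where
  "pt us i = (if i < length us then snd (us ! i) else 0)"

lemma pt_Cons: "pt (u # us) = case_nat (snd u) (pt us)"
  by (auto simp: pt_def fun_eq_iff split: nat.splits)

lemma pt_cong: "map snd us = map snd vs \<Longrightarrow> pt us = pt vs"
  by (rule ext) (metis length_map nth_map pt_def)

lemma nths_compl_singleton: "nths xs (- {l}) = take l xs @ drop (Suc l) xs"
proof (induction xs arbitrary: l)
  case (Cons x xs)
  show ?case
  proof (cases l)
    case 0
    then have "{j. Suc j \<in> - {l}} = UNIV" by auto
    then show ?thesis using 0 by (simp add: nths_Cons nths_all)
  next
    case (Suc m)
    then have "{j. Suc j \<in> - {l}} = - {m}" by auto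
    then show ?thesis using Suc Cons by (simp add: nths_Cons)
  qed
qed simp

lemma permute_list_swap:
  "permute_list (Transposition.transpose (length A) (length A + Suc (length B))) (A @ u # B @ v # C)
    = A @ v # B @ u # C"
proof (rule nth_equalityI)
  let ?i = "length A" and ?j = "length A + Suc (length B)"
  fix k assume "k < length (permute_list (Transposition.transpose ?i ?j) (A @ u # B @ v # C))"
  then have k: "k < length (A @ u # B @ v # C)" by simp
  have nth_j: "(A @ x # B @ y # D) ! ?j = y" for x y D
    by (simp add: nth_append)
  have nth_other: "(A @ x # B @ y # D) ! k = (A @ x' # B @ y' # D) ! k" if "k \<noteq> ?i" "k \<noteq> ?j" for x y x' y' D
    using that by (auto simp: nth_append nth_Cons split: nat.splits)
  show "permute_list (Transposition.transpose ?i ?j) (A @ u # B @ v # C) ! k = (A @ v # B @ u # C) ! k"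
    using k nth_other[of u v C v u]
    by (cases "k = ?i"; cases "k = ?j") (auto simp: permute_list_def nth_j simp del: add_Suc_right)
qed simp

lemma zip_map_points: "length us = q \<Longrightarrow> zip (map fst us) (map (pt us) [0..<q]) = us"
  by (rule nth_equalityI) (auto simp: pt_def)

context conformal_module_char0
begin

abbreviation "CC q \<equiv> cochains s sM q"
abbreviation "df \<equiv> differential s br sM act"

definition hat :: "('a list \<Rightarrow> 'm mpol) \<Rightarrow> ('a \<times> 'f) list \<Rightarrow> 'm" where
  "hat f us = eval sM (pt us) (f (map fst us))"

lemma alternating_move:
  assumes "alternating G"
  shows "G (A @ B @ v # C) = sM ((-1) ^ length B) (G (A @ v # B @ C))"
proof (induction B arbitrary: A)
  case (Cons b B)
  show ?case
    using Cons.IH[of "A @ [b]"] alternatingD(1)[OF assms, of A b v "B @ C"] by simp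
qed simp

lemma alternating_swap:
  assumes "alternating G"
  shows "G (A @ u # B @ v # C) = - G (A @ v # B @ u # C)"
proof -
  have "G (A @ u # B @ v # C) = sM ((-1) ^ length B) (G (A @ u # v # B @ C))"
    using alternating_move[OF assms, of "A @ [u]" B v C] by simp
  also have "\<dots> = - sM ((-1) ^ length B) (G (A @ v # u # B @ C))"
    by (subst alternatingD(1)[OF assms]) simp
  also have "sM ((-1) ^ length B) (G (A @ v # u # B @ C)) = G (A @ v # B @ u # C)"
    using alternating_move[OF assms, of "A @ [v]" B u C] by simp
  finally show ?thesis .
qed

lemma alternating_permute:
  assumes "alternating G" "\<pi> permutes {..<length us}"
  shows "G (permute_list \<pi> us) = sM (of_int (sign \<pi>)) (G us)"
proof -
  have "\<forall>us. length us = q \<longrightarrow> G (permute_list \<pi> us) = sM (of_int (sign \<pi>)) (G us)"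
    if "\<pi> permutes {..<q}" for q
    using that finite_lessThan
  proof (induction rule: permutes_induct)
    case id
    then show ?case by simp
  next
    case (swap a b p)
    let ?t = "Transposition.transpose a b"
    show ?case
    proof (intro allI impI)
      fix us :: "('a \<times> 'f) list" assume len: "length us = q"
      have swap: "G (permute_list (Transposition.transpose i j) us) = - G us"
        if "i < j" "j < q" for i j
      proof -
        define A B C where "A = take i us" "B = take (j - Suc i) (drop (Suc i) us)" "C = drop (Suc j) us"
        have "drop (Suc i) us = B @ us ! j # C"
          using that len id_take_nth_drop[of "j - Suc i" "drop (Suc i) us"]
          unfolding A_B_C_def by (simp add: Suc_diff_Suc)
        then have us: "us = A @ us ! i # B @ us ! j # C"
          using that len id_take_nth_drop[of i us] unfolding A_B_C_def by simp
        have lens: "length A = i" "length B = j - Suc i"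
          using that len by (auto simp: A_B_C_def)
        have "permute_list (Transposition.transpose i j) us = A @ us ! j # B @ us ! i # C"
          using permute_list_swap[of A B "us ! i" "us ! j" C] us lens that by simp
        then show ?thesis
          using alternating_swap[OF assms(1), of A "us ! j" B "us ! i" C] us by simp
      qed
      have t: "G (permute_list ?t us) = - G us"
        using swap[of a b] swap[of b a] swap.hyps by (cases "a < b") (auto simp: transpose_commute)
      have "G (permute_list (?t \<circ> p) us) = G (permute_list p (permute_list ?t us))"
        using swap.hyps len by (simp add: permute_list_compose)
      also have "\<dots> = sM (of_int (sign p)) (G (permute_list ?t us))"
        using swap.IH len by simp
      also have "\<dots> = sM (of_int (sign (?t \<circ> p))) (G us)"
        using swap.hyps permutes_imp_permutation[OF finite_lessThan swap.hyps(4)]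
        by (simp add: t sign_compose permutation_swap_id sign_swap_id)
      finally show "G (permute_list (?t \<circ> p) us) = sM (of_int (sign (?t \<circ> p))) (G us)" .
    qed
  qed
  with assms(2) show ?thesis by blast
qed

text \<open>
  The condition that only \<open>\<lambda>\<^sub>0, \<dots>, \<lambda>\<^bsub>q-1\<^esub>\<close> occur, in terms of values.
\<close>

definition local_on :: "nat \<Rightarrow> ('a list \<Rightarrow> 'm mpol) \<Rightarrow> bool" where
  "local_on q f \<longleftrightarrow> (\<forall>as x y. length as = q \<longrightarrow> (\<forall>i<q. x i = y i) \<longrightarrow> eval sM x (f as) = eval sM y (f as))"

lemma eval_eq_hat:
  assumes "local_on q f" "length as = q"
  shows "eval sM x (f as) = hat f (zip as (map x [0..<q]))"
proof -
  have "eval sM x (f as) = eval sM (pt (zip as (map x [0..<q]))) (f as)"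
    using assms unfolding local_on_def by (auto simp: pt_def)
  then show ?thesis using assms by (simp add: hat_def)
qed

lemma cochain_local_on: "f \<in> CC q \<Longrightarrow> local_on q f"
  unfolding local_on_def cochains_def
  by (auto intro!: PM.eval_local)

lemma cochain_slotwise:
  assumes "f \<in> CC q"
  shows "slotwise (hat f)"
proof -
  have upd: "hat f (us @ (a, x) # vs) =
      eval sM (pt (us @ (0, x) # vs)) (f ((map fst us @ 0 # map fst vs)[length us := a]))" for us vs a x
    by (auto simp: hat_def list_update_append intro!: arg_cong2[where f = "eval sM"] pt_cong)
  have q: "length us + length vs + 1 = q \<Longrightarrow>
      length ((map fst us @ 0 # map fst vs)[length us := a]) = q \<and> length us < q \<and>
      (map fst us @ 0 # map fst vs)[length us := a] ! length us = a" for us vs :: "('a \<times> 'f) list" and a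
    by (auto simp: nth_append list_update_append)
  have zero: "hat f (us @ (a, x) # vs) = 0" if "length us + length vs + 1 \<noteq> q" for us vs a x
    using assms that by (simp add: hat_def cochains_def)
  have add: "hat f (us @ (a + b, x) # vs) = hat f (us @ (a, x) # vs) + hat f (us @ (b, x) # vs)" for us vs a b x
    using assms q[of us vs 0] zero[of us vs] unfolding upd cochains_def
    by (cases "length us + length vs + 1 = q") (auto simp: PM.eval_add)
  have const: "hat f (us @ (s [:k:] a, x) # vs) = sM [:k:] (hat f (us @ (a, x) # vs))" for us vs a k x
  proof (cases "length us + length vs + 1 = q")
    case True
    let ?as = "(map fst us @ 0 # map fst vs)[length us := a]"
    have "f (?as[length us := s [:k:] (?as ! length us)]) = pact sM (const [:k:]) (f ?as)"
      using assms q[OF True, of a] unfolding cochains_def by blast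
    then show ?thesis unfolding upd using q[OF True, of a] by (simp add: PM.eval_pact)
  qed (simp add: zero)
  have del: "hat f (us @ (s [:0, 1:] a, x) # vs) = sM [:- x:] (hat f (us @ (a, x) # vs))" for us vs a x
  proof (cases "length us + length vs + 1 = q")
    case True
    let ?as = "(map fst us @ 0 # map fst vs)[length us := a]"
    have "f (?as[length us := s [:0, 1:] (?as ! length us)]) = pact sM (- var (length us)) (f ?as)"
      using assms q[OF True, of a] unfolding cochains_def by blast
    moreover have "pt (us @ (0, x) # vs) (length us) = x" by (simp add: pt_def)
    ultimately show ?thesis unfolding upd using q[OF True, of a] by (simp add: PM.eval_pact rval_simps)
  qed (simp add: zero)
  have "hat f (us @ (s p a, x) # vs) = sM [:poly p (- x):] (hat f (us @ (a, x) # vs))" for us vs a p x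
  proof (induction p)
    case 0
    show ?case using add[of us 0 0 x vs] by simp
  next
    case (pCons c p)
    have "s (pCons c p) a = s [:c:] a + s [:0, 1:] (s p a)"
      by (simp flip: A.scale_left_distrib)
    then show ?case
      by (simp only: add const del pCons.IH) (simp add: mult.commute flip: M.scale_left_distrib)
  qed
  with add show ?thesis unfolding slotwise_def by blast
qed

lemma eval_permuted:
  assumes "local_on q f" "length as = q" "\<pi> permutes {..<q}"
  shows "eval sM x (subst sM (\<lambda>i. var (\<pi> i)) (f (map (\<lambda>i. as ! \<pi> i) [0..<q])))
    = hat f (permute_list \<pi> (zip as (map x [0..<q])))"
proof -
  have "permute_list \<pi> (zip as (map x [0..<q])) = zip (map (\<lambda>i. as ! \<pi> i) [0..<q]) (map (\<lambda>i. x (\<pi> i)) [0..<q])"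
    using assms permutes_in_image[OF assms(3)]
    by (intro nth_equalityI) (auto simp: permute_list_def)
  moreover have "eval sM x (subst sM (\<lambda>i. var (\<pi> i)) u) = eval sM (\<lambda>i. x (\<pi> i)) u" for u
    by (rule PM.eval_subst) simp
  ultimately show ?thesis
    using eval_eq_hat[OF assms(1), of "map (\<lambda>i. as ! \<pi> i) [0..<q]"] by simp
qed

lemma cochain_alternating:
  assumes "f \<in> CC q"
  shows "alternating (hat f)"
proof -
  have "hat f (us @ v # w # vs) = - hat f (us @ w # v # vs)" for us v w vs
  proof (cases "length us + length vs + 2 = q")
    case True
    let ?ws = "us @ v # w # vs" and ?i = "length us"
    let ?\<pi> = "Transposition.transpose ?i (Suc ?i)"
    have perm: "?\<pi> permutes {..<q}"
      using True by (intro permutes_swap_id) auto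
    have "length (map fst ?ws) = q" using True by simp
    with assms perm have "subst sM (\<lambda>i. var (?\<pi> i)) (f (map (\<lambda>i. map fst ?ws ! ?\<pi> i) [0..<q]))
        = pact sM (of_int (sign ?\<pi>)) (f (map fst ?ws))"
      unfolding cochains_def by blast
    from arg_cong[OF this, of "eval sM (pt ?ws)"]
    have "hat f (permute_list ?\<pi> (zip (map fst ?ws) (map (pt ?ws) [0..<q])))
        = sM (of_int (sign ?\<pi>)) (eval sM (pt ?ws) (f (map fst ?ws)))"
      by (simp only: eval_permuted[OF cochain_local_on[OF assms] \<open>length (map fst ?ws) = q\<close> perm]
          PM.eval_pact rval_of_int)
    moreover have "zip (map fst ?ws) (map (pt ?ws) [0..<q]) = ?ws"
      by (rule zip_map_points) (use True in simp)
    moreover have "sign ?\<pi> = -1" by (simp add: sign_swap_id)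
    ultimately have "hat f (permute_list ?\<pi> ?ws) = - hat f ?ws"
      unfolding hat_def[of f ?ws] by simp
    moreover have "permute_list ?\<pi> ?ws = us @ w # v # vs"
      using permute_list_swap[of us "[]" v w vs] by simp
    ultimately show ?thesis by simp
  next
    case False
    then show ?thesis using assms by (auto simp: hat_def cochains_def)
  qed
  then show ?thesis unfolding alternating_def by blast
qed

text \<open>
  Every defining condition of a cochain is an equation between polynomials, or is
  \<open>local_on\<close> by \<open>keys_subset_if_eval_local\<close>; so all of them can be checked on values.
\<close>

lemma cochainsI:
  assumes zero: "\<And>as. length as \<noteq> q \<Longrightarrow> f as = 0"
    and loc: "local_on q f" and slot: "slotwise (hat f)" and alt: "alternating (hat f)"
  shows "f \<in> CC q"
proof -
  have slots: "hat f (zip (as[i := a]) (map x [0..<q])) = hat f (zip (take i as) (map x [0..<i]) @ (a, x i) # zip (drop (Suc i) as) (map x [Suc i..<q]))"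
    if "length as = q" "i < q" for as i a x
  proof -
    have "[0..<q] = [0..<i] @ i # [Suc i..<q]"
      using that by (metis le0 less_imp_add_positive upt_add_eq_append upt_conv_Cons add.commute)
    then show ?thesis using that by (simp add: upd_conv_take_nth_drop)
  qed
  have keys: "\<forall>\<alpha>\<in>keys (f as). keys \<alpha> \<subseteq> {..<q}" if "length as = q" for as
    using PM.keys_subset_if_eval_local[of q "f as"] loc that unfolding local_on_def by blast
  have add: "f (as[i := a + b]) = f (as[i := a]) + f (as[i := b])" if "length as = q" "i < q" for as i a b
    by (rule PM.eval_inject)
      (use that slotwiseD(1)[OF slot] in \<open>simp add: PM.eval_add eval_eq_hat[OF loc] slots\<close>)
  have const: "f (as[i := s [:k:] (as ! i)]) = pact sM (const [:k:]) (f as)" if "length as = q" "i < q" for as i k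
  proof (rule PM.eval_inject)
    fix x
    show "eval sM x (f (as[i := s [:k:] (as ! i)])) = eval sM x (pact sM (const [:k:]) (f as))"
      using that slots[OF that, of "as ! i"] slotwiseD(2)[OF slot, where p = "[:k:]"]
      by (simp add: PM.eval_pact eval_eq_hat[OF loc] slots)
  qed
  have del: "f (as[i := s [:0, 1:] (as ! i)]) = pact sM (- var i) (f as)" if "length as = q" "i < q" for as i
  proof (rule PM.eval_inject)
    fix x
    show "eval sM x (f (as[i := s [:0, 1:] (as ! i)])) = eval sM x (pact sM (- var i) (f as))"
      using that slots[OF that, of "as ! i"] slotwiseD(2)[OF slot, where p = "[:0, 1:]"]
      by (simp add: PM.eval_pact eval_eq_hat[OF loc] slots rval_simps)
  qed
  have perm: "subst sM (\<lambda>i. var (\<pi> i)) (f (map (\<lambda>i. as ! \<pi> i) [0..<q])) = pact sM (of_int (sign \<pi>)) (f as)"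
    if "length as = q" "\<pi> permutes {..<q}" for as \<pi>
    by (rule PM.eval_inject)
      (use that alternating_permute[OF alt] in
        \<open>simp add: eval_permuted[OF loc] PM.eval_pact eval_eq_hat[OF loc]\<close>)
  show ?thesis
    unfolding cochains_def using zero keys add const del perm by blast
qed

lemma cochain_eqI:
  assumes "f \<in> CC q" "g \<in> CC q" "\<And>us. length us = q \<Longrightarrow> hat f us = hat g us"
  shows "f = g"
proof
  fix as
  show "f as = g as"
  proof (cases "length as = q")
    case True
    show ?thesis
      by (rule PM.eval_inject)
        (use True assms in \<open>simp add: eval_eq_hat[OF cochain_local_on]\<close>)
  next
    case False
    then show ?thesis using assms by (simp add: cochains_def)
  qed
qed

lemma cochain_zero: "f \<in> CC q \<Longrightarrow> length as \<noteq> q \<Longrightarrow> f as = 0"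
  by (simp add: cochains_def)

lemma cochain_keys:
  "f \<in> CC q \<Longrightarrow> length as = q \<Longrightarrow> \<alpha> \<in> keys (f as) \<Longrightarrow> i \<in> keys \<alpha> \<Longrightarrow> i < q"
  unfolding cochains_def by blast

lemma hat_zero: "f \<in> CC q \<Longrightarrow> length us \<noteq> q \<Longrightarrow> hat f us = 0"
  by (simp add: hat_def cochains_def)

section \<open>The differential\<close>

lemma lie_d_sum:
  "lie_d u G us = app u (G us) - (\<Sum>i<length us. G (us[i := brk u (us ! i)]))"
proof (induction us arbitrary: G)
  case (Cons v us)
  show ?case
    unfolding lie_d.simps(2) Cons.IH by (simp add: sum.lessThan_Suc_shift del: sum.lessThan_Suc)
qed simp

text \<open>
  The usual formula with indices that start at 0, which turns the sign \<open>(-1)\<^bsup>k+1\<^esup>\<close> of the first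
  sum into \<open>(-1)\<^sup>k\<close> and leaves \<open>(-1)\<^bsup>k+l\<^esup>\<close> as it is.
\<close>

definition ce_sum :: "(('a \<times> 'f) list \<Rightarrow> 'm) \<Rightarrow> ('a \<times> 'f) list \<Rightarrow> 'm" where
  "ce_sum G us =
     (\<Sum>k<length us. sM ((-1) ^ k) (app (us ! k) (G (nths us (- {k})))))
   + (\<Sum>(k, l)\<in>{(k, l). k < l \<and> l < length us}.
        sM ((-1) ^ (k + l)) (G (brk (us ! k) (us ! l) # nths us (- {k, l}))))"

lemma nths_Cons_compl:
  "nths (x # xs) (- {0}) = xs" "nths (x # xs) (- {Suc k}) = x # nths xs (- {k})"
  "nths (x # xs) (- {0, Suc l}) = nths xs (- {l})"
  "nths (x # xs) (- {Suc k, Suc l}) = x # nths xs (- {k, l})"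
proof -
  have "{j. Suc j \<in> - {0}} = UNIV" "{j. Suc j \<in> - {Suc k}} = - {k}"
    "{j. Suc j \<in> - {0, Suc l}} = - {l}" "{j. Suc j \<in> - {Suc k, Suc l}} = - {k, l}"
    by auto
  then show "nths (x # xs) (- {0}) = xs" "nths (x # xs) (- {Suc k}) = x # nths xs (- {k})"
    "nths (x # xs) (- {0, Suc l}) = nths xs (- {l})"
    "nths (x # xs) (- {Suc k, Suc l}) = x # nths xs (- {k, l})"
    by (simp_all add: nths_Cons nths_all)
qed

lemma finite_pairs: "finite {(k, l). k < l \<and> l < (n::nat)}"
  by (rule finite_subset[of _ "{..<n} \<times> {..<n}"]) auto

lemma sum_pairs_Suc:
  fixes g :: "nat \<times> nat \<Rightarrow> 'm"
  shows "(\<Sum>p\<in>{(k, l). k < l \<and> l < Suc n}. g p) =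
    (\<Sum>l<n. g (0, Suc l)) + (\<Sum>(k, l)\<in>{(k, l). k < l \<and> l < n}. g (Suc k, Suc l))"
proof -
  let ?P = "{(k, l). k < l \<and> l < n}"
  have "{(k, l). k < l \<and> l < Suc n} = (\<lambda>l. (0, Suc l)) ` {..<n} \<union> map_prod Suc Suc ` ?P" (is "?L = ?R")
  proof
    show "?L \<subseteq> ?R"
    proof
      fix p assume "p \<in> ?L"
      then obtain k l where p: "p = (k, l)" "k < l" "l < Suc n" by auto
      then obtain l' where "l = Suc l'" by (cases l) auto
      with p show "p \<in> ?R" by (cases k) (auto simp: image_iff)
    qed
  qed auto
  also have "sum g \<dots> = sum g ((\<lambda>l. (0, Suc l)) ` {..<n}) + sum g (map_prod Suc Suc ` ?P)"
    by (rule sum.union_disjoint) (auto simp: finite_pairs)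
  also have "sum g ((\<lambda>l. (0, Suc l)) ` {..<n}) = (\<Sum>l<n. g (0, Suc l))"
    by (subst sum.reindex) (auto simp: inj_on_def)
  also have "sum g (map_prod Suc Suc ` ?P) = (\<Sum>(k, l)\<in>?P. g (Suc k, Suc l))"
    by (subst sum.reindex) (auto simp: inj_on_def intro!: sum.cong)
  finally show ?thesis .
qed

text \<open>
  Splitting off the terms with \<open>k = 0\<close> from both sums gives the recursion of \<open>ce_d\<close>: moving
  \<open>[u, u\<^sub>l]\<close> from the front to position \<open>l\<close> costs \<open>(-1)\<^sup>l\<close> and yields the sum in \<open>lie_d_sum\<close>, and
  moving it past \<open>u\<close> gives the sign of \<open>- d \<iota>\<^sub>u\<close>.
\<close>

lemma ce_sum_eq_ce_d:
  "alternating G \<Longrightarrow> ce_sum G us = ce_d G us"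
proof (induction us arbitrary: G)
  case Nil
  show ?case by (simp add: ce_sum_def)
next
  case (Cons u us)
  let ?P = "{(k, l). k < l \<and> l < length us}"
  have move: "sM ((-1) ^ Suc l) (G (w # nths us (- {l}))) = - G (us[l := w])" if "l < length us" for l w
  proof -
    have "G (us[l := w]) = sM ((-1) ^ l) (G (w # nths us (- {l})))"
      using alternating_move[OF Cons.prems, of "[]" "take l us" w "drop (Suc l) us"] that
      by (simp add: nths_compl_singleton upd_conv_take_nth_drop)
    then show ?thesis by simp
  qed
  have "ce_sum G (u # us) =
      app u (G us) + (\<Sum>k<length us. sM ((-1) ^ Suc k) (app (us ! k) (G (u # nths us (- {k})))))
    + ((\<Sum>l<length us. sM ((-1) ^ Suc l) (G (brk u (us ! l) # nths us (- {l}))))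
    + (\<Sum>(k, l)\<in>?P. sM ((-1) ^ (Suc k + Suc l)) (G (brk (us ! k) (us ! l) # u # nths us (- {k, l})))))"
    by (simp only: ce_sum_def length_Cons sum_pairs_Suc sum.lessThan_Suc_shift nth_Cons_0 nth_Cons_Suc
        nths_Cons_compl case_prod_conv add_0 power_0 M.scale_one)
  also have "(\<Sum>l<length us. sM ((-1) ^ Suc l) (G (brk u (us ! l) # nths us (- {l}))))
      = - (\<Sum>l<length us. G (us[l := brk u (us ! l)]))"
    unfolding sum_negf[symmetric] by (rule sum.cong) (simp_all only: move lessThan_iff)
  also have "(\<Sum>(k, l)\<in>?P. sM ((-1) ^ (Suc k + Suc l)) (G (brk (us ! k) (us ! l) # u # nths us (- {k, l}))))
      = - (\<Sum>(k, l)\<in>?P. sM ((-1) ^ (k + l)) (G (u # brk (us ! k) (us ! l) # nths us (- {k, l}))))"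
    unfolding sum_negf[symmetric]
    by (rule sum.cong) (auto simp: alternatingD(2)[OF Cons.prems, of _ u])
  also have "(\<Sum>k<length us. sM ((-1) ^ Suc k) (app (us ! k) (G (u # nths us (- {k})))))
      = - (\<Sum>k<length us. sM ((-1) ^ k) (app (us ! k) (G (u # nths us (- {k})))))"
    unfolding sum_negf[symmetric] by (rule sum.cong) auto
  finally have "ce_sum G (u # us) = lie_d u G us - ce_sum (\<lambda>ws. G (u # ws)) us"
    by (simp add: lie_d_sum ce_sum_def)
  then show ?case
    by (simp add: ce_d.simps(2) Cons.IH[OF alternating_Cons[OF Cons.prems]])
qed

lemma eval_cochain_at:
  assumes f: "f \<in> CC q" and len: "length ps = length as"
    and ps: "\<And>i. i < length as \<Longrightarrow> rval x (ps ! i) = [:y i:]"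
  shows "eval sM x (cochain_at sM f ps as) = hat f (zip as (map y [0..<length as]))"
proof (cases "length as = q")
  case True
  have "eval sM x (cochain_at sM f ps as) = eval sM y (f as)"
    unfolding cochain_at_def
    by (rule PM.eval_subst) (use cochain_keys[OF f True] True ps in blast)
  then show ?thesis using True by (simp add: eval_eq_hat[OF cochain_local_on[OF f]])
next
  case False
  then show ?thesis using f by (simp add: cochain_at_def cochain_zero hat_zero subst_def)
qed

text \<open>
  Evaluation turns each polynomial operation in the differential into its counterpart on arguments
  with parameters. In the second sum the bracket is itself a polynomial in \<open>\<lambda>\<^sub>k\<close>, and linearity in
  the first slot collects its coefficients into a single argument.
\<close>

lemma eval_differential:
  assumes f: "f \<in> CC q"
  shows "eval sM x (df f as) = ce_d (hat f) (zip as (map x [0..<length as]))"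
proof -
  let ?n = "length as"
  let ?us = "zip as (map x [0..<?n])"
  have nths_us: "nths ?us I = zip (nths as I) (map x (nths [0..<?n] I))" for I
  proof -
    have "?us = map (\<lambda>i. (as ! i, x i)) [0..<?n]"
      by (rule nth_equalityI) auto
    moreover have "nths as I = map (\<lambda>i. as ! i) (nths [0..<?n] I)"
      by (metis map_nth nths_map)
    ultimately show ?thesis by (simp add: nths_map zip_map_map flip: map_zip_map map_zip_map2)
        (simp add: zip_same_conv_map)
  qed
  have len: "length (nths as I) = length (nths [0..<?n] I)" for I
    by (metis length_map map_nth nths_map)
  have 1: "eval sM x (cochain_at sM f (nths (map var [0..<?n]) I) (nths as I)) = hat f (nths ?us I)" for I
  proof -
    let ?js = "nths [0..<?n] I"
    have "eval sM x (cochain_at sM f (map var ?js) (nths as I))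
      = hat f (zip (nths as I) (map (\<lambda>i. x (?js ! i)) [0..<length (nths as I)]))"
      by (rule eval_cochain_at[OF f]) (auto simp: len)
    moreover have "map (\<lambda>i. x (?js ! i)) [0..<length (nths as I)] = map x ?js"
      by (rule nth_equalityI) (auto simp: len)
    ultimately show ?thesis by (simp add: nths_us nths_map)
  qed
  have 2: "eval sM x (cochain_at_poly sM f ((var k + var l) # nths (map var [0..<?n]) I)
        (act_at s br (const (as ! k)) (var k) (const (as ! l))) (nths as I))
      = hat f (brk (?us ! k) (?us ! l) # nths ?us I)" if "k < ?n" "l < ?n" for k l I
  proof -
    let ?js = "nths [0..<?n] I"
    let ?w = "act_at s br (const (as ! k)) (var k) (const (as ! l))"
    have "eval sM x (cochain_at sM f ((var k + var l) # map var ?js) (a # nths as I))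
      = hat f ((a, x k + x l) # nths ?us I)" for a
    proof -
      let ?y = "case_nat (x k + x l) (\<lambda>i. x (?js ! i))"
      have "eval sM x (cochain_at sM f ((var k + var l) # map var ?js) (a # nths as I))
        = hat f (zip (a # nths as I) (map ?y [0..<length (a # nths as I)]))"
        by (rule eval_cochain_at[OF f]) (auto simp: len rval_simps nth_Cons split: nat.splits)
      moreover have "map ?y [0..<length (a # nths as I)] = (x k + x l) # map x ?js"
        by (rule nth_equalityI) (auto simp: len nth_Cons split: nat.splits simp del: upt_Suc)
      ultimately show ?thesis by (simp add: nths_us)
    qed
    then have "eval sM x (cochain_at_poly sM f ((var k + var l) # nths (map var [0..<?n]) I) ?w (nths as I))
      = (\<Sum>\<alpha>\<in>keys ?w. sM [:mval x \<alpha>:]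
          (hat f ((lookup ?w \<alpha>, x k + x l) # nths ?us I)))"
      by (simp add: cochain_at_poly_def PM.eval_sum PM.eval_pact nths_map)
    also have "\<dots> = hat f ((eval s x ?w, x k + x l) # nths ?us I)"
    proof -
      have sum: "hat f ((sum g A, y) # vs) = (\<Sum>i\<in>A. hat f ((g i, y) # vs))"
        for g and A :: "(nat \<Rightarrow>\<^sub>0 nat) set" and y vs
        by (induction A rule: infinite_finite_induct)
          (auto simp: slotwise_0[OF cochain_slotwise[OF f], of "[]", simplified]
            slotwiseD[OF cochain_slotwise[OF f]])
      show ?thesis
        unfolding eval_def[of s] sum by (simp add: slotwiseD[OF cochain_slotwise[OF f]])
    qed
    also have "eval s x ?w = lact s br (as ! k, x k) (as ! l)"
      using conformal_module_char0.eval_act_at[OF adjoint_char0, of x "var k" "x k"] by simp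
    finally show ?thesis using that by (simp add: lbr_def)
  qed
  have neg: "rval x ((-1) ^ k) = (-1) ^ k" for k
    by (simp add: rval_simps)
  have 3: "eval sM x (act_at sM act (const (as ! k)) (var k) u) = app (?us ! k) (eval sM x u)"
    if "k < ?n" for k u
    using that eval_act_at[of x "var k" "x k"] by simp
  have "eval sM x (df f as) = ce_sum (hat f) ?us"
    unfolding differential_def ce_sum_def Let_def PM.eval_add PM.eval_sum
    by (intro arg_cong2[where f = "(+)"] sum.cong)
      (auto simp: PM.eval_pact neg 1 2 3 PM.eval_sum)
  then show ?thesis
    by (simp add: ce_sum_eq_ce_d cochain_alternating[OF f])
qed

lemma hat_differential:
  assumes "f \<in> CC q"
  shows "hat (df f) us = ce_d (hat f) us"
  using eval_differential[OF assms, of "pt us" "map fst us"]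
  by (simp add: hat_def zip_map_points)

lemma ce_d_eq_0:
  assumes "\<And>us. length us \<noteq> q \<Longrightarrow> G us = 0" "length us \<noteq> Suc q"
  shows "ce_d G us = 0"
proof -
  have th: "lie_d u G us = 0" if "\<And>us. length us \<noteq> q \<Longrightarrow> G us = 0" "length us \<noteq> q" for u us q G
    unfolding lie_d_sum using that by simp
  show ?thesis
    using assms
  proof (induction us arbitrary: q G)
    case (Cons u us)
    have "ce_d (\<lambda>ws. G (u # ws)) us = 0"
    proof (cases q)
      case 0
      then have "G (u # ws) = 0" for ws using Cons.prems by simp
      then show ?thesis using ce_d_diff[of "\<lambda>_. 0" "\<lambda>_. 0" us] by simp
    next
      case (Suc q')
      show ?thesis by (rule Cons.IH[of q']) (use Suc Cons.prems in auto)
    qed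
    then show ?case using th[of q G us u] Cons.prems by (simp add: ce_d.simps(2))
  qed simp
qed

theorem differential_cochain:
  assumes f: "f \<in> CC q"
  shows "df f \<in> CC (Suc q)"
proof (rule cochainsI)
  fix as :: "'a list" assume "length as \<noteq> Suc q"
  then show "df f as = 0"
    by (intro PM.eval_eq_0) (simp add: eval_differential[OF f] ce_d_eq_0[of q] hat_zero[OF f])
next
  show "local_on (Suc q) (df f)"
    unfolding local_on_def
    by (auto simp: eval_differential[OF f] intro!: arg_cong[where f = "ce_d (hat f)"] arg_cong[where f = "zip _"])
next
  have "hat (df f) = ce_d (hat f)" by (rule ext) (rule hat_differential[OF f])
  then show "slotwise (hat (df f))" "alternating (hat (df f))"
    using ce_d_slotwise ce_d_alternating cochain_slotwise[OF f] cochain_alternating[OF f] by auto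
qed

theorem differential_differential:
  assumes f: "f \<in> CC q"
  shows "df (df f) = (\<lambda>as. 0)"
proof
  fix as
  have "hat (df f) = ce_d (hat f)" by (rule ext) (rule hat_differential[OF f])
  then show "df (df f) as = 0"
    by (intro PM.eval_eq_0)
      (simp add: eval_differential[OF differential_cochain[OF f]] ce_d_ce_d cochain_slotwise[OF f])
qed

section \<open>The vector space of cochains\<close>

lemma pact_add_right: "pact sM p (u + v) = pact sM p u + pact sM p v"
  by (rule PM.eval_inject) (simp add: PM.eval_pact PM.eval_add M.scale_right_distrib)

definition csmult :: "'f \<Rightarrow> ('a list \<Rightarrow> 'm mpol) \<Rightarrow> 'a list \<Rightarrow> 'm mpol" where
  "csmult k f as = pact sM (const [:k:]) (f as)"

lemma csmult_vector_space: "vector_space csmult"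
  by unfold_locales
    (auto simp: csmult_def fun_eq_iff PM.eval_pact PM.eval_add M.scale_right_distrib mult.commute
      intro!: PM.eval_inject simp flip: M.scale_left_distrib one_pCons)

lemma hat_add: "hat (f + g) us = hat f us + hat g us"
  by (simp add: hat_def PM.eval_add)

lemma hat_csmult: "hat (csmult k f) us = sM [:k:] (hat f us)"
  by (simp add: hat_def csmult_def PM.eval_pact)

lemma hat_0: "hat 0 us = 0"
  by (simp add: hat_def)

lemma zero_cochain: "0 \<in> CC q"
  by (rule cochainsI) (auto simp: local_on_def slotwise_def alternating_def hat_0)

lemma add_cochain:
  assumes "f \<in> CC q" "g \<in> CC q"
  shows "f + g \<in> CC q"
proof (rule cochainsI)
  show "local_on q (f + g)"
    using cochain_local_on[OF assms(1)] cochain_local_on[OF assms(2)]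
    unfolding local_on_def by (simp add: PM.eval_add) metis
  show "slotwise (hat (f + g))"
    using slotwiseD(1,2)[OF cochain_slotwise[OF assms(1)]] slotwiseD(1,2)[OF cochain_slotwise[OF assms(2)]]
    unfolding slotwise_def by (simp add: hat_add M.scale_right_distrib)
  have "hat (f + g) (us @ v # w # vs) = - hat (f + g) (us @ w # v # vs)" for us v w vs
    using alternatingD(1)[OF cochain_alternating[OF assms(1)], of us v w vs]
      alternatingD(1)[OF cochain_alternating[OF assms(2)], of us v w vs]
    by (simp add: hat_add)
  then show "alternating (hat (f + g))" unfolding alternating_def by blast
qed (use assms in \<open>simp add: cochain_zero\<close>)

lemma csmult_cochain:
  assumes "f \<in> CC q"
  shows "csmult k f \<in> CC q"
proof (rule cochainsI)
  show "local_on q (csmult k f)"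
    using cochain_local_on[OF assms]
    unfolding local_on_def csmult_def by (simp add: PM.eval_pact) metis
  show "slotwise (hat (csmult k f))"
    using slotwiseD(1,2)[OF cochain_slotwise[OF assms]]
    unfolding slotwise_def by (simp add: hat_csmult M.scale_right_distrib mult.commute)
  have "hat (csmult k f) (us @ v # w # vs) = - hat (csmult k f) (us @ w # v # vs)" for us v w vs
    using alternatingD(1)[OF cochain_alternating[OF assms], of us v w vs]
    by (simp add: hat_csmult)
  then show "alternating (hat (csmult k f))" unfolding alternating_def by blast
qed (use assms in \<open>simp add: cochain_zero csmult_def pact_def\<close>)

lemma differential_add:
  assumes "f \<in> CC q" "g \<in> CC q"
  shows "df (f + g) = df f + df g"
proof (rule cochain_eqI)
  show "df (f + g) \<in> CC (Suc q)" "df f + df g \<in> CC (Suc q)"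
    using assms by (auto intro: differential_cochain add_cochain)
  have "hat (f + g) = (\<lambda>us. hat f us + hat g us)" by (rule ext) (rule hat_add)
  then show "hat (df (f + g)) us = hat (df f + df g) us" for us
    using assms by (simp add: hat_add hat_differential[OF add_cochain] hat_differential ce_d_add)
qed

lemma differential_csmult:
  assumes "f \<in> CC q"
  shows "df (csmult k f) = csmult k (df f)"
proof (rule cochain_eqI)
  show "df (csmult k f) \<in> CC (Suc q)" "csmult k (df f) \<in> CC (Suc q)"
    using assms by (auto intro: differential_cochain csmult_cochain)
  have "hat (csmult k f) = (\<lambda>us. sM [:k:] (hat f us))" by (rule ext) (rule hat_csmult)
  then show "hat (df (csmult k f)) us = hat (csmult k (df f)) us" for us
    using assms by (simp add: hat_csmult hat_differential[OF csmult_cochain] hat_differential ce_d_scale)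
qed

lemma eval_cochain_del:
  "eval sM x (cochain_del sM f as) = sM [:\<Sum>k<length as. x k, 1:] (eval sM x (f as))"
  by (simp add: cochain_del_def PM.eval_pact rval_simps const_poly_sum)

lemma hat_cochain_del: "hat (cochain_del sM f) us = sM [:sum_list (map snd us), 1:] (hat f us)"
proof -
  have "(\<Sum>k<length us. pt us k) = sum_list (map snd us)"
    by (simp add: sum_list_sum_nth atLeast0LessThan pt_def)
  then show ?thesis by (simp add: hat_def eval_cochain_del)
qed

lemma cochain_del_cochain:
  assumes "f \<in> CC q"
  shows "cochain_del sM f \<in> CC q"
proof (rule cochainsI)
  show "cochain_del sM f as = 0" if "length as \<noteq> q" for as
    using assms that by (simp add: cochain_del_def cochain_zero pact_def)
  show "local_on q (cochain_del sM f)"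
    unfolding local_on_def
  proof (intro allI impI)
    fix as :: "'a list" and x y :: "nat \<Rightarrow> 'f"
    assume *: "length as = q" "\<forall>i<q. x i = y i"
    then have "eval sM x (f as) = eval sM y (f as)" "(\<Sum>k<length as. x k) = (\<Sum>k<length as. y k)"
      using cochain_local_on[OF assms] by (auto simp: local_on_def)
    then show "eval sM x (cochain_del sM f as) = eval sM y (cochain_del sM f as)"
      by (simp add: eval_cochain_del)
  qed
  show "slotwise (hat (cochain_del sM f))"
    using slotwiseD(1,2)[OF cochain_slotwise[OF assms]]
    unfolding slotwise_def by (simp add: hat_cochain_del M.scale_right_distrib mult.commute)
  have "hat (cochain_del sM f) (us @ v # w # vs) = - hat (cochain_del sM f) (us @ w # v # vs)" for us v w vs
    using alternatingD(1)[OF cochain_alternating[OF assms], of us v w vs]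
    by (simp add: hat_cochain_del add.left_commute)
  then show "alternating (hat (cochain_del sM f))" unfolding alternating_def by blast
qed

lemma cochain_del_add: "cochain_del sM (f + g) = cochain_del sM f + cochain_del sM g"
  by (rule ext) (simp add: cochain_del_def pact_add_right)

lemma cochain_del_csmult: "cochain_del sM (csmult k f) = csmult k (cochain_del sM f)"
  by (rule ext, rule PM.eval_inject)
    (simp add: eval_cochain_del csmult_def PM.eval_pact mult.commute)

section \<open>Contraction and homotopy\<close>

text \<open>
  The coefficient of \<open>\<lambda>\<^sub>0 ^ n\<close> in \<open>f(e, \<dots>)\<close>. It vanishes on 0-cochains, which are extended by 0
  to nonempty lists.
\<close>

definition contraction :: "'a \<Rightarrow> nat \<Rightarrow> ('a list \<Rightarrow> 'm mpol) \<Rightarrow> 'a list \<Rightarrow> 'm mpol" where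
  "contraction e n f as = slice n (f (e # as))"

lemma tcoeff_contraction_eval:
  "PM.tcoeff n (\<lambda>t. eval sM (case_nat t x) (f (e # as))) (eval sM x (contraction e n f as))"
  unfolding contraction_def by (rule PM.tcoeff_slice)

lemma tcoeff_contraction: "PM.tcoeff n (\<lambda>t. hat f ((e, t) # us)) (hat (contraction e n f) us)"
  using tcoeff_contraction_eval[of n "pt us" f e "map fst us"]
  by (simp add: hat_def pt_Cons)

lemma contraction_cochain:
  assumes "f \<in> CC q"
  shows "contraction e n f \<in> CC (q - 1)"
proof (cases q)
  case 0
  then have "contraction e n f = 0"
    using assms by (simp add: fun_eq_iff contraction_def cochain_zero slice_def)
  then show ?thesis by (simp add: zero_cochain)
next
  case (Suc p)
  let ?g = "contraction e n f"
  have "?g \<in> CC p"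
  proof (rule cochainsI)
    show "?g as = 0" if "length as \<noteq> p" for as
      using assms that Suc by (simp add: contraction_def cochain_zero slice_def)
    show "local_on p ?g"
      unfolding local_on_def
    proof (intro allI impI)
      fix as :: "'a list" and x y :: "nat \<Rightarrow> 'f"
      assume *: "length as = p" "\<forall>i<p. x i = y i"
      have "eval sM (case_nat t x) (f (e # as)) = eval sM (case_nat t y) (f (e # as))" for t
        using cochain_local_on[OF assms] * Suc unfolding local_on_def
        by (auto split: nat.splits)
      then show "eval sM x (?g as) = eval sM y (?g as)"
        using tcoeff_contraction_eval[of n x f e as] tcoeff_contraction_eval[of n y f e as]
        by (simp add: PM.tcoeff_unique)
    qed
    show "slotwise (hat ?g)"
      unfolding slotwise_def
    proof (intro allI conjI)
      fix us vs x a b p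
      note D = slotwiseD(1,2)[OF cochain_slotwise[OF assms], of "(e, t) # us" for t, unfolded append_Cons]
      show "hat ?g (us @ (a + b, x) # vs) = hat ?g (us @ (a, x) # vs) + hat ?g (us @ (b, x) # vs)"
        by (rule PM.tcoeff_unique[OF tcoeff_contraction])
          (simp add: D PM.tcoeff_add tcoeff_contraction)
      show "hat ?g (us @ (s p a, x) # vs) = sM [:poly p (- x):] (hat ?g (us @ (a, x) # vs))"
        by (rule PM.tcoeff_unique[OF tcoeff_contraction])
          (simp add: D PM.tcoeff_scale tcoeff_contraction)
    qed
    have "hat ?g (us @ v # w # vs) = - hat ?g (us @ w # v # vs)" for us v w vs
    proof (rule PM.tcoeff_unique[OF tcoeff_contraction])
      have "hat f ((e, t) # us @ v # w # vs) = - hat f ((e, t) # us @ w # v # vs)" for t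
        using alternatingD(1)[OF cochain_alternating[OF assms], of "(e, t) # us" v w vs] by simp
      then show "PM.tcoeff n (\<lambda>t. hat f ((e, t) # us @ v # w # vs)) (- hat ?g (us @ w # v # vs))"
        by (simp add: PM.tcoeff_uminus tcoeff_contraction)
    qed
    then show "alternating (hat ?g)" unfolding alternating_def by blast
  qed
  then show ?thesis by (simp add: Suc)
qed

lemma contraction_zero_degree: "f \<in> CC 0 \<Longrightarrow> contraction e n f = 0"
  by (simp add: fun_eq_iff contraction_def cochain_zero slice_def)

lemma contraction_add: "contraction e n (f + g) = contraction e n f + contraction e n g"
proof (rule ext, rule PM.eval_inject)
  fix as x
  show "eval sM x (contraction e n (f + g) as) = eval sM x ((contraction e n f + contraction e n g) as)"
    by (rule PM.tcoeff_unique[OF tcoeff_contraction_eval])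
      (simp add: PM.eval_add PM.tcoeff_add tcoeff_contraction_eval)
qed

lemma contraction_csmult: "contraction e n (csmult k f) = csmult k (contraction e n f)"
proof (rule ext, rule PM.eval_inject)
  fix as x
  show "eval sM x (contraction e n (csmult k f) as) = eval sM x (csmult k (contraction e n f) as)"
    by (rule PM.tcoeff_unique[OF tcoeff_contraction_eval])
      (simp add: csmult_def PM.eval_pact PM.tcoeff_scale tcoeff_contraction_eval)
qed

lemma tcoeff_app:
  assumes "PM.tcoeff n \<phi> m"
  shows "PM.tcoeff n (\<lambda>t. app u (\<phi> t)) (app u m)"
proof -
  obtain P where P: "\<forall>t. \<phi> t = pev sM P [:t:]" "coeff P n = m"
    using assms by (auto simp: PM.tcoeff_def)
  have "pev sM (map_poly (app u) P) [:t:] = app u (pev sM P [:t:])" for t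
    by (rule M.pev_map_poly) (auto simp: app_add_right const_poly_power app_scale_right)
  then show ?thesis
    unfolding PM.tcoeff_def using P by (intro exI[of _ "map_poly (app u) P"]) (auto simp: coeff_map_poly)
qed

lemma tcoeff_lie_d:
  "(\<And>ws. PM.tcoeff n (\<lambda>t. G t ws) (g ws)) \<Longrightarrow> PM.tcoeff n (\<lambda>t. lie_d u (G t) us) (lie_d u g us)"
  by (induction us arbitrary: G g) (auto simp: lie_d.simps(2) intro!: PM.tcoeff_diff tcoeff_app)

lemma tcoeff_ce_d:
  "(\<And>ws. PM.tcoeff n (\<lambda>t. G t ws) (g ws)) \<Longrightarrow> PM.tcoeff n (\<lambda>t. ce_d (G t) us) (ce_d g us)"
  by (induction us arbitrary: G g)
    (auto simp: ce_d.simps(2) PM.tcoeff_0 intro!: PM.tcoeff_diff tcoeff_lie_d)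

text \<open>
  Cartan's formula for \<open>u = (e, t)\<close>, compared at \<open>t ^ n\<close>: contraction with \<open>(e, t)\<close> is the
  generating function of the contractions \<open>contraction e n\<close>.
\<close>

theorem cartan_homotopy:
  assumes f: "f \<in> CC q"
  shows "PM.tcoeff n (\<lambda>t. lie_d (e, t) (hat f) us)
    (hat (df (contraction e n f) + contraction e n (df f)) us)"
proof -
  have "PM.tcoeff n (\<lambda>t. lie_d (e, t) (hat f) us - ce_d (\<lambda>ws. hat f ((e, t) # ws)) us)
      (hat (contraction e n (df f)) us)"
    using tcoeff_contraction[of n "df f" e us] by (simp add: hat_differential[OF f] ce_d.simps(2))
  moreover have "PM.tcoeff n (\<lambda>t. ce_d (\<lambda>ws. hat f ((e, t) # ws)) us) (hat (df (contraction e n f)) us)"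
    unfolding hat_differential[OF contraction_cochain[OF f]]
    by (rule tcoeff_ce_d) (rule tcoeff_contraction)
  ultimately show ?thesis
    using PM.tcoeff_add by (fastforce simp: hat_add add.commute)
qed

end

section \<open>Complexes with an Euler homotopy\<close>

text \<open>
  The operator \<open>D\<close> plays the role of \<open>\<partial>\<close>, and \<open>i0\<close>, \<open>i1\<close> those of contractions of degree
  \<open>- 1\<close>. In degree 0 the truncated subtraction makes \<open>C (q - 1)\<close> equal to \<open>C 0\<close>, so the vanishing of
  contractions on \<open>C 0\<close> is required separately.
\<close>

locale homotopy_complex = vector_space scale
  for scale :: "'f::field \<Rightarrow> 'v::ab_group_add \<Rightarrow> 'v" +
  fixes C :: "nat \<Rightarrow> 'v set" and d D i0 i1 :: "'v \<Rightarrow> 'v"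
  assumes C_subspace: "subspace (C q)"
    and d_closed: "f \<in> C q \<Longrightarrow> d f \<in> C (Suc q)"
    and d_add: "f \<in> C q \<Longrightarrow> g \<in> C q \<Longrightarrow> d (f + g) = d f + d g"
    and d_scale: "f \<in> C q \<Longrightarrow> d (scale k f) = scale k (d f)"
    and d_d: "f \<in> C q \<Longrightarrow> d (d f) = 0"
    and D_closed: "f \<in> C q \<Longrightarrow> D f \<in> C q"
    and D_add: "f \<in> C q \<Longrightarrow> g \<in> C q \<Longrightarrow> D (f + g) = D f + D g"
    and D_scale: "f \<in> C q \<Longrightarrow> D (scale k f) = scale k (D f)"
    and D_inj: "f \<in> C q \<Longrightarrow> D f = 0 \<Longrightarrow> f = 0"
    and i0_closed: "f \<in> C q \<Longrightarrow> i0 f \<in> C (q - 1)"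
    and i0_add: "f \<in> C q \<Longrightarrow> g \<in> C q \<Longrightarrow> i0 (f + g) = i0 f + i0 g"
    and i0_scale: "f \<in> C q \<Longrightarrow> i0 (scale k f) = scale k (i0 f)"
    and i0_0: "f \<in> C 0 \<Longrightarrow> i0 f = 0"
    and i1_closed: "f \<in> C q \<Longrightarrow> i1 f \<in> C (q - 1)"
    and i1_add: "f \<in> C q \<Longrightarrow> g \<in> C q \<Longrightarrow> i1 (f + g) = i1 f + i1 g"
    and i1_scale: "f \<in> C q \<Longrightarrow> i1 (scale k f) = scale k (i1 f)"
    and i1_0: "f \<in> C 0 \<Longrightarrow> i1 f = 0"
    and homotopy: "f \<in> C q \<Longrightarrow> d (i0 f) + i0 (d f) = D f"
begin

lemma C_0: "0 \<in> C q" and C_add: "f \<in> C q \<Longrightarrow> g \<in> C q \<Longrightarrow> f + g \<in> C q"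
  and C_scale: "f \<in> C q \<Longrightarrow> scale k f \<in> C q"
  and C_uminus: "f \<in> C q \<Longrightarrow> - f \<in> C q" and C_diff: "f \<in> C q \<Longrightarrow> g \<in> C q \<Longrightarrow> f - g \<in> C q"
  using C_subspace[of q] by (auto intro: subspace_0 subspace_add subspace_scale subspace_neg subspace_diff)

lemma d_0: "d 0 = 0"
  using d_add[OF C_0 C_0] by simp

lemma d_uminus: "f \<in> C q \<Longrightarrow> d (- f) = - d f"
  using d_scale[of f q "-1"] by simp

lemma d_diff: "f \<in> C q \<Longrightarrow> g \<in> C q \<Longrightarrow> d (f - g) = d f - d g"
  using d_add[of f q "- g"] by (simp add: d_uminus C_uminus)

lemma D_diff: "f \<in> C q \<Longrightarrow> g \<in> C q \<Longrightarrow> D (f - g) = D f - D g"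
  using D_add[of f q "- g"] D_scale[of g q "-1"] by (simp add: C_uminus)

lemma D_cancel: "f \<in> C q \<Longrightarrow> g \<in> C q \<Longrightarrow> D f = D g \<Longrightarrow> f = g"
  using D_inj[of "f - g" q] by (simp add: D_diff C_diff)

definition Z :: "nat \<Rightarrow> 'v set" where "Z q = {f \<in> C q. d f = 0}"
definition B :: "nat \<Rightarrow> 'v set" where "B q = (case q of 0 \<Rightarrow> {0} | Suc p \<Rightarrow> d ` C p)"

lemma d_closed_B: "f \<in> C (q - 1) \<Longrightarrow> (q = 0 \<Longrightarrow> f = 0) \<Longrightarrow> d f \<in> B q"
  by (cases q) (auto simp: B_def d_0)

lemma B_subset_C: "B q \<subseteq> C q"
  by (cases q) (auto simp: B_def C_0 d_closed)

lemma d_i0_B: "f \<in> C q \<Longrightarrow> d (i0 f) \<in> B q" and d_i1_B: "f \<in> C q \<Longrightarrow> d (i1 f) \<in> B q"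
  using i0_closed i1_closed i0_0 i1_0 by (auto intro!: d_closed_B)

lemma d_i0_closed: "f \<in> C q \<Longrightarrow> d (i0 f) \<in> C q" and d_i1_closed: "f \<in> C q \<Longrightarrow> d (i1 f) \<in> C q"
  using d_i0_B[of f q] d_i1_B[of f q] B_subset_C[of q] by blast+

lemma i0_d_closed: "f \<in> C q \<Longrightarrow> i0 (d f) \<in> C q" and i1_d_closed: "f \<in> C q \<Longrightarrow> i1 (d f) \<in> C q"
  using i0_closed[OF d_closed] i1_closed[OF d_closed] by auto

lemma i0_zero: "i0 0 = 0" and i1_zero: "i1 0 = 0"
  using i0_0 i1_0 C_0 by auto

definition E :: "'v \<Rightarrow> 'v" where "E f = d (i1 f) + i1 (d f)"

lemma E_closed: "f \<in> C q \<Longrightarrow> E f \<in> C q"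
  by (simp add: E_def C_add d_i1_closed i1_d_closed)

lemma E_add: "f \<in> C q \<Longrightarrow> g \<in> C q \<Longrightarrow> E (f + g) = E f + E g"
  unfolding E_def
  by (simp add: d_add[of _ q] i1_add[of _ q] d_add[OF i1_closed i1_closed] i1_add[OF d_closed d_closed])

lemma E_scale: "f \<in> C q \<Longrightarrow> E (scale k f) = scale k (E f)"
  unfolding E_def
  by (simp add: d_scale[of _ q] i1_scale[of _ q] d_scale[OF i1_closed] i1_scale[OF d_closed]
      scale_right_distrib)

lemma E_zero: "E 0 = 0"
  using E_scale[OF C_0, of 0] by simp

lemma E_diff: "f \<in> C q \<Longrightarrow> g \<in> C q \<Longrightarrow> E (f - g) = E f - E g"
  using E_add[of f q "- g"] E_scale[of g q "-1"] by (simp add: C_uminus)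

lemma d_E: "f \<in> C q \<Longrightarrow> d (E f) = E (d f)"
  by (simp add: E_def d_add[OF d_i1_closed i1_d_closed] d_d[OF i1_closed] d_d i1_zero)

end

text \<open>
  The functionals \<open>\<Phi> q\<close> are coordinates on the kernel of \<open>E\<close> in degree \<open>q\<close>, extended by 0 to the
  other eigenspaces. In \<open>semisimple\<close> the eigenvalue 0 is accounted for by the outer \<open>E\<close>, so that
  the remaining factors are invertible on the kernel of \<open>E\<close>.
\<close>

locale euler_complex = homotopy_complex scale C d D i0 i1
  for scale :: "'f::field \<Rightarrow> 'v::ab_group_add \<Rightarrow> 'v" and C d D i0 i1 +
  fixes n :: "nat \<Rightarrow> nat" and \<Phi> :: "nat \<Rightarrow> 'v \<Rightarrow> nat \<Rightarrow> 'f"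
  assumes semisimple: "g \<in> C q \<Longrightarrow> \<exists>ss. 0 \<notin> set ss \<and> E (fold (\<lambda>k h. E h - scale k h) ss g) = 0"
    and \<Phi>_add: "f \<in> C q \<Longrightarrow> g \<in> C q \<Longrightarrow> \<Phi> q (f + g) i = \<Phi> q f i + \<Phi> q g i"
    and \<Phi>_scale: "f \<in> C q \<Longrightarrow> \<Phi> q (scale k f) i = k * \<Phi> q f i"
    and \<Phi>_E: "f \<in> C q \<Longrightarrow> i < n q \<Longrightarrow> \<Phi> q (E f) i = 0"
    and \<Phi>_inj: "f \<in> C q \<Longrightarrow> E f = 0 \<Longrightarrow> (\<And>i. i < n q \<Longrightarrow> \<Phi> q f i = 0) \<Longrightarrow> f = 0"
    and d_ker_E: "f \<in> C q \<Longrightarrow> E f = 0 \<Longrightarrow> d f = 0"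
    and \<Phi>_surj: "\<exists>f\<in>C q. \<forall>i<n q. \<Phi> q f i = c i"
begin

lemma \<Phi>_0: "\<Phi> q 0 i = 0"
  using \<Phi>_scale[OF C_0, where k = 0] by simp

text \<open>
  The splitting into the kernel and the image of \<open>E\<close>, by induction on the number of nonzero
  eigenvalues: if \<open>E g - k g = g0 + E h\<close>, then \<open>g = - g0 / k + E ((g - h) / k)\<close>.
\<close>

lemma decompose:
  assumes "g \<in> C q"
  shows "\<exists>g0 h. g0 \<in> C q \<and> h \<in> C q \<and> E g0 = 0 \<and> g = g0 + E h \<and> (d g = 0 \<longrightarrow> d h = 0)"
proof -
  obtain ss where "0 \<notin> set ss" "E (fold (\<lambda>k h. E h - scale k h) ss g) = 0"
    using semisimple[OF assms] by blast
  then show ?thesis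
    using assms
  proof (induction ss arbitrary: g)
    case Nil
    with E_zero show ?case using C_0 d_0 by (intro exI[of _ g] exI[of _ 0]) auto
  next
    case (Cons k ss)
    let ?g = "E g - scale k g"
    have g: "?g \<in> C q" using Cons.prems by (intro C_diff E_closed C_scale)
    then obtain g0 h where *: "g0 \<in> C q" "h \<in> C q" "E g0 = 0" "?g = g0 + E h" "d ?g = 0 \<longrightarrow> d h = 0"
      using Cons.IH[of ?g] Cons.prems by auto
    let ?u = "scale (- 1 / k) g0" and ?h = "scale (1 / k) (g - h)"
    have k: "k \<noteq> 0" using Cons.prems by auto
    have "g = scale (1 / k) (scale k g)" using k by simp
    also have "scale k g = E (g - h) - g0"
      using * Cons.prems E_diff[of g q h] by (simp add: algebra_simps)
    also have "scale (1 / k) \<dots> = ?u + scale (1 / k) (E (g - h))"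
      by (simp add: scale_right_diff_distrib)
    also have "scale (1 / k) (E (g - h)) = E ?h"
      using * Cons.prems by (intro E_scale[symmetric] C_diff)
    finally have "g = ?u + E ?h" .
    moreover have "d ?h = 0" if "d g = 0"
    proof -
      have "d ?g = 0"
        using Cons.prems that by (simp add: d_diff[OF E_closed C_scale] d_E d_scale E_zero)
      then have "d h = 0" using *(5) by blast
      then show ?thesis
        using that by (simp only: d_scale[OF C_diff[OF Cons.prems(3) *(2)]] d_diff[OF Cons.prems(3) *(2)]) simp
    qed
    moreover have "?u \<in> C q" "?h \<in> C q"
      using *(1,2) Cons.prems(3) by (simp_all only: C_scale C_diff)
    moreover have "E ?u = 0"
      using E_scale[OF *(1), of "- 1 / k"] *(3) by (simp only: scale_zero_right)
    ultimately show ?case by blast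
  qed
qed

text \<open>
  A coboundary \<open>d g\<close> lies in the image of \<open>E\<close>, because \<open>d\<close> kills the component of \<open>g\<close> in the
  kernel of \<open>E\<close>. Conversely, a cocycle with vanishing coordinates is \<open>E h\<close> with \<open>h\<close> closed, and
  \<open>E h = d (i1 h)\<close>.
\<close>

lemma Z_in_B_iff:
  assumes "z \<in> Z q"
  shows "z \<in> B q \<longleftrightarrow> (\<forall>i<n q. \<Phi> q z i = 0)"
proof
  assume "z \<in> B q"
  show "\<forall>i<n q. \<Phi> q z i = 0"
  proof (cases q)
    case 0
    then have "z = 0" using \<open>z \<in> B q\<close> by (simp add: B_def)
    then show ?thesis by (simp add: \<Phi>_0)
  next
    case (Suc p)
    then obtain g where g: "g \<in> C p" "z = d g" using \<open>z \<in> B q\<close> by (auto simp: B_def)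
    obtain g0 h where *: "g0 \<in> C p" "h \<in> C p" "E g0 = 0" "g = g0 + E h"
      using decompose[OF g(1)] by blast
    then have "z = E (d h)"
      using g d_ker_E[of g0 p] by (simp add: d_add[OF _ E_closed] d_E)
    then show ?thesis using \<Phi>_E d_closed[OF *(2)] Suc by simp
  qed
next
  assume \<Phi>: "\<forall>i<n q. \<Phi> q z i = 0"
  have z: "z \<in> C q" "d z = 0" using assms by (auto simp: Z_def)
  obtain z0 h where *: "z0 \<in> C q" "h \<in> C q" "E z0 = 0" "z = z0 + E h" "d h = 0"
    using decompose[OF z(1)] z(2) by blast
  have "\<Phi> q z0 i = 0" if "i < n q" for i
    using \<Phi> that * \<Phi>_add[OF *(1) E_closed[OF *(2)]] \<Phi>_E[OF *(2)] by simp
  then have "z0 = 0" using \<Phi>_inj * by blast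
  then have "z = d (i1 h)" using * by (simp add: E_def i1_zero)
  then show "z \<in> B q" using d_i1_B[OF *(2)] by simp
qed

lemma \<Phi>_surj_Z: "\<exists>z\<in>Z q. \<forall>i<n q. \<Phi> q z i = c i"
proof -
  obtain g where g: "g \<in> C q" "\<forall>i<n q. \<Phi> q g i = c i" using \<Phi>_surj by blast
  obtain g0 h where *: "g0 \<in> C q" "h \<in> C q" "E g0 = 0" "g = g0 + E h"
    using decompose[OF g(1)] by blast
  then have "\<forall>i<n q. \<Phi> q g0 i = c i"
    using g \<Phi>_add[OF *(1) E_closed[OF *(2)]] \<Phi>_E[OF *(2)] by simp
  with * d_ker_E show ?thesis by (auto simp: Z_def)
qed

lemma Z_subspace: "subspace (Z q)"
  by (rule subspaceI) (auto simp: Z_def C_0 d_0 C_add d_add[of _ q] C_scale d_scale[of _ q])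

lemma B_subspace: "subspace (B q)"
proof (cases q)
  case 0
  then show ?thesis by (auto simp: B_def intro: subspace_single_0)
next
  case (Suc p)
  show ?thesis
  proof (rule subspaceI)
    show "0 \<in> B q" using C_0 d_0 Suc by (force simp: B_def)
  next
    fix x y assume "x \<in> B q" "y \<in> B q"
    then obtain f g where fg: "f \<in> C p" "g \<in> C p" "x = d f" "y = d g" using Suc by (auto simp: B_def)
    then have "x + y = d (f + g)" by (simp add: d_add[of f p])
    with fg show "x + y \<in> B q" using Suc by (auto simp: B_def C_add)
  next
    fix x k assume "x \<in> B q"
    then obtain f where f: "f \<in> C p" "x = d f" using Suc by (auto simp: B_def)
    then have "scale k x = d (scale k f)" by (simp add: d_scale[of f p])
    with f show "scale k x \<in> B q" using Suc by (auto simp: B_def C_scale)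
  qed
qed

lemma B_subset_Z: "B q \<subseteq> Z q"
  by (cases q) (auto simp: B_def Z_def C_0 d_0 d_closed d_d)

lemma D_d: "f \<in> C q \<Longrightarrow> D (d f) = d (D f)"
  by (simp add: d_d i0_zero d_add[OF d_i0_closed i0_d_closed] d_d[OF i0_closed]
      flip: homotopy[of _ q] homotopy[OF d_closed])

text \<open>
  Representatives of reduced cocycles and of reduced coboundaries. If \<open>d f = D g\<close>, then \<open>g\<close> is
  unique and closed, and \<open>f - i0 g\<close> is closed as well, since \<open>d (i0 g) = D g\<close>. Thus
  \<open>f \<mapsto> ([f - i0 g], [g])\<close> splits the long exact sequence; \<open>\<Psi>\<close> lists the coordinates of
  these two classes.
\<close>

definition R :: "nat \<Rightarrow> 'v set" where "R q = {f \<in> C q. d f \<in> D ` C (Suc q)}"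
definition RB :: "nat \<Rightarrow> 'v set" where "RB q = {b + D h | b h. b \<in> B q \<and> h \<in> C q}"
definition prim :: "nat \<Rightarrow> 'v \<Rightarrow> 'v" where "prim q f = (THE g. g \<in> C (Suc q) \<and> D g = d f)"
definition \<Psi> :: "nat \<Rightarrow> 'v \<Rightarrow> nat \<Rightarrow> 'f" where
  "\<Psi> q f i = (if i < n q then \<Phi> q (f - i0 (prim q f)) i else \<Phi> (Suc q) (prim q f) (i - n q))"

lemma prim_eq: "g \<in> C (Suc q) \<Longrightarrow> D g = d f \<Longrightarrow> prim q f = g"
  unfolding prim_def by (rule the_equality) (auto intro: D_cancel)

lemma RE:
  assumes "f \<in> R q"
  obtains g where "f \<in> C q" "g \<in> Z (Suc q)" "D g = d f" "prim q f = g" "f - i0 g \<in> Z q"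
proof -
  obtain g where g: "f \<in> C q" "g \<in> C (Suc q)" "D g = d f" using assms by (auto simp: R_def)
  then have "D (d g) = 0" by (simp add: D_d d_d)
  then have dg: "d g = 0" using D_inj d_closed g by blast
  have i: "i0 g \<in> C q" using i0_closed[OF g(2)] by simp
  have "d (i0 g) = D g" using homotopy[OF g(2)] dg by (simp add: i0_zero)
  then have "d (f - i0 g) = 0" using g i by (simp add: d_diff[of f q])
  then show ?thesis
    using that[of g] g dg i prim_eq by (simp add: Z_def C_diff)
qed

text \<open>
  If \<open>f - i0 g = b\<close> and \<open>g = d h\<close> with \<open>b\<close> a coboundary, then \<open>f = b - d (i0 h) + D h\<close> by the
  homotopy formula; the converse reads the same equation backwards.
\<close>

lemma R_in_RB_iff:
  assumes "f \<in> R q"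
  shows "f \<in> RB q \<longleftrightarrow> (\<forall>i<n q + n (Suc q). \<Psi> q f i = 0)"
proof -
  obtain g where g: "f \<in> C q" "g \<in> Z (Suc q)" "D g = d f" "prim q f = g" "f - i0 g \<in> Z q"
    using RE[OF assms] by blast
  have "(\<forall>i<n q + n (Suc q). \<Psi> q f i = 0) \<longleftrightarrow>
      (\<forall>i<n q. \<Phi> q (f - i0 g) i = 0) \<and> (\<forall>i<n (Suc q). \<Phi> (Suc q) g i = 0)" (is "?L \<longleftrightarrow> ?R")
  proof
    assume L: ?L
    have "\<Phi> (Suc q) g i = 0" if "i < n (Suc q)" for i
      using L[rule_format, of "n q + i"] that g by (simp add: \<Psi>_def)
    moreover have "\<Phi> q (f - i0 g) i = 0" if "i < n q" for i
      using L[rule_format, of i] that g by (simp add: \<Psi>_def)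
    ultimately show ?R by blast
  qed (auto simp: \<Psi>_def g)
  also have "\<dots> \<longleftrightarrow> f - i0 g \<in> B q \<and> g \<in> B (Suc q)"
    using Z_in_B_iff g by blast
  also have "\<dots> \<longleftrightarrow> f \<in> RB q"
  proof
    assume *: "f - i0 g \<in> B q \<and> g \<in> B (Suc q)"
    then obtain h where h: "h \<in> C q" "g = d h" by (auto simp: B_def)
    then have "f = (f - i0 g - d (i0 h)) + D h" using homotopy[OF h(1)] by (simp add: algebra_simps)
    moreover have "f - i0 g - d (i0 h) \<in> B q"
      using * d_i0_B[OF h(1)] subspace_diff[OF B_subspace, of "f - i0 g" q] by blast
    ultimately show "f \<in> RB q" using h(1) unfolding RB_def by blast
  next
    assume "f \<in> RB q"
    then obtain b h where bh: "b \<in> B q" "h \<in> C q" "f = b + D h" by (auto simp: RB_def)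
    have b: "b \<in> C q" "d b = 0" using bh B_subset_Z by (auto simp: Z_def)
    then have "D (d h) = d f" using bh by (simp add: d_add[OF b(1) D_closed] D_d)
    then have gh: "g = d h" using prim_eq[OF d_closed[OF bh(2)]] g(4) by metis
    have "f - i0 g = b + d (i0 h)"
      unfolding bh(3) gh homotopy[OF bh(2), symmetric] by simp
    then have "f - i0 g \<in> B q"
      using subspace_add[OF B_subspace bh(1) d_i0_B[OF bh(2)]] by simp
    then show "f - i0 g \<in> B q \<and> g \<in> B (Suc q)"
      using gh bh(2) by (simp add: B_def[of "Suc q"])
  qed
  finally show ?thesis by simp
qed

lemma \<Psi>_surj: "\<exists>f\<in>R q. \<forall>i<n q + n (Suc q). \<Psi> q f i = c i"
proof -
  obtain z where z: "z \<in> Z q" "\<forall>i<n q. \<Phi> q z i = c i" using \<Phi>_surj_Z[of q c] by blast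
  obtain g where g: "g \<in> Z (Suc q)" "\<forall>i<n (Suc q). \<Phi> (Suc q) g i = c (n q + i)"
    using \<Phi>_surj_Z[of "Suc q" "\<lambda>i. c (n q + i)"] by blast
  let ?f = "z + i0 g"
  have i: "i0 g \<in> C q" "i0 0 = 0"
    using i0_closed[of g "Suc q"] g i0_zero by (auto simp: Z_def)
  have "d ?f = D g" using z g i homotopy[of g "Suc q"] by (simp add: Z_def d_add[of z q])
  moreover have "?f \<in> C q" using z i by (simp add: Z_def C_add)
  ultimately have "?f \<in> R q" "prim q ?f = g"
    using g prim_eq by (auto simp: R_def Z_def)
  then show ?thesis
    using z g by (intro bexI[of _ ?f]) (auto simp: \<Psi>_def)
qed

lemma R_add:
  assumes "f \<in> R q" "f' \<in> R q"
  shows "f + f' \<in> R q" "\<Psi> q (f + f') i = \<Psi> q f i + \<Psi> q f' i"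
proof -
  obtain g where g: "f \<in> C q" "g \<in> Z (Suc q)" "D g = d f" "prim q f = g" "f - i0 g \<in> Z q"
    using RE[OF assms(1)] by blast
  obtain g' where g': "f' \<in> C q" "g' \<in> Z (Suc q)" "D g' = d f'" "prim q f' = g'" "f' - i0 g' \<in> Z q"
    using RE[OF assms(2)] by blast
  have C: "g \<in> C (Suc q)" "g' \<in> C (Suc q)" "f - i0 g \<in> C q" "f' - i0 g' \<in> C q"
    using g g' by (auto simp: Z_def)
  have "g + g' \<in> C (Suc q)" "D (g + g') = d (f + f')"
    using C g g' by (simp_all add: C_add D_add[of g "Suc q"] d_add[of f q])
  then show "f + f' \<in> R q" using g(1) g'(1) C_add unfolding R_def by (metis (mono_tags, lifting) imageI mem_Collect_eq)
  have p: "prim q (f + f') = g + g'" by (rule prim_eq) fact+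
  have eq: "f + f' - i0 (g + g') = (f - i0 g) + (f' - i0 g')"
    unfolding i0_add[OF C(1,2)] by simp
  show "\<Psi> q (f + f') i = \<Psi> q f i + \<Psi> q f' i"
    unfolding \<Psi>_def p g(4) g'(4) eq \<Phi>_add[OF C(3,4)] \<Phi>_add[OF C(1,2)] by simp
qed

lemma R_scale:
  assumes "f \<in> R q"
  shows "scale k f \<in> R q" "\<Psi> q (scale k f) i = k * \<Psi> q f i"
proof -
  obtain g where g: "f \<in> C q" "g \<in> Z (Suc q)" "D g = d f" "prim q f = g" "f - i0 g \<in> Z q"
    using RE[OF assms(1)] by blast
  have C: "g \<in> C (Suc q)" "f - i0 g \<in> C q"
    using g by (auto simp: Z_def)
  have "scale k g \<in> C (Suc q)" "D (scale k g) = d (scale k f)"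
    using C g by (simp_all add: C_scale D_scale[of g "Suc q"] d_scale[of f q])
  then show "scale k f \<in> R q" using g(1) C_scale unfolding R_def by (metis (mono_tags, lifting) imageI mem_Collect_eq)
  have p: "prim q (scale k f) = scale k g" by (rule prim_eq) fact+
  have eq: "scale k f - i0 (scale k g) = scale k (f - i0 g)"
    using C by (simp add: i0_scale[of g "Suc q"] scale_right_diff_distrib)
  show "\<Psi> q (scale k f) i = k * \<Psi> q f i"
    unfolding \<Psi>_def p g(4) eq \<Phi>_scale[OF C(2)] \<Phi>_scale[OF C(1)] by simp
qed

end

section \<open>Quotients of vector spaces\<close>

lemma vectorspace_of_subspace:
  fixes scale :: "'f::field \<Rightarrow> 'v::ab_group_add \<Rightarrow> 'v"
  assumes vs: "vector_space scale" and S: "module.subspace scale S"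
  shows "vectorspace class_ring \<lparr>carrier = S, monoid.mult = m, one = e, zero = 0, add = (+), module.smult = scale\<rparr>"
proof -
  interpret vector_space scale by (rule vs)
  show ?thesis
  proof (rule vs_criteria, unfold partial_object.simps monoid.simps ring.simps module.simps)
    show "field (class_ring :: 'f ring)"
      using class_field by (simp add: class_field_def)
    show "\<forall>v\<in>S. \<exists>neg_v\<in>S. v + neg_v = 0"
      using subspace_neg[OF S] by (metis add.right_inverse)
  qed (use subspace_0[OF S] subspace_add[OF S] subspace_scale[OF S] in
      \<open>auto simp: scale_left_distrib scale_right_distrib algebra_simps\<close>)
qed

locale quotient_space =
  fixes V :: "('f::field, 'v) module" and N :: "'v set"
  assumes V: "vectorspace class_ring V" and N: "VectorSpace.subspace class_ring N V"
begin

sublocale V: vectorspace class_ring V by (rule V)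

lemma N_submodule: "LinearCombinations.submodule class_ring N V"
  using N by (simp add: VectorSpace.subspace_def)

sublocale N: abelian_subgroup N V
proof (rule abelian_subgroupI3)
  have "\<ominus>\<^bsub>V\<^esub> x \<in> N" if "x \<in> N" for x
    using that V.smult_minus_1[of x] LinearCombinations.submodule.smult_closed[OF N_submodule, of "\<ominus>\<^bsub>class_ring\<^esub> \<one>\<^bsub>class_ring\<^esub>" x]
      LinearCombinations.submodule.subset[OF N_submodule] by auto
  then show "additive_subgroup N V"
    using N_submodule
    by (intro additive_subgroup.intro V.add.subgroupI)
      (auto simp: LinearCombinations.submodule_def a_inv_def)
qed (rule V.abelian_group_axioms)

lemma N_subset: "N \<subseteq> carrier V"
  using N.a_subset by simp

lemma smult_closed: "x \<in> carrier V \<Longrightarrow> k \<odot>\<^bsub>V\<^esub> x \<in> carrier V"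
  by (rule V.smult_closed) auto

lemma N_smult: "x \<in> N \<Longrightarrow> k \<odot>\<^bsub>V\<^esub> x \<in> N"
  using LinearCombinations.submodule.smult_closed[OF N_submodule] by simp

lemma coset_eq: "x \<in> N +>\<^bsub>V\<^esub> y \<Longrightarrow> y \<in> carrier V \<Longrightarrow> N +>\<^bsub>V\<^esub> x = N +>\<^bsub>V\<^esub> y"
  using V.a_repr_independence[of x N y] N.a_subgroup by simp

lemma coset_mem: "x \<in> N +>\<^bsub>V\<^esub> y \<longleftrightarrow> (\<exists>h\<in>N. x = h \<oplus>\<^bsub>V\<^esub> y)"
  by (auto simp: a_r_coset_def')

lemma coset_eq_iff:
  assumes "x \<in> carrier V" "y \<in> carrier V"
  shows "N +>\<^bsub>V\<^esub> x = N +>\<^bsub>V\<^esub> y \<longleftrightarrow> (\<exists>h\<in>N. x = h \<oplus>\<^bsub>V\<^esub> y)"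
  using coset_eq[of x y] coset_mem[of x y] N.a_rcos_self[OF assms(1)] assms(2) by blast

lemma coset_zero: "N +>\<^bsub>V\<^esub> \<zero>\<^bsub>V\<^esub> = N"
  using N_subset V.a_coset_add_zero by simp

lemma carrier_quot: "carrier (quot_module V N) = (\<lambda>x. N +>\<^bsub>V\<^esub> x) ` carrier V"
  by (auto simp: quot_module_def A_RCOSETS_def')

lemma zero_quot: "\<zero>\<^bsub>quot_module V N\<^esub> = N +>\<^bsub>V\<^esub> \<zero>\<^bsub>V\<^esub>"
  by (simp add: quot_module_def coset_zero)

lemma add_quot:
  "x \<in> carrier V \<Longrightarrow> y \<in> carrier V \<Longrightarrow>
    (N +>\<^bsub>V\<^esub> x) \<oplus>\<^bsub>quot_module V N\<^esub> (N +>\<^bsub>V\<^esub> y) = N +>\<^bsub>V\<^esub> (x \<oplus>\<^bsub>V\<^esub> y)"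
  using N.a_rcos_sum[of x y] by (simp add: quot_module_def)

lemma the_elem_coset:
  assumes "x \<in> carrier V" "\<And>x'. x' \<in> N +>\<^bsub>V\<^esub> x \<Longrightarrow> g x' = g x"
  shows "the_elem (g ` (N +>\<^bsub>V\<^esub> x)) = g x"
proof -
  have "g ` (N +>\<^bsub>V\<^esub> x) = (\<lambda>_. g x) ` (N +>\<^bsub>V\<^esub> x)"
    by (rule image_cong[OF refl assms(2)])
  also have "\<dots> = {g x}" using N.a_rcos_self[OF assms(1)] by blast
  finally have "g ` (N +>\<^bsub>V\<^esub> x) = {g x}" .
  then show ?thesis by simp
qed

lemma smult_quot:
  assumes x: "x \<in> carrier V"
  shows "k \<odot>\<^bsub>quot_module V N\<^esub> (N +>\<^bsub>V\<^esub> x) = N +>\<^bsub>V\<^esub> (k \<odot>\<^bsub>V\<^esub> x)"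
proof -
  have "N +>\<^bsub>V\<^esub> (k \<odot>\<^bsub>V\<^esub> x') = N +>\<^bsub>V\<^esub> (k \<odot>\<^bsub>V\<^esub> x)" if x': "x' \<in> N +>\<^bsub>V\<^esub> x" for x'
  proof -
    obtain h where h: "h \<in> N" "x' = h \<oplus>\<^bsub>V\<^esub> x" using x' by (auto simp: coset_mem)
    then have eq: "k \<odot>\<^bsub>V\<^esub> x' = (k \<odot>\<^bsub>V\<^esub> h) \<oplus>\<^bsub>V\<^esub> (k \<odot>\<^bsub>V\<^esub> x)"
      using V.smult_r_distr[of k h x] subsetD[OF N_subset h(1)] x by simp
    show ?thesis
      by (rule coset_eq[OF _ smult_closed[OF x]]) (use eq N_smult[OF h(1)] in \<open>auto simp: coset_mem\<close>)
  qed
  from the_elem_coset[where g = "\<lambda>x'. N +>\<^bsub>V\<^esub> (k \<odot>\<^bsub>V\<^esub> x')", OF x this] show ?thesis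
    by (simp add: quot_module_def)
qed

lemma quot_vectorspace: "vectorspace class_ring (quot_module V N)"
proof (rule vs_criteria)
  show "field (class_ring :: 'f ring)"
    by (rule vectorspace.axioms(2)[OF V])
  show "\<zero>\<^bsub>quot_module V N\<^esub> \<in> carrier (quot_module V N)"
    by (auto simp: zero_quot carrier_quot)
  show "\<forall>v\<in>carrier (quot_module V N). \<exists>neg_v\<in>carrier (quot_module V N).
      v \<oplus>\<^bsub>quot_module V N\<^esub> neg_v = \<zero>\<^bsub>quot_module V N\<^esub>"
  proof
    fix v assume "v \<in> carrier (quot_module V N)"
    then obtain x where x: "x \<in> carrier V" "v = N +>\<^bsub>V\<^esub> x" by (auto simp: carrier_quot)
    have "v \<oplus>\<^bsub>quot_module V N\<^esub> (N +>\<^bsub>V\<^esub> (\<ominus>\<^bsub>V\<^esub> x)) = \<zero>\<^bsub>quot_module V N\<^esub>"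
      using x by (simp add: add_quot zero_quot V.r_neg)
    with x show "\<exists>neg_v\<in>carrier (quot_module V N). v \<oplus>\<^bsub>quot_module V N\<^esub> neg_v = \<zero>\<^bsub>quot_module V N\<^esub>"
      by (auto simp: carrier_quot)
  qed
qed (auto simp: carrier_quot add_quot smult_quot zero_quot smult_closed V.a_ac
    V.smult_assoc1[simplified] V.smult_one[simplified] V.smult_l_distr[simplified]
    V.smult_r_distr[simplified])

text \<open>
  The coordinates \<open>\<phi>\<close> induce an isomorphism from the quotient to the coordinate space. Its
  inverse \<open>T\<close> is the map that is used, because finite dimension passes from the source of a
  surjection to its target.
\<close>

lemma has_dim_quot:
  fixes \<phi> :: "'v \<Rightarrow> nat \<Rightarrow> 'f"
  assumes add: "\<And>x y i. x \<in> carrier V \<Longrightarrow> y \<in> carrier V \<Longrightarrow> i < n \<Longrightarrow> \<phi> (x \<oplus>\<^bsub>V\<^esub> y) i = \<phi> x i + \<phi> y i"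
    and smult: "\<And>k x i. x \<in> carrier V \<Longrightarrow> i < n \<Longrightarrow> \<phi> (k \<odot>\<^bsub>V\<^esub> x) i = k * \<phi> x i"
    and kernel: "\<And>x. x \<in> carrier V \<Longrightarrow> x \<in> N \<longleftrightarrow> (\<forall>i<n. \<phi> x i = 0)"
    and surj: "\<And>c. \<exists>x\<in>carrier V. \<forall>i<n. \<phi> x i = c i"
  shows "has_dim (quot_module V N) n"
proof -
  let ?Q = "quot_module V N" and ?W = "module_vec TYPE('f) n"
  interpret Q: vectorspace class_ring ?Q by (rule quot_vectorspace)
  interpret W: vec_space "TYPE('f)" n .
  define rep where "rep c = (SOME x. x \<in> carrier V \<and> (\<forall>i<n. \<phi> x i = c $ i))" for c :: "'f vec"
  define T where "T c = N +>\<^bsub>V\<^esub> rep c" for c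
  have rep: "rep c \<in> carrier V" "i < n \<Longrightarrow> \<phi> (rep c) i = c $ i" for c i
    using someI_ex[of "\<lambda>x. x \<in> carrier V \<and> (\<forall>i<n. \<phi> x i = c $ i)"] surj[of "\<lambda>i. c $ i"]
    unfolding rep_def by blast+
  have eqI: "N +>\<^bsub>V\<^esub> x = N +>\<^bsub>V\<^esub> y \<longleftrightarrow> (\<forall>i<n. \<phi> x i = \<phi> y i)"
    if xy: "x \<in> carrier V" "y \<in> carrier V" for x y
  proof
    assume "N +>\<^bsub>V\<^esub> x = N +>\<^bsub>V\<^esub> y"
    then obtain h where h: "h \<in> N" "x = h \<oplus>\<^bsub>V\<^esub> y" using coset_eq_iff[OF xy] by blast
    then show "\<forall>i<n. \<phi> x i = \<phi> y i" using kernel[of h] N_subset xy by (auto simp: add)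
  next
    assume eq: "\<forall>i<n. \<phi> x i = \<phi> y i"
    \<comment> \<open>The scalar \<open>- 1\<close> expresses the difference by the operations that \<open>\<phi>\<close> respects.\<close>
    let ?h = "x \<oplus>\<^bsub>V\<^esub> (- 1) \<odot>\<^bsub>V\<^esub> y"
    have "?h \<in> carrier V" using xy smult_closed by auto
    then have "?h \<in> N" using xy eq by (simp add: kernel add smult smult_closed)
    moreover have "(- 1) \<odot>\<^bsub>V\<^esub> y \<oplus>\<^bsub>V\<^esub> y = \<zero>\<^bsub>V\<^esub>"
      using V.smult_l_distr[of "- 1" 1 y] V.smult_one[of y] xy V.lmult_0[of y] by simp
    then have "x = ?h \<oplus>\<^bsub>V\<^esub> y" using xy smult_closed by (simp add: V.a_assoc)
    ultimately show "N +>\<^bsub>V\<^esub> x = N +>\<^bsub>V\<^esub> y" using coset_eq_iff[OF xy] by blast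
  qed
  have T_eq: "T c = N +>\<^bsub>V\<^esub> x" if "x \<in> carrier V" "\<And>i. i < n \<Longrightarrow> \<phi> x i = c $ i" for c x
    unfolding T_def using that rep eqI[OF rep(1) that(1)] by simp
  have add_T: "T (c + c') = T c \<oplus>\<^bsub>?Q\<^esub> T c'" if "c \<in> carrier_vec n" "c' \<in> carrier_vec n" for c c'
  proof -
    have "T (c + c') = N +>\<^bsub>V\<^esub> (rep c \<oplus>\<^bsub>V\<^esub> rep c')"
      by (rule T_eq) (use that rep in \<open>auto simp: add\<close>)
    then show ?thesis by (simp add: T_def add_quot rep)
  qed
  have smult_T: "T (k \<cdot>\<^sub>v c) = k \<odot>\<^bsub>?Q\<^esub> T c" if "c \<in> carrier_vec n" for k c
  proof -
    have "T (k \<cdot>\<^sub>v c) = N +>\<^bsub>V\<^esub> (k \<odot>\<^bsub>V\<^esub> rep c)"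
      by (rule T_eq) (use that rep in \<open>auto simp: smult smult_closed\<close>)
    then show ?thesis by (simp add: T_def smult_quot rep)
  qed
  have img: "T ` carrier_vec n = carrier ?Q"
  proof
    show "T ` carrier_vec n \<subseteq> carrier ?Q" using rep by (auto simp: T_def carrier_quot)
    show "carrier ?Q \<subseteq> T ` carrier_vec n"
    proof
      fix X assume "X \<in> carrier ?Q"
      then obtain x where x: "x \<in> carrier V" "X = N +>\<^bsub>V\<^esub> x" by (auto simp: carrier_quot)
      have "T (vec n (\<phi> x)) = X" unfolding x(2) by (rule T_eq) (use x in auto)
      then show "X \<in> T ` carrier_vec n" by (metis imageI vec_carrier)
    qed
  qed
  have inj: "inj_on T (carrier_vec n)"
  proof (rule inj_onI)
    fix c c' assume *: "c \<in> carrier_vec n" "c' \<in> carrier_vec n" "T c = T c'"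
    then have "\<forall>i<n. \<phi> (rep c) i = \<phi> (rep c') i"
      unfolding T_def using eqI[OF rep(1) rep(1)] by blast
    with rep * show "c = c'" by (intro eq_vecI) auto
  qed
  have "linear_map class_ring ?W ?Q T"
    unfolding linear_map_def mod_hom_def mod_hom_axioms_def LinearCombinations.module_hom_def
    using W.vectorspace_axioms Q.vectorspace_axioms W.module_axioms Q.module_axioms img add_T smult_T
    by (auto simp: module_vec_simps)
  then interpret T: linear_map class_ring ?W ?Q T .
  have "vectorspace.fin_dim class_ring ?Q"
    by (rule T.surj_fin_dim) (use img in \<open>auto simp: module_vec_simps\<close>)
  moreover have "vectorspace.dim class_ring ?Q = n"
    using T.dim_eq W.dim_is_n W.fin_dim inj img by (auto simp: module_vec_simps)
  ultimately show ?thesis using Q.vectorspace_axioms by (simp add: has_dim_def)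
qed

end

section \<open>Cohomology of a complex with an Euler homotopy\<close>

text \<open>
  The fields of the ring structure are \<open>undefined\<close> as in \<open>cochain_space\<close>, so that
  \<open>cochain_space\<close> is literally of this form.
\<close>

definition lin_record :: "('f \<Rightarrow> 'v \<Rightarrow> 'v) \<Rightarrow> 'v set \<Rightarrow> ('f::field, 'v::ab_group_add) module" where
  "lin_record scale S = \<lparr>carrier = S, monoid.mult = undefined, one = undefined, zero = 0, add = (+), module.smult = scale\<rparr>"

lemma lin_record_sel:
  "carrier (lin_record scale S) = S" "\<zero>\<^bsub>lin_record scale S\<^esub> = 0" "x \<oplus>\<^bsub>lin_record scale S\<^esub> y = x + y"
  "module.smult (lin_record scale S) = scale"
  by (simp_all add: lin_record_def)

lemma lin_record_update: "(lin_record scale S)\<lparr>carrier := T\<rparr> = lin_record scale T"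
  by (simp add: lin_record_def)

lemma quotient_space_lin_record:
  assumes "vector_space scale"
  assumes S: "module.subspace scale S" and N: "module.subspace scale N" and sub: "N \<subseteq> S"
  shows "quotient_space (lin_record scale S) N"
proof -
  interpret vector_space scale by fact
  have V: "vectorspace class_ring (lin_record scale S)"
    unfolding lin_record_def by (rule vectorspace_of_subspace[OF vector_space_axioms S])
  have "VectorSpace.subspace class_ring N (lin_record scale S)"
    unfolding VectorSpace.subspace_def LinearCombinations.submodule_def lin_record_sel
    using V sub subspace_0[OF N] subspace_add[OF N] subspace_scale[OF N] vectorspace.axioms(1)[OF V]
    by auto
  with V show ?thesis by (rule quotient_space.intro)
qed

context euler_complex
begin

lemma has_dim_basic: "has_dim (cohomology (\<lambda>q. lin_record scale (C q)) (\<lambda>_. d) q) (n q)"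
proof -
  interpret Q: quotient_space "lin_record scale (Z q)" "B q"
    by (rule quotient_space_lin_record[OF vector_space_axioms Z_subspace B_subspace B_subset_Z])
  have "has_dim (quot_module (lin_record scale (Z q)) (B q)) (n q)"
  proof (rule Q.has_dim_quot, unfold lin_record_sel)
    show "\<exists>x\<in>Z q. \<forall>i<n q. \<Phi> q x i = c i" for c by (rule \<Phi>_surj_Z)
    show "x \<in> B q \<longleftrightarrow> (\<forall>i<n q. \<Phi> q x i = 0)" if "x \<in> Z q" for x
      by (rule Z_in_B_iff[OF that])
  qed (auto simp: Z_def \<Phi>_add \<Phi>_scale)
  moreover have "cohomology (\<lambda>q. lin_record scale (C q)) (\<lambda>_. d) q = quot_module (lin_record scale (Z q)) (B q)"
    unfolding cohomology_def lin_record_update lin_record_sel a_kernel_def' Z_def B_def ..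
  ultimately show ?thesis by simp
qed

definition DC :: "nat \<Rightarrow> 'v set" where "DC q = D ` C q"

lemma DC_subspace: "subspace (DC q)" "DC q \<subseteq> C q"
proof -
  have D0: "D 0 = 0" using D_scale[OF C_0, of 0] by simp
  show "subspace (DC q)"
  proof (rule subspaceI)
    show "0 \<in> DC q" using D0 C_0 by (force simp: DC_def)
  next
    fix x y assume "x \<in> DC q" "y \<in> DC q"
    then obtain f g where fg: "f \<in> C q" "g \<in> C q" "x = D f" "y = D g" by (auto simp: DC_def)
    then have "x + y = D (f + g)" by (simp add: D_add[of f q])
    with fg show "x + y \<in> DC q" by (auto simp: DC_def C_add)
  next
    fix x k assume "x \<in> DC q"
    then obtain f where f: "f \<in> C q" "x = D f" by (auto simp: DC_def)
    then have "scale k x = D (scale k f)" by (simp add: D_scale[of f q])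
    with f show "scale k x \<in> DC q" by (auto simp: DC_def C_scale)
  qed
  show "DC q \<subseteq> C q" by (auto simp: DC_def D_closed)
qed

text \<open>
  The abstract counterparts of \<open>reduced_space\<close> and \<open>reduced_differential\<close>.
\<close>

definition reduced :: "nat \<Rightarrow> ('f, 'v set) module" where
  "reduced q = quot_module (lin_record scale (C q)) (DC q)"

definition reduced_d :: "nat \<Rightarrow> 'v set \<Rightarrow> 'v set" where
  "reduced_d q X = the_elem ((\<lambda>f. DC (Suc q) +>\<^bsub>lin_record scale (C (Suc q))\<^esub> d f) ` X)"

abbreviation coset :: "nat \<Rightarrow> 'v \<Rightarrow> 'v set" where
  "coset q f \<equiv> DC q +>\<^bsub>lin_record scale (C q)\<^esub> f"

lemma reduced_quotient: "quotient_space (lin_record scale (C q)) (DC q)"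
  by (rule quotient_space_lin_record[OF vector_space_axioms C_subspace DC_subspace])

lemmas coset_eq_iff = quotient_space.coset_eq_iff[OF reduced_quotient, unfolded lin_record_sel]
lemmas coset_mem = quotient_space.coset_mem[OF reduced_quotient, unfolded lin_record_sel]
lemmas carrier_reduced = quotient_space.carrier_quot[OF reduced_quotient, unfolded lin_record_sel, folded reduced_def]
lemmas zero_reduced = quotient_space.zero_quot[OF reduced_quotient, unfolded lin_record_sel, folded reduced_def]
lemmas add_reduced = quotient_space.add_quot[OF reduced_quotient, unfolded lin_record_sel, folded reduced_def]
lemmas smult_reduced = quotient_space.smult_quot[OF reduced_quotient, unfolded lin_record_sel, folded reduced_def]

lemma reduced_d_coset:
  assumes f: "f \<in> C q"
  shows "reduced_d q (coset q f) = coset (Suc q) (d f)"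
  unfolding reduced_d_def
proof (rule quotient_space.the_elem_coset[OF reduced_quotient])
  show "f \<in> carrier (lin_record scale (C q))" using f by (simp add: lin_record_sel)
  fix f' assume "f' \<in> coset q f"
  then obtain h where h: "h \<in> C q" "f' = D h + f" unfolding coset_mem by (auto simp: DC_def)
  then have "d f' = D (d h) + d f" "d f' \<in> C (Suc q)"
    using f by (simp_all add: d_add[OF D_closed] D_d d_closed C_add D_closed)
  then show "coset (Suc q) (d f') = coset (Suc q) (d f)"
    using f h d_closed[OF f] d_closed[OF h(1)] by (subst coset_eq_iff) (auto simp: DC_def)
qed

lemma kernel_reduced: "a_kernel (reduced q) (reduced (Suc q)) (reduced_d q) = coset q ` R q"
proof -
  have "coset (Suc q) (d f) = \<zero>\<^bsub>reduced (Suc q)\<^esub> \<longleftrightarrow> d f \<in> D ` C (Suc q)" if "f \<in> C q" for f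
    using d_closed[OF that] C_0
    unfolding zero_reduced by (subst coset_eq_iff) (auto simp: DC_def)
  then have "R q = {f \<in> C q. coset (Suc q) (d f) = \<zero>\<^bsub>reduced (Suc q)\<^esub>}"
    by (auto simp: R_def)
  then show ?thesis
    unfolding a_kernel_def' carrier_reduced using reduced_d_coset by auto
qed

lemma image_reduced:
  "(case q of 0 \<Rightarrow> {\<zero>\<^bsub>reduced 0\<^esub>} | Suc p \<Rightarrow> reduced_d p ` carrier (reduced p)) = coset q ` B q"
  by (cases q) (auto simp: zero_reduced carrier_reduced B_def reduced_d_coset image_image)

lemma R_subset: "R q \<subseteq> C q"
  by (auto simp: R_def)

lemma RB_subset: "RB q \<subseteq> R q"
proof
  fix f assume "f \<in> RB q"
  then obtain b h where bh: "b \<in> B q" "h \<in> C q" "f = b + D h" by (auto simp: RB_def)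
  have b: "b \<in> C q" "d b = 0" using bh B_subset_Z by (auto simp: Z_def)
  then have "d f = D (d h)" using bh by (simp add: d_add[OF b(1) D_closed] D_d)
  then show "f \<in> R q" using b bh d_closed by (auto simp: R_def C_add D_closed)
qed

text \<open>
  The coordinates \<open>\<Psi>\<close> vanish on representatives of reduced coboundaries, in particular on the
  image of \<open>D\<close>. They are therefore well defined on cosets.
\<close>

lemma has_dim_reduced: "has_dim (cohomology reduced reduced_d q) (n q + n (Suc q))"
proof -
  let ?V = "(reduced q)\<lparr>carrier := coset q ` R q\<rparr>" and ?N = "coset q ` B q"
  have Q: "vectorspace class_ring (reduced q)"
    unfolding reduced_def by (rule quotient_space.quot_vectorspace[OF reduced_quotient])
  interpret Q: vectorspace class_ring "reduced q" by (rule Q)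
  have R0: "0 \<in> R q" using C_0 d_0 D_scale[OF C_0, of 0] by (force simp: R_def image_iff)
  have sub: "VectorSpace.subspace class_ring (coset q ` R q) (reduced q)"
    unfolding VectorSpace.subspace_def LinearCombinations.submodule_def
  proof (intro conjI impI allI)
    show "coset q ` R q \<subseteq> carrier (reduced q)"
      using R_subset by (auto simp: carrier_reduced)
    show "\<zero>\<^bsub>reduced q\<^esub> \<in> coset q ` R q" using R0 by (auto simp: zero_reduced)
    show "v \<oplus>\<^bsub>reduced q\<^esub> w \<in> coset q ` R q" if "v \<in> coset q ` R q" "w \<in> coset q ` R q" for v w
      using that R_subset R_add(1) by (auto simp: add_reduced subset_iff)
    show "c \<odot>\<^bsub>reduced q\<^esub> v \<in> coset q ` R q" if "c \<in> carrier class_ring" "v \<in> coset q ` R q" for c v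
      using that R_subset R_scale(1) by (auto simp: smult_reduced subset_iff)
  qed (use Q in \<open>auto simp: Q.module_axioms\<close>)
  have V: "vectorspace class_ring ?V"
    by (rule Q.subspace_is_vs[OF sub])
  have "B q \<subseteq> R q"
    using RB_subset[of q] C_0[of q] D_scale[OF C_0, of 0] by (force simp: RB_def)
  interpret V: quotient_space ?V ?N
  proof (rule quotient_space.intro)
    show "vectorspace class_ring ?V" by (rule V)
    show "VectorSpace.subspace class_ring ?N ?V"
      unfolding VectorSpace.subspace_def LinearCombinations.submodule_def
    proof (intro conjI impI allI)
      show "?N \<subseteq> carrier ?V" using \<open>B q \<subseteq> R q\<close> by auto
      show "\<zero>\<^bsub>?V\<^esub> \<in> ?N" using subspace_0[OF B_subspace] by (auto simp: zero_reduced)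
      show "v \<oplus>\<^bsub>?V\<^esub> w \<in> ?N" if "v \<in> ?N" "w \<in> ?N" for v w
        using that B_subset_C subspace_add[OF B_subspace] by (auto simp: add_reduced subset_iff)
      show "c \<odot>\<^bsub>?V\<^esub> v \<in> ?N" if "c \<in> carrier class_ring" "v \<in> ?N" for c v
        using that B_subset_C subspace_scale[OF B_subspace] by (auto simp: smult_reduced subset_iff)
    qed (use V vectorspace.axioms(1)[OF V] in auto)
  qed
  define \<phi> where "\<phi> X = \<Psi> q (SOME f. f \<in> R q \<and> X = coset q f)" for X
  have \<phi>: "\<phi> (coset q f) i = \<Psi> q f i" if f: "f \<in> R q" and i: "i < n q + n (Suc q)" for f i
  proof -
    define f' where "f' = (SOME g. g \<in> R q \<and> coset q f = coset q g)"
    have f': "f' \<in> R q" "coset q f = coset q f'"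
      using someI_ex[of "\<lambda>g. g \<in> R q \<and> coset q f = coset q g"] f unfolding f'_def by blast+
    then obtain h where h: "h \<in> C q" "f = D h + f'"
      using coset_eq_iff[of f q f'] f R_subset by (auto simp: DC_def)
    then have "D h \<in> RB q" using subspace_0[OF B_subspace, of q] by (force simp: RB_def)
    then have "D h \<in> R q" "\<Psi> q (D h) i = 0" using RB_subset R_in_RB_iff[of "D h" q] i by auto
    then have "\<Psi> q f i = \<Psi> q f' i" using R_add(2)[of "D h" q f' i] f' h by simp
    then show ?thesis by (simp add: \<phi>_def f'_def)
  qed
  have "has_dim (quot_module ?V ?N) (n q + n (Suc q))"
  proof (rule V.has_dim_quot)
    fix x y i assume "x \<in> carrier ?V" "y \<in> carrier ?V" and i: "i < n q + n (Suc q)"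
    then obtain f g where fg: "f \<in> R q" "g \<in> R q" "x = coset q f" "y = coset q g" by auto
    then have "x \<oplus>\<^bsub>?V\<^esub> y = coset q (f + g)" using R_subset by (auto simp: add_reduced subset_iff)
    then show "\<phi> (x \<oplus>\<^bsub>?V\<^esub> y) i = \<phi> x i + \<phi> y i"
      using fg i by (simp add: \<phi> R_add)
  next
    fix k x i assume "x \<in> carrier ?V" and i: "i < n q + n (Suc q)"
    then obtain f where f: "f \<in> R q" "x = coset q f" by auto
    then have "k \<odot>\<^bsub>?V\<^esub> x = coset q (scale k f)" using R_subset by (auto simp: smult_reduced subset_iff)
    then show "\<phi> (k \<odot>\<^bsub>?V\<^esub> x) i = k * \<phi> x i"
      using f i by (simp add: \<phi> R_scale)
  next
    fix x assume "x \<in> carrier ?V"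
    then obtain f where f: "f \<in> R q" "x = coset q f" by auto
    have "coset q f = coset q b \<longleftrightarrow> (\<exists>h\<in>C q. f = D h + b)" if "b \<in> B q" for b
      using that f R_subset B_subset_C by (subst coset_eq_iff) (auto simp: DC_def)
    then have "x \<in> ?N \<longleftrightarrow> (\<exists>b\<in>B q. \<exists>h\<in>C q. f = D h + b)"
      by (simp add: image_iff f(2))
    also have "\<dots> \<longleftrightarrow> f \<in> RB q" by (auto simp: RB_def add.commute)
    also have "\<dots> \<longleftrightarrow> (\<forall>i<n q + n (Suc q). \<phi> x i = 0)"
      using f by (simp add: R_in_RB_iff \<phi>)
    finally show "x \<in> ?N \<longleftrightarrow> (\<forall>i<n q + n (Suc q). \<phi> x i = 0)" .
  next
    fix c
    obtain f where f: "f \<in> R q" "\<forall>i<n q + n (Suc q). \<Psi> q f i = c i" using \<Psi>_surj[of q c] by blast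
    then show "\<exists>x\<in>carrier ?V. \<forall>i<n q + n (Suc q). \<phi> x i = c i"
      by (intro bexI[of _ "coset q f"]) (auto simp: \<phi>)
  qed
  then show ?thesis
    unfolding cohomology_def kernel_reduced image_reduced by simp
qed

end

context conformal_module_char0
begin

lemma cohomology_dimensions:
  assumes "euler_complex csmult CC df (cochain_del sM) (contraction e 0) (contraction e 1) n \<Phi>"
  shows "has_dim (basic_cohomology s br sM act q) (n q)"
    and "has_dim (reduced_cohomology s br sM act q) (n q + n (Suc q))"
proof -
  interpret EC: euler_complex csmult CC df "cochain_del sM" "contraction e 0" "contraction e 1" n \<Phi>
    by (rule assms)
  have sp: "cochain_space s sM q = lin_record csmult (CC q)" for q
    unfolding cochain_space_def lin_record_def
    by (simp add: fun_eq_iff plus_fun_def zero_fun_def csmult_def)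
  have "basic_cohomology s br sM act = cohomology (\<lambda>q. lin_record csmult (CC q)) (\<lambda>_. df)"
    unfolding basic_cohomology_def sp ..
  then show "has_dim (basic_cohomology s br sM act q) (n q)"
    using EC.has_dim_basic by simp
  have "reduced_space s sM = EC.reduced" "reduced_differential s br sM act = EC.reduced_d"
    unfolding reduced_space_def reduced_differential_def sp EC.reduced_def EC.reduced_d_def EC.DC_def fun_eq_iff
    by auto
  then show "has_dim (reduced_cohomology s br sM act q) (n q + n (Suc q))"
    using EC.has_dim_reduced by (simp add: reduced_cohomology_def)
qed

end

section \<open>The algebra \<open>W(0)\<close>\<close>

locale W0_char0 = W0_algebra s br L H
  for s :: "'f::field_char_0 poly \<Rightarrow> 'a::ab_group_add \<Rightarrow> 'a" and br L H
begin

sublocale conformal_module_char0 s br s br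
  by (simp add: conformal_module_char0_def adjoint_module)

lemma coords_unique:
  assumes "s p L + s r H = s p' L + s r' H"
  shows "p = p'" "r = r'"
proof -
  define u where "u v = (if v = L then p - p' else r - r')" for v
  have "(\<Sum>v\<in>{L, H}. s (u v) v) = 0"
    using assms distinct_generators by (simp add: u_def scale_left_diff_distrib algebra_simps)
  then have "\<forall>v\<in>{L, H}. u v = 0"
    using independent_generators dependent_finite[of "{L, H}"] by auto
  then show "p = p'" "r = r'" using distinct_generators by (auto simp: u_def split: if_splits)
qed

lemma coords_exist: "\<exists>p r. a = s p L + s r H"
proof -
  have "a \<in> span {L, H}" using span_generators by simp
  then obtain u where "a = (\<Sum>v\<in>{L, H}. s (u v) v)"
    by (subst (asm) span_finite) auto
  then show ?thesis using distinct_generators by auto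
qed

definition cL :: "'a \<Rightarrow> 'f poly" where "cL a = (THE p. \<exists>r. a = s p L + s r H)"
definition cH :: "'a \<Rightarrow> 'f poly" where "cH a = (THE r. \<exists>p. a = s p L + s r H)"

lemma cL_eq [simp]: "cL (s p L + s r H) = p" and cH_eq [simp]: "cH (s p L + s r H) = r"
  unfolding cL_def cH_def by (auto intro!: the_equality dest: coords_unique)

lemma coords: "a = s (cL a) L + s (cH a) H"
proof -
  obtain p r where "a = s p L + s r H" using coords_exist by blast
  then show ?thesis by simp
qed

lemma coords_add: "cL (a + b) = cL a + cL b" "cH (a + b) = cH a + cH b"
proof -
  have "a + b = s (cL a + cL b) L + s (cH a + cH b) H"
    by (subst (1) coords[of a], subst (1) coords[of b]) (simp add: scale_left_distrib algebra_simps)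
  then show "cL (a + b) = cL a + cL b" "cH (a + b) = cH a + cH b"
    by (metis cL_eq, metis cH_eq)
qed

lemma coords_scale: "cL (s p a) = p * cL a" "cH (s p a) = p * cH a"
proof -
  have "s p a = s (p * cL a) L + s (p * cH a) H"
    by (subst (1) coords[of a]) (simp add: scale_right_distrib)
  then show "cL (s p a) = p * cL a" "cH (s p a) = p * cH a"
    by (metis cL_eq, metis cH_eq)
qed

lemma coords_0 [simp]: "cL 0 = 0" "cH 0 = 0"
  using cL_eq[of 0 0] cH_eq[of 0 0] by simp_all

lemma coords_gens [simp]: "cL L = 1" "cH L = 0" "cL H = 0" "cH H = 1"
  using cL_eq[of 1 0] cH_eq[of 1 0] cL_eq[of 0 1] cH_eq[of 0 1] by simp_all

lemma coords_eqI: "cL a = cL b \<Longrightarrow> cH a = cH b \<Longrightarrow> a = b"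
  by (metis coords)

lemma torsion_free: "s p a = 0 \<Longrightarrow> p \<noteq> 0 \<Longrightarrow> a = 0"
  by (rule coords_eqI) (use coords_scale[of p a] in auto)

text \<open>
  The defining brackets at \<open>\<lambda> = x\<close>; every other value of the action follows by
  \<open>app_scale_poly_left\<close> and \<open>app_scale_poly_right\<close>.
\<close>

lemma act_gens:
  "app (L, x) L = s [:2 * x, 1:] L" "app (L, x) H = s [:x, 1:] H"
  "app (H, x) L = s [:x:] H" "app (H, x) H = 0"
proof -
  have two: "2 * [:x:] + [:0, 1:] = [:2 * x, 1:]" by (simp flip: numeral_poly) (simp add: numeral_poly)
  show "app (L, x) L = s [:2 * x, 1:] L"
    using arg_cong[OF br_LL, of "eval s (\<lambda>_. x)"] two
    by (simp add: PA.eval_poly_at PA.eval_pact rval_simps lact_def add.commute)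
  show "app (L, x) H = s [:x, 1:] H"
    using arg_cong[OF br_LH, of "eval s (\<lambda>_. x)"]
    by (simp add: PA.eval_poly_at PA.eval_pact rval_simps lact_def)
  show "app (H, x) L = s [:x:] H"
    using arg_cong[OF br_HL, of "eval s (\<lambda>_. x)"]
    by (simp add: PA.eval_poly_at PA.eval_pact rval_simps lact_def)
  show "app (H, x) H = 0"
    using arg_cong[OF br_HH, of "eval s (\<lambda>_. x)"]
    by (simp add: PA.eval_poly_at lact_def)
qed

lemma app_L: "app (L, x) (s p L + s r H) =
  s [:2 * x, 1:] (s (pcompose p [:x, 1:]) L) + s [:x, 1:] (s (pcompose r [:x, 1:]) H)"
  by (simp add: app_add_right app_scale_poly_right act_gens mult.commute)

lemma app_L_0: "app (L, 0) m = s [:0, 1:] m"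
proof -
  have "app (L, 0) (s (cL m) L + s (cH m) H) = s [:0, 1:] (s (cL m) L + s (cH m) H)"
    unfolding app_L by (simp add: pcompose_idR scale_right_distrib)
  then show ?thesis by (simp flip: coords)
qed

lemma app_H_H: "app (H, x) (s r H) = 0"
  by (simp add: app_scale_poly_right act_gens)

text \<open>
  Both the action and the bracket of \<open>(L, 0)\<close> are \<open>\<partial>\<close>. In a slot with parameter \<open>x\<close> this is
  \<open>- x\<close>, and the Lie derivative subtracts the slots, which gives \<open>\<partial>\<close> plus the sum of the
  parameters.
\<close>

lemma homotopy_del:
  assumes f: "f \<in> CC q"
  shows "df (contraction L 0 f) + contraction L 0 (df f) = cochain_del s f" (is "?l = _")
proof (rule cochain_eqI)
  show "cochain_del s f \<in> CC q" by (rule cochain_del_cochain[OF f])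
  show "?l \<in> CC q"
  proof (cases q)
    case 0
    then have "contraction L 0 f = 0" using f by (simp add: contraction_zero_degree)
    moreover have "csmult 0 g = 0" for g by (simp add: csmult_def fun_eq_iff pact_def const_def)
    then have "df 0 = 0" using differential_csmult[OF zero_cochain, of 0] by simp
    ultimately show ?thesis
      using contraction_cochain[OF differential_cochain[OF f]] by simp
  next
    case (Suc p)
    then show ?thesis
      using differential_cochain[OF contraction_cochain[OF f]]
        contraction_cochain[OF differential_cochain[OF f]] by (simp add: add_cochain)
  qed
  fix us
  have slot: "hat f (us[i := brk (L, 0) (us ! i)]) = s [:- snd (us ! i):] (hat f us)" if "i < length us" for i
  proof -
    have "brk (L, 0) (us ! i) = (s [:0, 1:] (fst (us ! i)), snd (us ! i))"
      by (simp add: lbr_def app_L_0)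
    then show ?thesis
      using slotwiseD(2)[OF cochain_slotwise[OF f], where us = "take i us" and p = "[:0, 1:]"
          and a = "fst (us ! i)" and x = "snd (us ! i)" and vs = "drop (Suc i) us"] that
      by (simp add: upd_conv_take_nth_drop id_take_nth_drop[symmetric])
  qed
  have "hat ?l us = lie_d (L, 0) (hat f) us"
    using PA.tcoeff_0_eval[OF cartan_homotopy[OF f, where n = 0 and e = L and us = us]] by simp
  also have "\<dots> = s [:0, 1:] (hat f us) - (\<Sum>i<length us. s [:- snd (us ! i):] (hat f us))"
    by (simp add: lie_d_sum app_L_0 slot)
  also have "\<dots> = s ([:0, 1:] - (\<Sum>i<length us. [:- snd (us ! i):])) (hat f us)"
    by (simp add: scale_left_diff_distrib scale_sum_left)
  also have "[:0, 1:] - (\<Sum>i<length us. [:- snd (us ! i):]) = [:sum_list (map snd us), 1:]"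
    by (simp add: const_poly_sum sum_negf sum_list_sum_nth atLeast0LessThan)
  finally show "hat ?l us = hat (cochain_del s f) us" unfolding hat_cochain_del .
qed

lemma cochain_del_inject:
  assumes "f \<in> CC q" "cochain_del s f = 0"
  shows "f = 0"
proof (rule cochain_eqI[OF assms(1) zero_cochain])
  fix us
  have "s [:sum_list (map snd us), 1:] (hat f us) = 0"
    using hat_cochain_del[of f us] assms(2) by (simp add: hat_0)
  then have "hat f us = 0" by (rule torsion_free) simp
  then show "hat f us = hat 0 us" by (simp add: hat_0)
qed

end

sublocale W0_char0 \<subseteq> HC: homotopy_complex csmult CC df "cochain_del s" "contraction L 0" "contraction L 1"
proof (intro homotopy_complex.intro homotopy_complex_axioms.intro csmult_vector_space)
  show "Modules.module.subspace csmult (CC q)" for q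
  proof -
    interpret v: vector_space csmult by (rule csmult_vector_space)
    show ?thesis by (rule v.subspaceI) (auto simp: zero_cochain add_cochain csmult_cochain)
  qed
  show "df (df f) = 0" if "f \<in> CC q" for f q
    using differential_differential[OF that] by (simp add: zero_fun_def)
qed (auto simp: differential_cochain differential_add differential_csmult cochain_del_cochain
    cochain_del_add cochain_del_csmult contraction_cochain[simplified] contraction_add contraction_csmult
    contraction_zero_degree homotopy_del dest: cochain_del_inject)

section \<open>The Euler operator on \<open>W(0)\<close>\<close>

context W0_char0
begin

definition nL :: "'a list \<Rightarrow> nat" where "nL gs = card {i. i < length gs \<and> gs ! i = L}"
definition mdeg :: "nat \<Rightarrow> (nat \<Rightarrow>\<^sub>0 nat) \<Rightarrow> nat" where "mdeg q \<alpha> = (\<Sum>i<q. lookup \<alpha> i)"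
definition gens :: "nat \<Rightarrow> 'a list set" where "gens q = {gs. set gs \<subseteq> {L, H} \<and> length gs = q}"

text \<open>
  The coefficient of \<open>t\<close> in \<open>L\<^sub>t m\<close>, multiplying \<open>\<partial>\<^sup>n L\<close> by \<open>n + 2\<close> and \<open>\<partial>\<^sup>n H\<close> by
  \<open>n + 1\<close>.
\<close>

definition Deg :: "'a \<Rightarrow> 'a" where
  "Deg m = s (pCons 0 (pderiv (cL m)) + Polynomial.smult 2 (cL m)) L + s (pCons 0 (pderiv (cH m)) + cH m) H"

lemma tcoeff_app_L: "PA.tcoeff (Suc 0) (\<lambda>t. app (L, t) m) (Deg m)"
proof -
  let ?p = "cL m" and ?r = "cH m"
  let ?f = "\<lambda>t. s (pcompose ?p [:t, 1:]) L" and ?g = "\<lambda>t. s (pcompose ?r [:t, 1:]) H"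
  have "app (L, t) m = (s [:0, 1:] (?f t) + s [:2:] (s [:t:] (?f t))) + (s [:0, 1:] (?g t) + s [:t:] (?g t))" for t
  proof -
    have "[:2 * t, 1:] = [:0, 1:] + [:2:] * [:t:]" "[:t, 1:] = [:0, 1:] + [:t:]" by simp_all
    then have "s [:2 * t, 1:] a = s [:0, 1:] a + s [:2:] (s [:t:] a)" "s [:t, 1:] b = s [:0, 1:] b + s [:t:] b" for a b
      by (simp_all only: scale_left_distrib scale_scale)
    then have "app (L, t) (s ?p L + s ?r H) = (s [:0, 1:] (?f t) + s [:2:] (s [:t:] (?f t))) + (s [:0, 1:] (?g t) + s [:t:] (?g t))"
      by (simp only: app_L)
    then show ?thesis by (simp flip: coords)
  qed
  moreover have "PA.tcoeff (Suc 0) (\<lambda>t. (s [:0, 1:] (?f t) + s [:2:] (s [:t:] (?f t))) + (s [:0, 1:] (?g t) + s [:t:] (?g t)))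
      ((s [:0, 1:] (s (pderiv ?p) L) + s [:2:] (s ?p L)) + (s [:0, 1:] (s (pderiv ?r) H) + s ?r H))"
    by (intro PA.tcoeff_add PA.tcoeff_scale PA.tcoeff_times_t PA.tcoeff_shift)
  moreover have "(s [:0, 1:] (s (pderiv ?p) L) + s [:2:] (s ?p L)) + (s [:0, 1:] (s (pderiv ?r) H) + s ?r H) = Deg m"
    by (simp add: Deg_def scale_left_distrib)
  ultimately show ?thesis by simp
qed

lemma pt_update: "i < length us \<Longrightarrow> pt (us[i := (a, y)]) = (pt us)(i := y)"
  by (auto simp: pt_def fun_eq_iff nth_list_update)

lemma hat_sum: "hat f us = (\<Sum>\<alpha>\<in>keys (f (map fst us)). s [:mval (pt us) \<alpha>:] (lookup (f (map fst us)) \<alpha>))"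
  by (simp add: hat_def eval_def)

lemma sum_of_bool_nL: "(\<Sum>i<length gs. of_bool (gs ! i = L)) = (of_nat (nL gs) :: 'f)"
proof -
  have "(\<Sum>i<length gs. of_bool (gs ! i = L)) = (\<Sum>i\<in>{i. i < length gs \<and> gs ! i = L}. (1 :: 'f))"
    by (rule sum.mono_neutral_cong_right) auto
  then show ?thesis by (simp add: nL_def)
qed

text \<open>
  Expand the Lie derivative along \<open>(L, t)\<close> to first order in \<open>t\<close>. The action on the value
  contributes \<open>Deg\<close>. Bracketing the argument \<open>(g, x)\<close> with \<open>(L, t)\<close> shifts its parameter to
  \<open>x + t\<close> and multiplies the value by \<open>\<delta> t - x\<close>, where \<open>\<delta>\<close> is 1 for \<open>g = L\<close> and 0 for
  \<open>g = H\<close>. The coefficient of \<open>t\<close> in \<open>(\<delta> t - x) (x + t)\<^sup>a\<close> is \<open>(\<delta> - a) x\<^sup>a\<close>, and these are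
  subtracted and summed over all arguments.
\<close>

lemma lookup_E:
  assumes f: "f \<in> CC q" and gs: "gs \<in> gens q"
  shows "lookup (HC.E f gs) \<alpha> = Deg (lookup (f gs) \<alpha>)
    + s [:of_nat (mdeg q \<alpha>) - of_nat (nL gs):] (lookup (f gs) \<alpha>)"
proof -
  let ?u = "f gs"
  let ?K = "keys ?u"
  let ?T = "\<lambda>\<alpha>. Deg (lookup ?u \<alpha>) + s [:of_nat (mdeg q \<alpha>) - of_nat (nL gs):] (lookup ?u \<alpha>)"
  define v where "v = (\<Sum>\<alpha>\<in>?K. single \<alpha> (?T \<alpha>))"
  have len: "length gs = q" and mem: "\<And>i. i < q \<Longrightarrow> gs ! i = L \<or> gs ! i = H"
    using gs by (auto simp: gens_def dest: nth_mem)
  have keys: "i < q" if "\<alpha> \<in> ?K" "i \<in> keys \<alpha>" for \<alpha> i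
    using cochain_keys[OF f len that] .
  have "HC.E f gs = v"
  proof (rule PA.eval_inject)
    fix x :: "nat \<Rightarrow> 'f"
    let ?us = "zip gs (map x [0..<q])"
    let ?c = "\<lambda>i \<alpha>. [:- x i, of_bool (gs ! i = L):] * [:x i, 1:] ^ lookup \<alpha> i" and ?r = "\<lambda>i \<alpha>. s [:mval ((pt ?us)(i := 1)) \<alpha>:] (lookup ?u \<alpha>)"
    have us: "map fst ?us = gs" "length ?us = q" using len by auto
    have ptx: "pt ?us i = x i" if "i < q" for i using that len by (simp add: pt_def)
    have slot: "hat f (?us[i := brk (L, t) (?us ! i)])
        = (\<Sum>\<alpha>\<in>?K. s [:poly (?c i \<alpha>) t:]
            (?r i \<alpha>))" if i: "i < q" for i t
    proof -
      have usi: "?us ! i = (gs ! i, x i)" using i len by simp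
      \<comment> \<open>For \<open>L\<close> the bracket is \<open>\<partial> + 2 t\<close> and for \<open>H\<close> it is \<open>\<partial> + t\<close>, where \<open>\<partial>\<close> acts as \<open>- (x i + t)\<close>.\<close>
      obtain p where p: "brk (L, t) (?us ! i) = (s p (gs ! i), x i + t)"
          "poly p (- (x i + t)) = of_bool (gs ! i = L) * t - x i"
      proof (cases "gs ! i = L")
        case True
        then show ?thesis
          using that[of "[:2 * t, 1:]"] usi by (simp add: lbr_def act_gens add.commute)
      next
        case False
        then have "gs ! i = H" using mem[OF i] by simp
        then show ?thesis
          using that[of "[:t, 1:]"] usi False by (simp add: lbr_def act_gens add.commute)
      qed
      have "hat f (?us[i := brk (L, t) (?us ! i)]) = s [:of_bool (gs ! i = L) * t - x i:] (hat f (?us[i := (gs ! i, x i + t)]))"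
        using slotwiseD(2)[OF cochain_slotwise[OF f], where us = "take i ?us" and p = p
            and a = "gs ! i" and x = "x i + t" and vs = "drop (Suc i) ?us"] i us p
        by (simp add: upd_conv_take_nth_drop)
      also have "hat f (?us[i := (gs ! i, x i + t)]) = (\<Sum>\<alpha>\<in>?K. s [:mval ((pt ?us)(i := x i + t)) \<alpha>:] (lookup ?u \<alpha>))"
      proof -
        have "map fst (?us[i := (gs ! i, x i + t)]) = gs"
          using i us by (simp add: map_update)
        then show ?thesis using i us by (simp add: hat_sum pt_update)
      qed
      also have "s [:of_bool (gs ! i = L) * t - x i:] \<dots>
        = (\<Sum>\<alpha>\<in>?K. s [:poly (?c i \<alpha>) t:]
            (?r i \<alpha>))"
        unfolding scale_sum_right
      proof (rule sum.cong[OF refl])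
        fix \<alpha>
        let ?a = "lookup \<alpha> i" and ?R = "mval ((pt ?us)(i := 1)) \<alpha>"
        have "poly ([:- x i, of_bool (gs ! i = L):] * [:x i, 1:] ^ ?a) t = (of_bool (gs ! i = L) * t - x i) * (x i + t) ^ ?a"
          by (simp add: algebra_simps)
        moreover have "mval ((pt ?us)(i := x i + t)) \<alpha> = (x i + t) ^ ?a * ?R"
          by (rule mval_upd)
        ultimately show "s [:of_bool (gs ! i = L) * t - x i:] (s [:mval ((pt ?us)(i := x i + t)) \<alpha>:] (lookup ?u \<alpha>))
          = s [:poly ([:- x i, of_bool (gs ! i = L):] * [:x i, 1:] ^ ?a) t:] (s [:?R:] (lookup ?u \<alpha>))"
          by (simp only: scale_scale const_poly_mult mult.assoc)
      qed
      finally show ?thesis .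
    qed
    have "PA.tcoeff (Suc 0) (\<lambda>t. lie_d (L, t) (hat f) ?us)
      ((\<Sum>\<alpha>\<in>?K. s [:mval (pt ?us) \<alpha>:] (Deg (lookup ?u \<alpha>)))
        - (\<Sum>i<q. \<Sum>\<alpha>\<in>?K. s [:coeff (?c i \<alpha>) (Suc 0):]
            (?r i \<alpha>)))"
    proof -
      have "lie_d (L, t) (hat f) ?us = (\<Sum>\<alpha>\<in>?K. s [:mval (pt ?us) \<alpha>:] (app (L, t) (lookup ?u \<alpha>)))
        - (\<Sum>i<q. \<Sum>\<alpha>\<in>?K. s [:poly (?c i \<alpha>) t:]
            (?r i \<alpha>))" for t
      proof -
        have "app (L, t) (hat f ?us) = (\<Sum>\<alpha>\<in>?K. s [:mval (pt ?us) \<alpha>:] (app (L, t) (lookup ?u \<alpha>)))"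
          unfolding hat_sum us(1) app_sum_right app_scale_right ..
        moreover have "(\<Sum>i<q. hat f (?us[i := brk (L, t) (?us ! i)])) = (\<Sum>i<q. \<Sum>\<alpha>\<in>?K. s [:poly (?c i \<alpha>) t:]
            (?r i \<alpha>))"
          by (rule sum.cong) (use slot in auto)
        ultimately show ?thesis by (simp only: lie_d_sum us(2))
      qed
      then show ?thesis
        by (simp only:) (intro PA.tcoeff_diff PA.tcoeff_sum PA.tcoeff_scale tcoeff_app_L PA.tcoeff_poly)
    qed
    then have "hat (HC.E f) ?us = (\<Sum>\<alpha>\<in>?K. s [:mval (pt ?us) \<alpha>:] (Deg (lookup ?u \<alpha>)))
        - (\<Sum>i<q. \<Sum>\<alpha>\<in>?K. s [:coeff (?c i \<alpha>) (Suc 0):]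
            (?r i \<alpha>))"
      using PA.tcoeff_unique cartan_homotopy[OF f, where n = 1 and e = L and us = ?us]
      unfolding HC.E_def by simp
    also have "(\<Sum>i<q. \<Sum>\<alpha>\<in>?K. s [:coeff (?c i \<alpha>) (Suc 0):]
            (?r i \<alpha>))
      = (\<Sum>\<alpha>\<in>?K. \<Sum>i<q. s [:(of_bool (gs ! i = L) - of_nat (lookup \<alpha> i)) * mval (pt ?us) \<alpha>:] (lookup ?u \<alpha>))"
    proof (subst sum.swap, intro sum.cong refl)
      fix \<alpha> :: "nat \<Rightarrow>\<^sub>0 nat" and i assume "i \<in> {..<q}"
      then have i: "i < q" by simp
      let ?a = "lookup \<alpha> i" and ?b = "of_bool (gs ! i = L) :: 'f"
      have "coeff ([:- x i, ?b:] * [:x i, 1:] ^ ?a) (Suc 0) = ?b * x i ^ ?a - of_nat ?a * x i ^ ?a"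
        using coeff_linear_power[of "x i" ?a] by simp
      then have "coeff ([:- x i, ?b:] * [:x i, 1:] ^ ?a) (Suc 0) * mval ((pt ?us)(i := 1)) \<alpha>
          = (?b - of_nat ?a) * mval (pt ?us) \<alpha>"
        by (simp only: mval_split[of "pt ?us" \<alpha> i] ptx[OF i] left_diff_distrib mult.assoc)
      then show "s [:coeff ([:- x i, ?b:] * [:x i, 1:] ^ ?a) (Suc 0):]
            (?r i \<alpha>)
          = s [:(?b - of_nat ?a) * mval (pt ?us) \<alpha>:] (lookup ?u \<alpha>)"
        by (simp only: scale_scale const_poly_mult)
    qed
    also have "\<dots> = (\<Sum>\<alpha>\<in>?K. s [:mval (pt ?us) \<alpha>:] (s [:of_nat (nL gs) - of_nat (mdeg q \<alpha>):] (lookup ?u \<alpha>)))"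
    proof (rule sum.cong[OF refl])
      fix \<alpha> :: "nat \<Rightarrow>\<^sub>0 nat"
      have "(\<Sum>i<q. (of_bool (gs ! i = L) - of_nat (lookup \<alpha> i)) * mval (pt ?us) \<alpha>)
          = (of_nat (nL gs) - of_nat (mdeg q \<alpha>)) * mval (pt ?us) \<alpha>"
        using sum_of_bool_nL[of gs] len by (simp add: mdeg_def sum_subtractf flip: sum_distrib_right)
      then show "(\<Sum>i<q. s [:(of_bool (gs ! i = L) - of_nat (lookup \<alpha> i)) * mval (pt ?us) \<alpha>:] (lookup ?u \<alpha>))
          = s [:mval (pt ?us) \<alpha>:] (s [:of_nat (nL gs) - of_nat (mdeg q \<alpha>):] (lookup ?u \<alpha>))"
        by (simp add: const_poly_sum mult.commute flip: scale_sum_left)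
    qed
    also have "(\<Sum>\<alpha>\<in>?K. s [:mval (pt ?us) \<alpha>:] (Deg (lookup ?u \<alpha>))) - \<dots>
        = (\<Sum>\<alpha>\<in>?K. s [:mval (pt ?us) \<alpha>:] (?T \<alpha>))"
    proof -
      have "s c (Deg m) - s c (s [:a - b:] m) = s c (Deg m + s [:b - a:] m)" for c m and a b :: 'f
      proof -
        have "s [:b - a:] m = - s [:a - b:] m" by (simp flip: scale_minus_left)
        then show ?thesis by (simp only: scale_right_distrib scale_minus_right) simp
      qed
      then show ?thesis by (simp only: flip: sum_subtractf)
    qed
    also have "\<dots> = eval s (pt ?us) v"
      by (simp add: v_def PA.eval_sum)
    also have "\<dots> = eval s x v"
      unfolding v_def PA.eval_sum PA.eval_single
      by (intro sum.cong refl arg_cong2[where f = s] arg_cong[where f = "\<lambda>c. [:c:]"] mval_cong)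
        (use keys ptx in auto)
    finally show "eval s x (HC.E f gs) = eval s x v"
      using eval_eq_hat[OF cochain_local_on[OF HC.E_closed[OF f]] len] by simp
  qed
  moreover have "lookup v \<alpha> = ?T \<alpha>"
  proof (cases "\<alpha> \<in> ?K")
    case True
    then show ?thesis by (simp add: v_def lookup_sum lookup_single when_def)
  next
    case False
    then have "lookup ?u \<alpha> = 0" by (simp add: in_keys_iff)
    moreover have "lookup v \<alpha> = 0"
      using False by (auto simp: v_def lookup_sum lookup_single when_def intro!: sum.neutral)
    ultimately show ?thesis by (simp add: Deg_def)
  qed
  ultimately show ?thesis by simp
qed

text \<open>The flag \<open>X\<close> selects the component along \<open>H\<close>, and its negation that along \<open>L\<close>.\<close>

definition co :: "bool \<Rightarrow> nat \<Rightarrow> 'a \<Rightarrow> 'f" where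
  "co X n m = coeff (if X then cH m else cL m) n"

text \<open>An integer, because the weight is negative for small degrees.\<close>

definition wt :: "'a list \<Rightarrow> (nat \<Rightarrow>\<^sub>0 nat) \<Rightarrow> nat \<Rightarrow> bool \<Rightarrow> int" where
  "wt gs \<alpha> n X = int (mdeg (length gs) \<alpha>) + int n + (if X then 1 else 2) - int (nL gs)"

lemma co_add: "co X n (a + b) = co X n a + co X n b"
  by (simp add: co_def coords_add)

lemma co_scale: "co X n (s [:k:] a) = k * co X n a"
  by (simp add: co_def coords_scale)

lemma co_0 [simp]: "co X n 0 = 0"
  by (simp add: co_def)

lemma co_diff: "co X n (a - b) = co X n a - co X n b"
  using co_add[of X n "a - b" b] by simp

lemma co_eqI: "(\<And>X n. co X n a = co X n b) \<Longrightarrow> a = b"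
proof (rule coords_eqI)
  assume *: "\<And>X n. co X n a = co X n b"
  show "cL a = cL b" using *[of False] by (simp add: co_def poly_eq_iff)
  show "cH a = cH b" using *[of True] by (simp add: co_def poly_eq_iff)
qed

lemma co_Deg: "co X n (Deg m) = (of_nat n + (if X then 1 else 2)) * co X n m"
proof -
  have "coeff (pCons 0 (pderiv p)) n = of_nat n * coeff p n" for p :: "'f poly"
    by (cases n) (auto simp: coeff_pderiv)
  moreover have "cL (Deg m) = pCons 0 (pderiv (cL m)) + Polynomial.smult 2 (cL m)"
    "cH (Deg m) = pCons 0 (pderiv (cH m)) + cH m"
    unfolding Deg_def by (rule cL_eq cH_eq)+
  ultimately show ?thesis by (simp add: co_def) (simp add: algebra_simps)
qed

lemma co_E:
  assumes "f \<in> CC q" "gs \<in> gens q"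
  shows "co X n (lookup (HC.E f gs) \<alpha>) = of_int (wt gs \<alpha> n X) * co X n (lookup (f gs) \<alpha>)"
proof -
  have "length gs = q" using assms by (simp add: gens_def)
  then show ?thesis
    unfolding lookup_E[OF assms] by (simp add: co_add co_scale co_Deg wt_def algebra_simps)
qed

end

section \<open>Cochains of weight zero\<close>

lemma sum_inj_nat_ge: "finite S \<Longrightarrow> inj_on g S \<Longrightarrow> (\<Sum>i<card S. i) \<le> (\<Sum>i\<in>S. (g i :: nat))"
proof -
  have *: "(\<Sum>i<card T. i) \<le> \<Sum> T" if "finite T" for T :: "nat set"
    using that
  proof (induction T rule: finite_linorder_max_induct)
    case (insert b A)
    have "A \<subseteq> {..<b}" using insert by auto
    then have "card A \<le> b" using card_mono[of "{..<b}" A] by simp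
    moreover have "b \<notin> A" using insert by auto
    ultimately show ?case using insert by simp
  qed simp
  assume "finite S" "inj_on g S"
  then show ?thesis using *[of "g ` S"] by (simp add: card_image sum.reindex)
qed

context W0_char0
begin

lemma finite_gens: "finite (gens q)"
  unfolding gens_def by (rule finite_lists_length_eq) simp

lemma cochain_gens_eq_0:
  assumes f: "f \<in> CC q" and 0: "\<And>gs. gs \<in> gens q \<Longrightarrow> f gs = 0"
  shows "f = 0"
proof (rule cochain_eqI[OF f zero_cochain])
  have *: "hat f (us @ vs) = 0" if "set (map fst vs) \<subseteq> {L, H}" for us vs
    using that
  proof (induction us arbitrary: vs rule: rev_induct)
    case Nil
    show ?case
    proof (cases "length vs = q")
      case True
      then have "map fst vs \<in> gens q" using Nil by (simp add: gens_def)
      then show ?thesis using 0 by (simp add: hat_def)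
    qed (simp add: hat_zero[OF f])
  next
    case (snoc u us)
    obtain a x where u: "u = (a, x)" by fastforce
    note D = slotwiseD(1,2)[OF cochain_slotwise[OF f]]
    have "hat f (us @ (s (cL a) L + s (cH a) H, x) # vs) = 0"
      using snoc.IH[of "(L, x) # vs"] snoc.IH[of "(H, x) # vs"] snoc.prems by (simp add: D)
    then show ?case by (simp add: u flip: coords)
  qed
  show "hat f us = hat 0 us" for us
    using *[of "[]" us] by (simp add: hat_0)
qed

lemma lookup_csmult: "lookup (csmult k f gs) \<alpha> = s [:k:] (lookup (f gs) \<alpha>)"
  by (simp add: csmult_def PA.lookup_pact_const)

abbreviation "euler_fold \<equiv> fold (\<lambda>k h. HC.E h - csmult k h)"

lemma fold_E:
  assumes "f \<in> CC q"
  shows "euler_fold ss f \<in> CC q"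
    and "gs \<in> gens q \<Longrightarrow> co X n (lookup (euler_fold ss f gs) \<alpha>)
      = (\<Prod>k\<leftarrow>ss. of_int (wt gs \<alpha> n X) - k) * co X n (lookup (f gs) \<alpha>)"
proof -
  have "euler_fold ss f \<in> CC q \<and>
    (gs \<in> gens q \<longrightarrow> co X n (lookup (euler_fold ss f gs) \<alpha>)
      = (\<Prod>k\<leftarrow>ss. of_int (wt gs \<alpha> n X) - k) * co X n (lookup (f gs) \<alpha>))"
    using assms
  proof (induction ss arbitrary: f)
    case (Cons k ss)
    let ?g = "HC.E f - csmult k f"
    have g: "?g \<in> CC q" using Cons.prems by (intro HC.C_diff HC.E_closed HC.C_scale)
    have step: "co X n (lookup (?g gs) \<alpha>) = (of_int (wt gs \<alpha> n X) - k) * co X n (lookup (f gs) \<alpha>)"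
      if "gs \<in> gens q"
      using co_E[OF Cons.prems that, of X n \<alpha>]
      by (simp add: lookup_minus co_diff lookup_csmult co_scale left_diff_distrib)
    show ?case
    proof (intro conjI impI)
      show "euler_fold (k # ss) f \<in> CC q"
        using conjunct1[OF Cons.IH[OF g]] by (simp only: fold_Cons o_apply)
      assume gs: "gs \<in> gens q"
      show "co X n (lookup (euler_fold (k # ss) f gs) \<alpha>)
          = (\<Prod>k\<leftarrow>k # ss. of_int (wt gs \<alpha> n X) - k) * co X n (lookup (f gs) \<alpha>)"
        using conjunct2[OF Cons.IH[OF g], rule_format, OF gs] step[OF gs]
        by (simp only: fold_Cons o_apply list.map prod_list.Cons mult_ac)
    qed
  qed simp
  then show "euler_fold ss f \<in> CC q"
    "gs \<in> gens q \<Longrightarrow> co X n (lookup (euler_fold ss f gs) \<alpha>)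
      = (\<Prod>k\<leftarrow>ss. of_int (wt gs \<alpha> n X) - k) * co X n (lookup (f gs) \<alpha>)" by auto
qed

text \<open>
  The list \<open>ss\<close> consists of the nonzero weights that occur in \<open>f\<close>, so that its product annihilates
  the corresponding components. These are finitely many, since there are finitely many lists of
  generators of length \<open>q\<close> and the values of \<open>f\<close> are polynomials.
\<close>

lemma semisimple:
  assumes f: "f \<in> CC q"
  shows "\<exists>ss. 0 \<notin> set ss \<and> HC.E (euler_fold ss f) = 0"
proof -
  let ?deg = "\<lambda>gs \<alpha> X. degree ((if X then cH else cL) (lookup (f gs) \<alpha>))"
  \<comment> \<open>All weights of nonzero coefficients of \<open>f\<close> lie in \<open>W\<close>.\<close>
  define W where "W = (\<Union>gs\<in>gens q. \<Union>\<alpha>\<in>keys (f gs). \<Union>X. (\<lambda>n. wt gs \<alpha> n X) ` {..?deg gs \<alpha> X})"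
  have fin: "finite W" by (auto simp: W_def finite_gens)
  define ss :: "'f list" where "ss = map of_int (sorted_list_of_set (W - {0}))"
  have set_ss: "set ss = of_int ` (W - {0})" using fin by (simp add: ss_def)
  let ?g = "euler_fold ss f"
  have "HC.E ?g = 0"
  proof (rule cochain_gens_eq_0[OF HC.E_closed[OF fold_E(1)[OF f]]])
    fix gs assume gs: "gs \<in> gens q"
    have "co X n (lookup (HC.E ?g gs) \<alpha>) = 0" for X n \<alpha>
    proof (cases "co X n (lookup (f gs) \<alpha>) = 0")
      case False
      then have "\<alpha> \<in> keys (f gs)" by (auto simp: in_keys_iff)
      moreover have "n \<le> ?deg gs \<alpha> X"
        using False by (auto simp: co_def intro: le_degree)
      ultimately have "wt gs \<alpha> n X \<in> W" using gs unfolding W_def by blast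
      then have "wt gs \<alpha> n X = 0 \<or> of_int (wt gs \<alpha> n X) \<in> set ss" by (auto simp: set_ss)
      then have "of_int (wt gs \<alpha> n X) * (\<Prod>k\<leftarrow>ss. of_int (wt gs \<alpha> n X) - k) = (0 :: 'f)"
        by (auto simp: prod_list_zero_iff)
      then show ?thesis
        unfolding co_E[OF fold_E(1)[OF f] gs] fold_E(2)[OF f gs]
        by (simp only: mult.assoc[symmetric] mult_zero_left)
    next
      case True
      then show ?thesis
        unfolding co_E[OF fold_E(1)[OF f] gs] fold_E(2)[OF f gs] by simp
    qed
    then have "lookup (HC.E ?g gs) \<alpha> = 0" for \<alpha>
      using co_eqI[of "lookup (HC.E ?g gs) \<alpha>" 0] by simp
    then show "HC.E ?g gs = 0" by (intro poly_mapping_eqI) simp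
  qed
  moreover have "0 \<notin> set ss" by (auto simp: set_ss)
  ultimately show ?thesis by blast
qed

text \<open>
  Skew-symmetry permutes arguments and variables together; if two arguments are equal, exchanging
  them affects only the variables.
\<close>

lemma lookup_skew:
  assumes f: "f \<in> CC q" and gs: "length gs = q" and ij: "i < q" "j < q" "i \<noteq> j" "gs ! i = gs ! j"
  shows "lookup (f gs) (map_key (Transposition.transpose i j) \<alpha>) = - lookup (f gs) \<alpha>"
proof -
  let ?t = "Transposition.transpose i j" and ?u = "f gs"
  define v where "v = (\<Sum>\<beta>\<in>keys ?u. single (map_key ?t \<beta>) (lookup ?u \<beta>))"
  have perm: "?t permutes {..<q}" using ij by (intro permutes_swap_id) auto
  have "v = - ?u"
  proof (rule PA.eval_inject)
    fix x :: "nat \<Rightarrow> 'f"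
    let ?us = "zip gs (map x [0..<q])"
    have "permute_list ?t ?us = zip gs (map (x \<circ> ?t) [0..<q])"
    proof (rule nth_equalityI)
      fix k assume "k < length (permute_list ?t ?us)"
      then have k: "k < q" using gs by simp
      then have "?t k < q" using permutes_in_image[OF perm, of k] by simp
      moreover have "gs ! ?t k = gs ! k" using ij(4) by (auto simp: Transposition.transpose_def)
      ultimately show "permute_list ?t ?us ! k = zip gs (map (x \<circ> ?t) [0..<q]) ! k"
        using k gs by (simp add: permute_list_def)
    qed (use gs in simp)
    then have "hat f (zip gs (map (x \<circ> ?t) [0..<q])) = - hat f ?us"
      using alternating_permute[OF cochain_alternating[OF f], of ?t ?us] perm gs ij
      by (simp add: sign_swap_id)
    then have "eval s (x \<circ> ?t) ?u = - eval s x ?u"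
      by (simp add: eval_eq_hat[OF cochain_local_on[OF f] gs])
    moreover have "eval s x v = eval s (x \<circ> ?t) ?u"
      by (simp add: v_def PA.eval_sum mval_map_key_transpose eval_def[of _ "x \<circ> ?t"])
    ultimately show "eval s x v = eval s x (- ?u)" by (simp add: PA.eval_uminus)
  qed
  moreover have "lookup v (map_key ?t \<alpha>) = lookup ?u \<alpha>"
  proof -
    have eq: "map_key ?t \<beta> = map_key ?t \<alpha> \<longleftrightarrow> \<beta> = \<alpha>" for \<beta> :: "nat \<Rightarrow>\<^sub>0 nat"
      by (metis map_key_transpose_invol)
    show ?thesis
      by (simp add: v_def lookup_sum lookup_single when_def eq sum.delta in_keys_iff)
  qed
  ultimately show ?thesis by (metis lookup_uminus minus_minus)
qed

lemma lookup_repeated: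
  assumes "f \<in> CC q" "length gs = q" "i < q" "j < q" "i \<noteq> j" "gs ! i = gs ! j"
    and "lookup \<alpha> i = lookup \<alpha> j"
  shows "lookup (f gs) \<alpha> = 0"
proof -
  have "map_key (Transposition.transpose i j) \<alpha> = \<alpha>"
    using assms(7) by (intro poly_mapping_eqI) (auto simp: lookup_map_key_transpose Transposition.transpose_def)
  then have "lookup (f gs) \<alpha> = - lookup (f gs) \<alpha>"
    using lookup_skew[OF assms(1-6), of \<alpha>] by simp
  then have "lookup (f gs) \<alpha> + lookup (f gs) \<alpha> = 0" by (metis add.right_inverse)
  then have "s 2 (lookup (f gs) \<alpha>) = 0"
    by (metis one_add_one scale_left_distrib scale_one)
  then show ?thesis by (rule torsion_free) simp
qed

lemma tri_ge: "3 \<le> k \<Longrightarrow> k \<le> (\<Sum>i<k. i)" for k :: nat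
proof (induction k rule: dec_induct)
  case base
  show ?case by (simp add: numeral_3_eq_3)
qed simp

text \<open>
  Let \<open>k\<close> be the number of entries \<open>L\<close> and \<open>j\<close> that of entries \<open>H\<close>. The exponents at the former
  are distinct, and so are those at the latter, so \<open>\<bar>\<alpha>\<bar>\<close> is at least \<open>k(k - 1)/2 + j(j - 1)/2\<close>.
  Weight zero means \<open>\<bar>\<alpha>\<bar> + n + w = k\<close> with \<open>w \<ge> 1\<close>. The resulting inequality excludes
  \<open>k = 0\<close> and \<open>k \<ge> 3\<close>; for \<open>k = 1\<close> and \<open>k = 2\<close> it is sharp for \<open>w = 1\<close>, \<open>n = 0\<close> and \<open>j \<le> 1\<close>, and
  fails otherwise.
\<close>

lemma weight_zero_support:
  assumes f: "f \<in> CC q" "HC.E f = 0" and gs: "gs \<in> gens q"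
    and nz: "co X n (lookup (f gs) \<alpha>) \<noteq> 0"
  shows "X" "n = 0" "nL gs = 1 \<or> nL gs = 2" "q - nL gs \<le> 1" "mdeg q \<alpha> + 1 = nL gs"
proof -
  have len: "length gs = q" and mem: "\<And>i. i < q \<Longrightarrow> gs ! i = L \<or> gs ! i = H"
    using gs by (auto simp: gens_def dest: nth_mem)
  have "of_int (wt gs \<alpha> n X) * co X n (lookup (f gs) \<alpha>) = 0"
    using co_E[OF f(1) gs, of X n \<alpha>] f(2) by simp
  \<comment> \<open>In characteristic 0 the integer weight itself vanishes, not only its image in \<open>F\<close>.\<close>
  then have wt: "mdeg q \<alpha> + n + (if X then 1 else 2) = nL gs"
  proof -
    have "of_int (wt gs \<alpha> n X) = (0 :: 'f)" using \<open>of_int _ * _ = 0\<close> nz by simp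
    then have "wt gs \<alpha> n X = 0" by (simp only: of_int_eq_0_iff)
    then show ?thesis using len by (auto simp: wt_def split: if_splits)
  qed
  let ?g = "lookup \<alpha>"
  let ?P = "{i. i < q \<and> gs ! i = L}" and ?N = "{i. i < q \<and> gs ! i = H}"
  have part: "{..<q} = ?P \<union> ?N" "?P \<inter> ?N = {}" using mem distinct_generators by auto
  \<comment> \<open>Equal exponents at equal generators contradict skew-symmetry.\<close>
  have inj: "inj_on ?g {i. i < q \<and> gs ! i = a}" for a
  proof (rule inj_onI, rule ccontr)
    fix i j assume *: "i \<in> {i. i < q \<and> gs ! i = a}" "j \<in> {i. i < q \<and> gs ! i = a}" "?g i = ?g j" "i \<noteq> j"
    then have "lookup (f gs) \<alpha> = 0"
      using lookup_repeated[OF f(1) len, of i j \<alpha>] by simp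
    with nz show False by simp
  qed
  have P: "card ?P = nL gs" by (simp add: nL_def len)
  have card: "card ?P + card ?N = q" using part card_Un_disjoint[of ?P ?N] by (metis (no_types, lifting) card_lessThan finite_Un finite_lessThan)
  have "mdeg q \<alpha> = (\<Sum>i\<in>?P. ?g i) + (\<Sum>i\<in>?N. ?g i)"
    unfolding mdeg_def part(1) by (rule sum.union_disjoint) (use part in auto)
  moreover have "(\<Sum>i<card ?P. i) \<le> (\<Sum>i\<in>?P. ?g i)" "(\<Sum>i<card ?N. i) \<le> (\<Sum>i\<in>?N. ?g i)"
    by (intro sum_inj_nat_ge inj; simp)+
  ultimately have ineq: "(\<Sum>i<nL gs. i) + (\<Sum>i<card ?N. i) + n + (if X then 1 else 2) \<le> nL gs"
    using wt P by simp
  have k: "nL gs < 3"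
  proof (rule ccontr)
    assume "\<not> nL gs < 3"
    then have "nL gs \<le> (\<Sum>i<nL gs. i)" by (intro tri_ge) simp
    with ineq show False by (simp split: if_splits)
  qed
  then have "nL gs = 0 \<or> nL gs = 1 \<or> nL gs = 2" by auto
  then have *: "(nL gs = 1 \<or> nL gs = 2) \<and> X \<and> n = 0 \<and> (\<Sum>i<card ?N. i) = 0"
    using ineq by (auto simp: numeral_2_eq_2 split: if_splits)
  then have "card ?N \<le> 1"
  proof -
    have "card ?N \<le> 1 \<or> 2 \<le> card ?N" by auto
    moreover have "0 < (\<Sum>i<m. i)" if "2 \<le> m" for m :: nat
      by (rule sum_pos2[of _ 1]) (use that in auto)
    ultimately show ?thesis using * by (metis (no_types, lifting) less_irrefl)
  qed
  then show "X" "n = 0" "nL gs = 1 \<or> nL gs = 2" "q - nL gs \<le> 1" "mdeg q \<alpha> + 1 = nL gs"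
    using * wt P card by auto
qed

end

section \<open>Wedge products of one-forms\<close>

text \<open>The polynomial \<open>p(- \<lambda>\<^sub>i)\<close>.\<close>

definition mcoord :: "'f::field_char_0 poly \<Rightarrow> nat \<Rightarrow> 'f poly mpol" where
  "mcoord p i = (\<Sum>k\<le>degree p. const [:coeff p k:] * (- var i) ^ k)"

lemma rval_mcoord: "rval x (mcoord p i) = [:poly p (- x i):]"
proof -
  show ?thesis
    by (simp add: mcoord_def rval_simps const_poly_power poly_altdef const_poly_sum mult.commute)
qed

lemma mcoord_0_1: "mcoord 0 i = 0" "mcoord 1 i = 1"
  by (simp_all add: mcoord_def const_def flip: one_pCons)

text \<open>
  The product of a one-form with an alternating form, by the rule
  \<open>\<iota>\<^sub>u (\<xi> \<and> G) = \<xi>(u) G - \<xi> \<and> \<iota>\<^sub>u G\<close>. As for \<open>ce_d\<close>, the recursion makes linearity and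
  skew-symmetry straightforward inductions.
\<close>

primrec wedge :: "('u \<Rightarrow> 'r::comm_ring_1) \<Rightarrow> ('u list \<Rightarrow> 'r) \<Rightarrow> 'u list \<Rightarrow> 'r" where
  "wedge \<xi> G [] = 0"
| "wedge \<xi> G (u # us) = \<xi> u * G us - wedge \<xi> (\<lambda>ws. G (u # ws)) us"

primrec wedges :: "('u \<Rightarrow> 'r::comm_ring_1) list \<Rightarrow> 'u list \<Rightarrow> 'r" where
  "wedges [] us = (if us = [] then 1 else 0)"
| "wedges (\<xi> # \<xi>s) us = wedge \<xi> (wedges \<xi>s) us"

lemma wedge_add: "wedge \<xi> (\<lambda>ws. G ws + G' ws) us = wedge \<xi> G us + wedge \<xi> G' us"
  by (induction us arbitrary: G G') (auto simp: algebra_simps)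

lemma wedge_scale: "wedge \<xi> (\<lambda>ws. k * G ws) us = k * wedge \<xi> G us"
  by (induction us arbitrary: G) (auto simp: algebra_simps)

lemma wedge_uminus: "wedge \<xi> (\<lambda>ws. - G ws) us = - wedge \<xi> G us"
  using wedge_scale[of \<xi> "-1" G us] by simp

lemma wedge_0: "wedge \<xi> (\<lambda>ws. 0) us = 0"
  using wedge_scale[of \<xi> 0 "\<lambda>_. 0" us] by simp

lemma wedge_slot_add:
  assumes "\<xi> u = \<xi> v + \<xi> w"
    and "\<And>us vs. G (us @ u # vs) = G (us @ v # vs) + G (us @ w # vs)"
  shows "wedge \<xi> G (us @ u # vs) = wedge \<xi> G (us @ v # vs) + wedge \<xi> G (us @ w # vs)"
  using assms(2)
proof (induction us arbitrary: G)
  case Nil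
  have "(\<lambda>ws. G (u # ws)) = (\<lambda>ws. G (v # ws) + G (w # ws))" using Nil[of "[]"] by auto
  then show ?case by (simp add: assms(1) wedge_add algebra_simps)
next
  case (Cons t us)
  have "wedge \<xi> (\<lambda>ws. G (t # ws)) (us @ u # vs)
      = wedge \<xi> (\<lambda>ws. G (t # ws)) (us @ v # vs) + wedge \<xi> (\<lambda>ws. G (t # ws)) (us @ w # vs)"
    by (rule Cons.IH) (use Cons.prems[of "t # _"] in simp)
  with Cons.prems[of us vs] show ?case by (simp add: algebra_simps)
qed

lemma wedge_slot_scale:
  assumes "\<xi> u = k * \<xi> v" and "\<And>us vs. G (us @ u # vs) = k * G (us @ v # vs)"
  shows "wedge \<xi> G (us @ u # vs) = k * wedge \<xi> G (us @ v # vs)"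
  using assms(2)
proof (induction us arbitrary: G)
  case Nil
  have "(\<lambda>ws. G (u # ws)) = (\<lambda>ws. k * G (v # ws))" using Nil[of "[]"] by auto
  then show ?case by (simp add: assms(1) wedge_scale algebra_simps)
next
  case (Cons t us)
  have "wedge \<xi> (\<lambda>ws. G (t # ws)) (us @ u # vs) = k * wedge \<xi> (\<lambda>ws. G (t # ws)) (us @ v # vs)"
    by (rule Cons.IH) (use Cons.prems[of "t # _"] in simp)
  with Cons.prems[of us vs] show ?case by (simp add: algebra_simps)
qed

lemma wedge_alternating:
  assumes "\<And>us v w vs. G (us @ v # w # vs) = - G (us @ w # v # vs)"
  shows "wedge \<xi> G (us @ v # w # vs) = - wedge \<xi> G (us @ w # v # vs)"
  using assms
proof (induction us arbitrary: G)
  case Nil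
  have "(\<lambda>ws. G (v # w # ws)) = (\<lambda>ws. - G (w # v # ws))" using Nil[of "[]" v w] by auto
  then have "wedge \<xi> (\<lambda>ws. G (v # w # ws)) vs = - wedge \<xi> (\<lambda>ws. G (w # v # ws)) vs"
    by (simp only: wedge_uminus)
  then show ?case by simp
next
  case (Cons t us)
  have "wedge \<xi> (\<lambda>ws. G (t # ws)) (us @ v # w # vs) = - wedge \<xi> (\<lambda>ws. G (t # ws)) (us @ w # v # vs)"
    by (rule Cons.IH) (metis Cons.prems append_Cons)
  moreover have "G (us @ v # w # vs) = - G (us @ w # v # vs)" by (rule Cons.prems)
  ultimately show ?case by simp
qed

lemma wedge_length:
  assumes "\<And>ws. length ws \<noteq> n \<Longrightarrow> G ws = 0" "length us \<noteq> Suc n"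
  shows "wedge \<xi> G us = 0"
  using assms
proof (induction us arbitrary: n G)
  case (Cons u us)
  have "wedge \<xi> (\<lambda>ws. G (u # ws)) us = 0"
  proof (cases n)
    case 0
    then have "(\<lambda>ws. G (u # ws)) = (\<lambda>ws. 0)" using Cons.prems(1) by simp
    then show ?thesis by (simp only: wedge_0)
  next
    case (Suc m)
    show ?thesis by (rule Cons.IH[of m]) (use Cons.prems Suc in auto)
  qed
  with Cons.prems show ?case by simp
qed simp

lemma wedges_slot_add:
  "(\<And>\<xi>. \<xi> \<in> set \<xi>s \<Longrightarrow> \<xi> u = \<xi> v + \<xi> w) \<Longrightarrow>
    wedges \<xi>s (us @ u # vs) = wedges \<xi>s (us @ v # vs) + wedges \<xi>s (us @ w # vs)"
  by (induction \<xi>s arbitrary: us vs) (simp_all add: wedge_slot_add)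

lemma wedges_slot_scale:
  "(\<And>\<xi>. \<xi> \<in> set \<xi>s \<Longrightarrow> \<xi> u = k * \<xi> v) \<Longrightarrow> wedges \<xi>s (us @ u # vs) = k * wedges \<xi>s (us @ v # vs)"
  by (induction \<xi>s arbitrary: us vs) (simp_all add: wedge_slot_scale)

lemma wedges_alternating: "wedges \<xi>s (us @ v # w # vs) = - wedges \<xi>s (us @ w # v # vs)"
proof (induction \<xi>s arbitrary: us v w vs)
  case (Cons \<xi> \<xi>s)
  show ?case unfolding wedges.simps by (rule wedge_alternating) (rule Cons.IH)
qed simp

lemma wedges_length: "length us \<noteq> length \<xi>s \<Longrightarrow> wedges \<xi>s us = 0"
proof (induction \<xi>s arbitrary: us)
  case (Cons \<xi> \<xi>s)
  show ?case unfolding wedges.simps by (rule wedge_length[OF Cons.IH]) (use Cons.prems in auto)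
qed simp

lemma rval_wedge:
  assumes "\<And>u. rval x (\<xi> u) = [:\<xi>' (g u):]" "\<And>ws. rval x (G ws) = [:G' (map g ws):]"
  shows "rval x (wedge \<xi> G us) = [:wedge \<xi>' G' (map g us) :: 'f::field_char_0:]"
  using assms(2)
proof (induction us arbitrary: G G')
  case (Cons u us)
  have "rval x (wedge \<xi> (\<lambda>ws. G (u # ws)) us) = [:wedge \<xi>' (\<lambda>ws. G' (g u # ws)) (map g us):]"
    by (rule Cons.IH) (simp add: Cons.prems)
  then show ?case by (simp add: rval_simps assms(1) Cons.prems)
qed simp

lemma rval_wedges:
  assumes "list_all2 (\<lambda>\<xi> \<xi>'. \<forall>u. rval x (\<xi> u) = [:\<xi>' (g u):]) \<xi>s \<xi>s'"
  shows "rval x (wedges \<xi>s us) = [:wedges \<xi>s' (map g us) :: 'f::field_char_0:]"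
  using assms
proof (induction arbitrary: us rule: list_all2_induct)
  case Nil
  show ?case by simp
next
  case (Cons \<xi> \<xi>s \<xi>' \<xi>s')
  then show ?case by (simp add: rval_wedge)
qed

context W0_char0
begin

text \<open>
  The one-form \<open>a \<mapsto> \<lambda>\<^sup>n p(- \<lambda>)\<close>, where \<open>p\<close> is the coordinate of \<open>a\<close> selected by \<open>X\<close>, first
  as a polynomial and then as its value at \<open>\<lambda> = x\<close>.
\<close>

definition form :: "bool \<Rightarrow> nat \<Rightarrow> 'a \<times> nat \<Rightarrow> 'f poly mpol" where
  "form X n = (\<lambda>(a, i). var i ^ n * mcoord (if X then cH a else cL a) i)"

definition form_at :: "bool \<Rightarrow> nat \<Rightarrow> 'a \<times> 'f \<Rightarrow> 'f" where
  "form_at X n = (\<lambda>(a, x). x ^ n * poly (if X then cH a else cL a) (- x))"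

lemma rval_form: "rval x (form X n (a, i)) = [:form_at X n (a, x i):]"
proof -
  show ?thesis by (simp add: form_def form_at_def rval_simps rval_mcoord const_poly_power)
qed

lemma form_at_add: "form_at X n (a + b, x) = form_at X n (a, x) + form_at X n (b, x)"
  by (simp add: form_at_def coords_add algebra_simps)

lemma form_at_scale: "form_at X n (s p a, x) = poly p (- x) * form_at X n (a, x)"
  by (simp add: form_at_def coords_scale)

definition form_cochain :: "(bool \<times> nat) list \<Rightarrow> 'a list \<Rightarrow> 'a mpol" where
  "form_cochain fs as = pact s (wedges (map (\<lambda>(X, n). form X n) fs) (zip as [0..<length as])) (const H)"

lemma form_cochain_in: "form_cochain fs \<in> CC (length fs)"
proof (rule cochainsI)
  let ?W = "wedges (map (\<lambda>(X, n). form_at X n) fs)"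
  have "rval x (wedges (map (\<lambda>(X, n). form X n) fs) us) = [:?W (map (\<lambda>(a, i). (a, x i)) us):]" for x us
    by (rule rval_wedges) (auto simp: list_all2_conv_all_nth rval_form case_prod_beta)
  then have ev: "eval s x (form_cochain fs as) = s [:?W (zip as (map x [0..<length as])):] H" for x as
    by (simp add: form_cochain_def PA.eval_pact zip_map2)
  have hat: "hat (form_cochain fs) us = s [:?W us:] H" for us
    using ev[of "pt us" "map fst us"] by (simp add: hat_def zip_map_points)
  show "form_cochain fs as = 0" if "length as \<noteq> length fs" for as
    using that by (simp add: form_cochain_def wedges_length pact_def)
  show "local_on (length fs) (form_cochain fs)"
    unfolding local_on_def ev
    by (auto intro!: arg_cong[where f = "zip _"] arg_cong[where f = ?W] arg_cong2[where f = s])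
  have add: "?W (us @ (a + b, x) # vs) = ?W (us @ (a, x) # vs) + ?W (us @ (b, x) # vs)" for us vs a b x
    by (rule wedges_slot_add) (auto simp: form_at_add)
  have scale: "?W (us @ (s p a, x) # vs) = poly p (- x) * ?W (us @ (a, x) # vs)" for us vs p a x
    by (rule wedges_slot_scale) (auto simp: form_at_scale)
  show "slotwise (hat (form_cochain fs))"
    unfolding slotwise_def hat by (simp add: add scale mult.commute flip: scale_left_distrib)
  have "hat (form_cochain fs) (us @ v # u # vs) = - hat (form_cochain fs) (us @ u # v # vs)" for us v u vs
    unfolding hat using wedges_alternating[of "map (\<lambda>(X, n). form_at X n) fs" us v u vs]
    by (simp flip: scale_minus_left)
  then show "alternating (hat (form_cochain fs))" unfolding alternating_def by blast
qed

lemma form_gens: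
  "form False n (L, i) = var i ^ n" "form False n (H, i) = 0"
  "form True n (L, i) = 0" "form True n (H, i) = var i ^ n"
  by (simp_all add: form_def mcoord_0_1)

section \<open>The cohomology classes\<close>

text \<open>
  For each class, the list of generators and the monomial at which the coefficient of \<open>H\<close> detects
  it; \<open>single 0 1\<close> is the exponent vector of \<open>\<lambda>\<^sub>0\<close>.
\<close>

definition cls :: "nat \<Rightarrow> ('a list \<times> (nat \<Rightarrow>\<^sub>0 nat)) list" where
  "cls q = (if q = 1 then [([L], 0)]
    else if q = 2 then [([L, H], 0), ([L, L], single 0 1)]
    else if q = 3 then [([L, L, H], single 0 1)] else [])"

definition Phi :: "nat \<Rightarrow> ('a list \<Rightarrow> 'a mpol) \<Rightarrow> nat \<Rightarrow> 'f" where
  "Phi q f i = co True 0 (lookup (f (fst (cls q ! i))) (snd (cls q ! i)))"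

lemma nL_simps [simp]: "nL [] = 0" "nL (g # gs) = (if g = L then 1 else 0) + nL gs"
proof -
  have "nL gs = length (filter (\<lambda>g. g = L) gs)" for gs by (simp add: nL_def length_filter_conv_card)
  then show "nL [] = 0" "nL (g # gs) = (if g = L then 1 else 0) + nL gs" by simp_all
qed

lemma cls_gens: "i < length (cls q) \<Longrightarrow> fst (cls q ! i) \<in> gens q"
  by (auto simp: cls_def gens_def less_Suc_eq split: if_splits)

lemma cls_weight: "i < length (cls q) \<Longrightarrow> wt (fst (cls q ! i)) (snd (cls q ! i)) 0 True = 0"
  using distinct_generators
  by (auto simp: cls_def wt_def mdeg_def less_Suc_eq lookup_single when_def numeral_2_eq_2 numeral_3_eq_3 split: if_splits)

lemma Phi_add: "Phi q (f + g) i = Phi q f i + Phi q g i"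
  by (simp add: Phi_def lookup_add co_add)

lemma Phi_csmult: "Phi q (csmult k f) i = k * Phi q f i"
  by (simp add: Phi_def lookup_csmult co_scale)

lemma Phi_E: "f \<in> CC q \<Longrightarrow> i < length (cls q) \<Longrightarrow> Phi q (HC.E f) i = 0"
  unfolding Phi_def by (simp only: co_E[OF _ cls_gens] cls_weight) simp

lemma lookup_monomials:
  "lookup (pact s 1 (const H)) 0 = H"
  "lookup (pact s (var 0 - var 1) (const H)) (single 0 1) = H"
  "lookup (pact s (var 1 - var 0) (const H)) (single 0 1) = - H"
proof -
  have "pact s 1 (const H) = const H"
    by (rule PA.eval_inject) (simp add: PA.eval_pact)
  then show "lookup (pact s 1 (const H)) 0 = H" by (simp add: const_def)
  have *: "pact s (var i - var j) (const H) = single (single i 1) H - single (single j 1) H" for i j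
    by (rule PA.eval_inject) (simp add: PA.eval_pact PA.eval_diff rval_simps flip: scale_left_diff_distrib)
  have ne: "single (Suc 0) (Suc 0) \<noteq> single 0 (Suc 0)"
    by (metis lookup_single_eq lookup_single_not_eq nat.distinct(1))
  show "lookup (pact s (var 0 - var 1) (const H)) (single 0 1) = H"
    "lookup (pact s (var 1 - var 0) (const H)) (single 0 1) = - H"
    unfolding * using ne by (simp_all add: lookup_minus lookup_single when_def)
qed

text \<open>
  Representatives are wedge products of the one-forms \<open>\<lambda>\<^sup>n L\<^sup>*\<close> and \<open>H\<^sup>*\<close>, multiplied by \<open>H\<close>.
\<close>

lemma Phi_surj: "\<exists>f\<in>CC q. \<forall>i<length (cls q). Phi q f i = c i"
proof -
  have co: "co True 0 H = 1" by (simp add: co_def)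
  have forms: "form_cochain [(False, 0)] \<in> CC 1" "form_cochain [(False, 0), (True, 0)] \<in> CC 2"
    "form_cochain [(False, 1), (False, 0)] \<in> CC 2" "form_cochain [(False, 1), (False, 0), (True, 0)] \<in> CC 3"
    using form_cochain_in[of "[(False, 0)]"] form_cochain_in[of "[(False, 0), (True, 0)]"]
      form_cochain_in[of "[(False, 1), (False, 0)]"] form_cochain_in[of "[(False, 1), (False, 0), (True, 0)]"]
    by (simp_all add: numeral_2_eq_2 numeral_3_eq_3)
  have upt: "[0..<Suc 0] = [0]" "[0..<Suc (Suc 0)] = [0, 1]" "[0..<Suc (Suc (Suc 0))] = [0, 1, 2]"
    by (simp_all add: upt_rec)
  have 1: "form_cochain [(False, 0)] [L] = pact s 1 (const H)"
    "form_cochain [(False, 0), (True, 0)] [L, H] = pact s 1 (const H)"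
    "form_cochain [(False, 0), (True, 0)] [L, L] = 0"
    "form_cochain [(False, 1), (False, 0)] [L, H] = 0"
    "form_cochain [(False, 1), (False, 0)] [L, L] = pact s (var 0 - var 1) (const H)"
    "form_cochain [(False, 1), (False, 0), (True, 0)] [L, L, H] = pact s (var 0 - var 1) (const H)"
    by (simp_all add: form_cochain_def upt form_gens pact_def[of _ 0])
  consider "q = 1" | "q = 2" | "q = 3" | "q \<noteq> 1 \<and> q \<noteq> 2 \<and> q \<noteq> 3" by blast
  then show ?thesis
  proof cases
    case 1
    then show ?thesis
      using forms csmult_cochain[OF forms(1), of "c 0"] \<open>form_cochain [(False, 0)] [L] = _\<close>
      by (intro bexI[of _ "csmult (c 0) (form_cochain [(False, 0)])"])
        (auto simp: Phi_csmult, simp add: Phi_def cls_def lookup_monomials co)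
  next
    case 2
    let ?f = "csmult (c 0) (form_cochain [(False, 0), (True, 0)]) + csmult (c 1) (form_cochain [(False, 1), (False, 0)])"
    have "?f \<in> CC 2" by (intro add_cochain csmult_cochain forms)
    moreover have "Phi 2 ?f 0 = c 0" "Phi 2 ?f 1 = c 1"
      unfolding Phi_add Phi_csmult by (simp_all add: Phi_def cls_def 1 lookup_monomials co del: One_nat_def single_one)
    ultimately show ?thesis
      using 2 by (intro bexI[of _ ?f]) (auto simp: cls_def less_Suc_eq)
  next
    case 3
    let ?f = "csmult (c 0) (form_cochain [(False, 1), (False, 0), (True, 0)])"
    have "?f \<in> CC 3" by (intro csmult_cochain forms)
    moreover have "Phi 3 ?f 0 = c 0"
      unfolding Phi_csmult by (simp add: Phi_def cls_def 1 lookup_monomials co del: One_nat_def single_one)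
    ultimately show ?thesis
      using 3 by (intro bexI[of _ ?f]) (auto simp: cls_def less_Suc_eq)
  next
    case 4
    then show ?thesis using zero_cochain by (auto simp: cls_def)
  qed
qed

text \<open>
  By skew-symmetry a cochain is determined by its values on lists in which all \<open>L\<close> precede all
  \<open>H\<close>.
\<close>

lemma sorted_gens_eq_0:
  assumes f: "f \<in> CC q" and 0: "\<And>k j. k + j = q \<Longrightarrow> f (replicate k L @ replicate j H) = 0"
  shows "f = 0"
proof (rule cochain_gens_eq_0[OF f])
  fix gs assume gs: "gs \<in> gens q"
  then have len: "length gs = q" by (simp add: gens_def)
  define k j where "k = length (filter (\<lambda>g. g = L) gs)" and "j = length (filter (\<lambda>g. g \<noteq> L) gs)"
  have "filter (\<lambda>g. g = L) gs = replicate k L"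
    by (rule replicate_eqI) (auto simp: k_def)
  moreover have "filter (\<lambda>g. g \<noteq> L) gs = replicate j H"
    by (rule replicate_eqI) (use gs in \<open>auto simp: j_def gens_def\<close>)
  ultimately have mset: "mset (replicate k L @ replicate j H) = mset gs"
    using multiset_partition[of "mset gs" "\<lambda>g. g = L"] by (metis mset_append mset_filter)
  then have kj: "k + j = q" using len mset_eq_length[OF mset] by simp
  obtain \<pi> where \<pi>: "\<pi> permutes {..<length gs}" "permute_list \<pi> gs = replicate k L @ replicate j H"
    using mset_eq_permutation[OF mset] by blast
  show "f gs = 0"
  proof (rule PA.eval_eq_0)
    fix x :: "nat \<Rightarrow> 'f"
    let ?us = "zip gs (map x [0..<q])"
    have "map fst (permute_list \<pi> ?us) = permute_list \<pi> (map fst ?us)"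
      using permute_list_map[of \<pi> ?us fst] \<pi>(1) len by simp
    also have "\<dots> = replicate k L @ replicate j H" using \<pi>(2) len by simp
    finally have "hat f (permute_list \<pi> ?us) = 0"
      using 0[OF kj] by (simp add: hat_def)
    then have "s (of_int (sign \<pi>)) (hat f ?us) = 0"
      using alternating_permute[OF cochain_alternating[OF f], of \<pi> ?us] \<pi>(1) len by simp
    then have "hat f ?us = 0" by (rule torsion_free) (simp add: sign_def)
    then show "eval s x (f gs) = 0"
      using eval_eq_hat[OF cochain_local_on[OF f] len] by simp
  qed
qed

lemma co_eq_0: "(\<And>X n. co X n a = 0) \<Longrightarrow> a = 0"
  using co_eqI[of a 0] by simp

lemma lookup_weight_zero:
  assumes f: "f \<in> CC q" "HC.E f = 0" and gs: "gs \<in> gens q" and nz: "lookup (f gs) \<alpha> \<noteq> 0"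
  shows "co True 0 (lookup (f gs) \<alpha>) \<noteq> 0" "nL gs = 1 \<or> nL gs = 2" "q - nL gs \<le> 1" "mdeg q \<alpha> + 1 = nL gs"
proof -
  obtain X n where Xn: "co X n (lookup (f gs) \<alpha>) \<noteq> 0" using co_eq_0 nz by blast
  note W = weight_zero_support[OF f gs Xn]
  from W(1,2) Xn show "co True 0 (lookup (f gs) \<alpha>) \<noteq> 0" "nL gs = 1 \<or> nL gs = 2" "q - nL gs \<le> 1" "mdeg q \<alpha> + 1 = nL gs"
    using W(3-5) by auto
qed

lemma nL_replicate: "nL (replicate k L @ replicate j H) = k"
proof -
  have "nL (replicate j H) = 0" using distinct_generators by (induction j) auto
  then show ?thesis by (induction k) auto
qed

text \<open>
  On a sorted list with one \<open>L\<close> only the constant monomial can occur, and it is detected by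
  \<open>Phi\<close>. With two \<open>L\<close> only \<open>\<lambda>\<^sub>0\<close> and \<open>\<lambda>\<^sub>1\<close> can occur, with opposite coefficients, and
  the first is detected.
\<close>

lemma Phi_inj:
  assumes f: "f \<in> CC q" "HC.E f = 0" and 0: "\<And>i. i < length (cls q) \<Longrightarrow> Phi q f i = 0"
  shows "f = 0"
proof (rule sorted_gens_eq_0[OF f(1)], rule ccontr)
  fix k j assume kj: "k + j = q"
  let ?gs = "replicate k L @ replicate j H"
  assume "f ?gs \<noteq> 0"
  then obtain \<alpha> where \<alpha>: "lookup (f ?gs) \<alpha> \<noteq> 0"
    by (metis poly_mapping_eqI lookup_zero)
  have gs: "?gs \<in> gens q" using kj by (auto simp: gens_def)
  then have len: "length ?gs = q" by (simp add: gens_def)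
  note W = lookup_weight_zero[OF f gs, unfolded nL_replicate]
  have k: "k = 1 \<or> k = 2" and j: "j = 0 \<or> j = 1" and deg: "mdeg q \<alpha> + 1 = k"
    using W(2-4)[OF \<alpha>] kj by auto
  have keys: "i < q" if "lookup \<alpha> i \<noteq> 0" for i
    using cochain_keys[OF f(1) len, of \<alpha> i] \<alpha> that by (simp add: in_keys_iff)
  have le: "lookup \<alpha> i \<le> mdeg q \<alpha>" for i
    using keys[of i] by (cases "lookup \<alpha> i = 0") (auto simp: mdeg_def intro: member_le_sum)
  from k show False
  proof
    assume k1: "k = 1"
    then have "\<alpha> = 0" using deg le by (intro poly_mapping_eqI) auto
    with W(1)[OF \<alpha>] have "co True 0 (lookup (f ?gs) 0) \<noteq> 0" by simp
    then show False
      using j 0[of 0] k1 kj by (auto simp: cls_def Phi_def)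
  next
    assume k2: "k = 2"
    then have q: "0 < q" "1 < q" "?gs ! 0 = ?gs ! 1" using kj by (auto simp: numeral_2_eq_2)
    let ?e = "single 0 1 :: nat \<Rightarrow>\<^sub>0 nat" and ?t = "Transposition.transpose 0 1 :: nat \<Rightarrow> nat"
    have e: "lookup (f ?gs) ?e = 0"
    proof (rule ccontr)
      assume "lookup (f ?gs) ?e \<noteq> 0"
      then have "co True 0 (lookup (f ?gs) ?e) \<noteq> 0" by (rule W(1))
      then show False
        using j 0[of 0] 0[of 1] k2 kj by (auto simp: cls_def Phi_def numeral_2_eq_2 numeral_3_eq_3 simp del: single_one)
    qed
    have "lookup (f ?gs) (map_key ?t ?e) = 0"
      using lookup_skew[OF f(1) len q(1,2) _ q(3), of ?e] e by simp
    \<comment> \<open>The total degree is 1 and the exponents of \<open>\<lambda>\<^sub>0\<close> and \<open>\<lambda>\<^sub>1\<close> differ.\<close>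
    moreover have "\<alpha> = ?e \<or> \<alpha> = map_key ?t ?e"
    proof -
      have ne: "lookup \<alpha> 0 \<noteq> lookup \<alpha> 1"
        using lookup_repeated[OF f(1) len q(1,2) _ q(3), of \<alpha>] \<alpha> by auto
      have deg1: "mdeg q \<alpha> = 1" using deg k2 by simp
      have "{..<q} = {0, 1} \<union> {2..<q}" using q by auto
      then have sum: "lookup \<alpha> 0 + lookup \<alpha> 1 + (\<Sum>i\<in>{2..<q}. lookup \<alpha> i) = 1"
        using deg1 unfolding mdeg_def by (simp add: sum.union_disjoint)
      then have rest: "lookup \<alpha> i = 0" if "i \<noteq> 0" "i \<noteq> 1" for i
      proof (rule_tac ccontr)
        assume nz: "lookup \<alpha> i \<noteq> 0"
        then have "i \<in> {2..<q}" using keys[OF nz] that by auto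
        then have "lookup \<alpha> i \<le> (\<Sum>i\<in>{2..<q}. lookup \<alpha> i)"
          by (intro member_le_sum) auto
        with sum nz ne show False by auto
      qed
      have "(lookup \<alpha> 0 = 1 \<and> lookup \<alpha> 1 = 0) \<or> (lookup \<alpha> 0 = 0 \<and> lookup \<alpha> 1 = 1)"
        using sum ne by auto
      then show ?thesis
      proof
        assume *: "lookup \<alpha> 0 = 1 \<and> lookup \<alpha> 1 = 0"
        have "lookup \<alpha> i = lookup ?e i" for i
          using * rest[of i] by (cases "i = 0"; cases "i = 1") (auto simp: lookup_single when_def simp del: single_one)
        then show ?thesis by (auto intro: poly_mapping_eqI)
      next
        assume *: "lookup \<alpha> 0 = 0 \<and> lookup \<alpha> 1 = 1"
        have "lookup \<alpha> i = lookup (map_key ?t ?e) i" for i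
          using * rest[of i]
          by (cases "i = 0"; cases "i = 1")
            (auto simp: lookup_map_key_transpose lookup_single when_def Transposition.transpose_def simp del: single_one)
        then show ?thesis by (auto intro: poly_mapping_eqI)
      qed
    qed
    ultimately show False using e \<alpha> by auto
  qed
qed

lemma weight_zero_value:
  assumes f: "f \<in> CC q" "HC.E f = 0" and us: "map fst us \<in> gens q"
  shows "cL (hat f us) = 0"
proof -
  let ?gs = "map fst us"
  have "cL (lookup (f ?gs) \<alpha>) = 0" for \<alpha>
  proof (rule poly_eqI)
    fix n
    show "coeff (cL (lookup (f ?gs) \<alpha>)) n = coeff 0 n"
      using weight_zero_support(1)[OF f us, of False n \<alpha>] by (auto simp: co_def)
  qed
  moreover have "cL (sum g A) = (\<Sum>i\<in>A. cL (g i))" for g and A :: "(nat \<Rightarrow>\<^sub>0 nat) set"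
    by (induction A rule: infinite_finite_induct) (auto simp: coords_add)
  ultimately show ?thesis by (simp add: hat_sum coords_scale)
qed

lemma weight_zero_nL_0:
  assumes f: "f \<in> CC q" "HC.E f = 0" and us: "map fst us \<in> gens q" "nL (map fst us) = 0"
  shows "hat f us = 0"
proof -
  have "f (map fst us) = 0"
    using lookup_weight_zero(2)[OF f us(1)] us(2) by (intro poly_mapping_eqI) fastforce
  then show ?thesis by (simp add: hat_def)
qed

lemma weight_zero_nL_1:
  assumes f: "f \<in> CC q" "HC.E f = 0" and gs: "gs \<in> gens q" "nL gs = 1"
  shows "\<exists>c. \<forall>us. map fst us = gs \<longrightarrow> hat f us = s [:c:] H"
proof -
  have len: "length gs = q" using gs by (simp add: gens_def)
  have zero: "\<alpha> = 0" if "lookup (f gs) \<alpha> \<noteq> 0" for \<alpha>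
  proof -
    have "mdeg q \<alpha> = 0" using lookup_weight_zero(4)[OF f gs(1) that] gs(2) by simp
    moreover have "i < q" if "lookup \<alpha> i \<noteq> 0" for i
      using cochain_keys[OF f(1) len, of \<alpha> i] that \<open>lookup (f gs) \<alpha> \<noteq> 0\<close> by (simp add: in_keys_iff)
    ultimately show ?thesis by (intro poly_mapping_eqI) (fastforce simp: mdeg_def)
  qed
  let ?m = "lookup (f gs) 0"
  have single: "f gs = single 0 ?m"
    by (rule poly_mapping_eqI) (use zero in \<open>auto simp: lookup_single when_def\<close>)
  have H: "?m = s [:co True 0 ?m:] H"
  proof (rule co_eqI)
    fix X n
    show "co X n ?m = co X n (s [:co True 0 ?m:] H)"
    proof (cases "X \<and> n = 0")
      case False
      then have "co X n ?m = 0" using weight_zero_support(1,2)[OF f gs(1), of X n 0] by blast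
      moreover have "co X n H = 0" using False by (cases n) (auto simp: co_def)
      ultimately show ?thesis by (simp add: co_scale)
    qed (simp add: co_scale, simp add: co_def)
  qed
  have "hat f us = s [:co True 0 ?m:] H" if "map fst us = gs" for us
  proof -
    have "hat f us = eval s (pt us) (single 0 ?m)"
      using that single by (metis hat_def)
    also have "\<dots> = ?m" by (simp flip: one_pCons)
    finally show ?thesis using H by simp
  qed
  then show ?thesis by blast
qed

lemma ce_d_small:
  "ce_d G [u, v] = app u (G [v]) - G [brk u v] - app v (G [u])"
  "ce_d G [u, v, w] = app u (G [v, w]) - G [brk u v, w] - G [v, brk u w]
    - (app v (G [u, w]) - G [u, brk v w] - app w (G [u, v]))"
  by (simp_all add: ce_d.simps lie_d.simps)

lemma brk_gens: "brk (L, x) (L, y) = (s [:2 * x, 1:] L, x + y)" "brk (L, x) (H, y) = (s [:x, 1:] H, x + y)"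
  by (simp_all add: lbr_def act_gens)

text \<open>
  The differential of a cochain of weight zero has weight zero, so by \<open>Phi_inj\<close> it suffices to
  compute its values on the lists in \<open>cls\<close>. In degree 0 there is no cochain of weight zero, and the
  lists that remain are \<open>(L, L)\<close>, \<open>(L, H)\<close> and \<open>(L, L, H)\<close>.
\<close>

lemma differential_weight_zero:
  assumes f: "f \<in> CC q" "HC.E f = 0"
  shows "df f = 0"
proof (rule Phi_inj)
  show df: "df f \<in> CC (Suc q)" by (rule differential_cochain[OF f(1)])
  show "HC.E (df f) = 0" using HC.d_E[OF f(1)] f(2) HC.d_0 by simp
  fix i assume i: "i < length (cls (Suc q))"
  let ?gs = "fst (cls (Suc q) ! i)"
  note slot = slotwiseD[OF cochain_slotwise[OF f(1)]]
  have LH: "L \<noteq> H" "H \<noteq> L" using distinct_generators by auto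
  have scH: "s p (s r H) = s (p * r) H" for p r by simp
  have "q = 0 \<or> q = 1 \<or> q = 2" using i by (auto simp: cls_def split: if_splits)
  then have "df f ?gs = 0"
  proof (elim disjE)
    assume q: "q = 0"
    have "f = 0" by (rule Phi_inj[OF f]) (simp add: cls_def q)
    then show ?thesis using HC.d_0 by simp
  next
    assume q: "q = 1"
    obtain c where c: "\<And>us. map fst us = [L] \<Longrightarrow> hat f us = s [:c:] H"
      using weight_zero_nL_1[OF f, of "[L]"] q by (auto simp: gens_def)
    have H0: "hat f [(H, x)] = 0" for x
      by (rule weight_zero_nL_0[OF f]) (use q LH in \<open>auto simp: gens_def\<close>)
    have LL: "ce_d (hat f) [(L, x), (L, y)] = 0" for x y
      unfolding ce_d_small brk_gens
      by (simp add: slot(4) c app_scale_right act_gens del: scale_scale)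
        (simp add: algebra_simps flip: scale_left_diff_distrib)
    have LH: "ce_d (hat f) [(L, x), (H, y)] = 0" for x y
      unfolding ce_d_small brk_gens
      by (simp add: slot(4) c H0 app_scale_right act_gens)
    have "?gs = [L, L] \<or> ?gs = [L, H]"
      using i q by (auto simp: cls_def less_Suc_eq)
    then show ?thesis
      using LL LH by (intro PA.eval_eq_0) (auto simp: eval_differential[OF f(1)])
  next
    assume q: "q = 2"
    obtain c where c: "\<And>us. map fst us = [L, H] \<Longrightarrow> hat f us = s [:c:] H"
      using weight_zero_nL_1[OF f, of "[L, H]"] q LH by (auto simp: gens_def)
    have "cL (hat f [(L, x), (L, y)]) = 0" for x y
      by (rule weight_zero_value[OF f]) (simp add: gens_def q)
    then have "hat f [(L, x), (L, y)] = s (cH (hat f [(L, x), (L, y)])) H" for x y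
      using coords[of "hat f [(L, x), (L, y)]"] by simp
    \<comment> \<open>The value on \<open>(L, L)\<close> is a multiple of \<open>H\<close>, on which \<open>H\<close> acts trivially.\<close>
    then have HLL: "app (H, z) (hat f [(L, x), (L, y)]) = 0" for x y z
      by (metis app_H_H)
    have slot2: "hat f [u, (s p a, x)] = s [:poly p (- x):] (hat f [u, (a, x)])" for u p a x
      using slot(2)[of "[u]" p a x "[]"] by simp
    have LLH: "ce_d (hat f) [(L, x), (L, y), (H, z)] = 0" for x y z
      unfolding ce_d_small brk_gens
      by (simp add: slot(4) slot2 c HLL app_scale_right act_gens del: scale_scale)
        (simp add: algebra_simps flip: scale_left_diff_distrib scale_left_distrib)
    have "?gs = [L, L, H]" using i q by (auto simp: cls_def)
    then show ?thesis
      using LLH by (intro PA.eval_eq_0) (auto simp: eval_differential[OF f(1)])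
  qed
  then show "Phi (Suc q) (df f) i = 0" by (simp add: Phi_def)
qed

theorem euler_complex_W0:
  "euler_complex csmult CC df (cochain_del s) (contraction L 0) (contraction L 1) (\<lambda>q. length (cls q)) Phi"
  by unfold_locales
    (use semisimple Phi_add Phi_csmult Phi_E Phi_inj differential_weight_zero Phi_surj in blast)+

end

theorem theorem4p3:
  fixes s :: "'f::field_char_0 poly \<Rightarrow> 'a::ab_group_add \<Rightarrow> 'a"
    and br :: "'a \<Rightarrow> 'a \<Rightarrow> 'a poly"
    and L H :: 'a
    and q :: nat
  assumes "W0_algebra s br L H"
  shows "has_dim (basic_cohomology s br s br q)
           (if q = 1 \<or> q = 3 then 1 else if q = 2 then 2 else 0)
       \<and> has_dim (reduced_cohomology s br s br q)
           (if q = 1 \<or> q = 2 then 3 else if q = 0 \<or> q = 3 then 1 else 0)"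
proof -
  interpret W0_char0 s br L H using assms by (simp add: W0_char0_def)
  have "has_dim (basic_cohomology s br s br q) (length (cls q))"
    "has_dim (reduced_cohomology s br s br q) (length (cls q) + length (cls (Suc q)))"
    by (rule cohomology_dimensions[OF euler_complex_W0])+
  moreover have "length (cls q) = (if q = 1 \<or> q = 3 then 1 else if q = 2 then 2 else 0)"
    "length (cls q) + length (cls (Suc q)) = (if q = 1 \<or> q = 2 then 3 else if q = 0 \<or> q = 3 then 1 else 0)"
    by (auto simp: cls_def)
  ultimately show ?thesis by simp
qed

end
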